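(* Let $\Phi$ be an irreducible crystallographic root system of rank $\ell$, $m\ge1$ and $0\le k\le\ell$. The number $f^+_{k-1}(\Phi,m)$ equals each of: (i) the number of pairs $(R,S)$ with $R$ a bounded dominant region of $\mathcal A^m_\Phi$ and $S$ a set of $\ell-k$ walls of $R$ of the form $H_{\alpha,m}$ which do not separate $R$ from $A_\circ$; (ii) the number of pairs $(\mathcal J,T)$ with $\mathcal J$ a positive geometric chain of ideals in $\Phi^+$ of length $m$ and $T$ a set of $\ell-k$ roots indecomposable of rank $m$ with respect to $\mathcal J$; (iii) the cardinality of $\mathcal F^+_k(\Phi,m)$.
   Context: $\Phi$ spans Euclidean $V$; positive system $\Phi^+$, simple roots $\Pi=\{\sigma_i\}$, highest root $\tilde\alpha$. $H_{\alpha,k}=\{x:(\alpha,x)=k\}$, $H^\mp_{\alpha,r}=\{x:(\alpha,x)\lessgtr r\}$. $\mathcal A^m_\Phi$: all $H_{\alpha,k}$, $\alpha\in\Phi$, $0\le k\le m$; dominant = inside $\{x:(\alpha,x)>0\ \forall\alpha\in\Phi^+\}$; $A_\circ=\{x:(\sigma_i,x)>0,(\tilde\alpha,x)<1\}$; walls support facets of closures; not separating = same open half-space. $h^+_i(\Phi,m)$ is the number of bounded dominant regions $R$ of $\mathcal A^m_\Phi$ with exactly $\ell-i$ walls of the form $H_{\alpha,m}$ not separating $R$ from $A_\circ$; $f^+_{i-1}(\Phi,m)$ are defined by $\sum_{i=0}^\ell f^+_{i-1}(\Phi,m)(x-1)^{\ell-i}=\sum_{i=0}^\ell h^+_i(\Phi,m)x^{\ell-i}$.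 Root poset: $\alpha\le\beta$ iff $\beta-\alpha$ is a nonnegative combination of positive roots; ideals are down-closed. Positive geometric chain of ideals of length $m$: ideals $\emptyset=\mathcal J_0\subseteq\cdots\subseteq\mathcal J_m$ with $(\mathcal J_i+\mathcal J_j)\cap\Phi^+\subseteq\mathcal J_{i+j}$ ($i+j\le m$), $(\mathcal I_i+\mathcal I_j)\cap\Phi^+\subseteq\mathcal I_{i+j}$ (all $i,j$; $\mathcal I_i=\Phi^+\setminus\mathcal J_i$ for $i\le m$, $\mathcal I_i=\mathcal I_m$ for $i>m$) and $\Pi\subseteq\mathcal J_m$; $\alpha$ is indecomposable of rank $m$ if it is maximal in $\mathcal J_m\setminus\mathcal J_{m-1}$ and not $\beta+\gamma$ with $\beta\in\mathcal J_i,\gamma\in\mathcal J_j$, $i,j\ge1$, $i+j=m$. $\mathcal F^+_k(\Phi,m)$ is the collection of nonempty $k$-dimensional sets $\bigcap_{(\alpha,r)\in\Phi^+\times\{0,\dots,m\}}\tilde H_{\alpha,r}$ with $\tilde H_{\alpha,0}=H^+_{\alpha,0}$, $\tilde H_{\alpha,m}\in\{H^-_{\alpha,m},H^+_{\alpha,m},H_{\alpha,m}\}$, $\tilde H_{\alpha,r}\in\{H^-_{\alpha,r},H^+_{\alpha,r}\}$ for $1\le r<m$, which are bounded (equivalently, $\tilde H_{\sigma_i,m}\in\{H^-_{\sigma_i,m},H_{\sigma_i,m}\}$ for all $i$). *)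

theory Defs
  imports "HOL-Analysis.Analysis"
begin

definition rreflect :: "'a::euclidean_space \<Rightarrow> 'a \<Rightarrow> 'a" where
  "rreflect \<alpha> x = x - ((2 * (x \<bullet> \<alpha>)) / (\<alpha> \<bullet> \<alpha>)) *\<^sub>R \<alpha>"

definition root_system :: "'a::euclidean_space set \<Rightarrow> bool" where
  "root_system \<Phi> \<longleftrightarrow> finite \<Phi> \<and> 0 \<notin> \<Phi> \<and> span \<Phi> = UNIV \<and>
     (\<forall>\<alpha>\<in>\<Phi>. \<forall>\<beta>\<in>\<Phi>. rreflect \<alpha> \<beta> \<in> \<Phi>) \<and>
     (\<forall>\<alpha>\<in>\<Phi>. \<forall>c::real. c *\<^sub>R \<alpha> \<in> \<Phi> \<longleftrightarrow> c = 1 \<or> c = -1)"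

definition crystallographic :: "'a::euclidean_space set \<Rightarrow> bool" where
  "crystallographic \<Phi> \<longleftrightarrow> (\<forall>\<alpha>\<in>\<Phi>. \<forall>\<beta>\<in>\<Phi>. (2 * (\<beta> \<bullet> \<alpha>)) / (\<alpha> \<bullet> \<alpha>) \<in> \<int>)"

definition irreducible_rs :: "'a::euclidean_space set \<Rightarrow> bool" where
  "irreducible_rs \<Phi> \<longleftrightarrow> \<not> (\<exists>A B. A \<noteq> {} \<and> B \<noteq> {} \<and> A \<union> B = \<Phi> \<and> A \<inter> B = {} \<and>
      (\<forall>a\<in>A. \<forall>b\<in>B. a \<bullet> b = 0))"

definition positive_system :: "'a::euclidean_space set \<Rightarrow> 'a set \<Rightarrow> bool" where
  "positive_system \<Phi> P \<longleftrightarrow> (\<exists>v. (\<forall>\<alpha>\<in>\<Phi>. \<alpha> \<bullet> v \<noteq> 0) \<and> P = {\<alpha>\<in>\<Phi>. \<alpha> \<bullet> v > 0})"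

definition nonneg_comb :: "'a::euclidean_space set \<Rightarrow> 'a \<Rightarrow> bool" where
  "nonneg_comb S x \<longleftrightarrow> (\<exists>c. (\<forall>s\<in>S. c s \<ge> 0) \<and> x = (\<Sum>s\<in>S. c s *\<^sub>R s))"

definition simple_roots :: "'a::euclidean_space set \<Rightarrow> 'a set" where
  "simple_roots P = (THE \<Delta>. \<Delta> \<subseteq> P \<and> independent \<Delta> \<and> (\<forall>\<alpha>\<in>P. nonneg_comb \<Delta> \<alpha>))"

definition root_le :: "'a::euclidean_space set \<Rightarrow> 'a \<Rightarrow> 'a \<Rightarrow> bool" where
  "root_le P \<alpha> \<beta> \<longleftrightarrow> \<alpha> \<in> P \<and> \<beta> \<in> P \<and> nonneg_comb P (\<beta> - \<alpha>)"

definition highest_root :: "'a::euclidean_space set \<Rightarrow> 'a" where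
  "highest_root P = (THE \<gamma>. \<gamma> \<in> P \<and> (\<forall>\<beta>\<in>P. root_le P \<beta> \<gamma>))"

definition hyp :: "'a::euclidean_space \<Rightarrow> real \<Rightarrow> 'a set" where
  "hyp \<alpha> r = {x. \<alpha> \<bullet> x = r}"
definition hminus :: "'a::euclidean_space \<Rightarrow> real \<Rightarrow> 'a set" where
  "hminus \<alpha> r = {x. \<alpha> \<bullet> x < r}"
definition hplus :: "'a::euclidean_space \<Rightarrow> real \<Rightarrow> 'a set" where
  "hplus \<alpha> r = {x. \<alpha> \<bullet> x > r}"

definition cat_hyps :: "'a::euclidean_space set \<Rightarrow> nat \<Rightarrow> 'a set set" where
  "cat_hyps \<Phi> m = {hyp \<alpha> (real r) | \<alpha> r. \<alpha> \<in> \<Phi> \<and> r \<le> m}"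

definition regions :: "'a::euclidean_space set \<Rightarrow> nat \<Rightarrow> 'a set set" where
  "regions \<Phi> m = components (UNIV - \<Union>(cat_hyps \<Phi> m))"

definition dominant_cone :: "'a::euclidean_space set \<Rightarrow> 'a set" where
  "dominant_cone P = {x. \<forall>\<alpha>\<in>P. \<alpha> \<bullet> x > 0}"

definition fund_alcove :: "'a::euclidean_space set \<Rightarrow> 'a set" where
  "fund_alcove P = {x. (\<forall>\<sigma>\<in>simple_roots P. \<sigma> \<bullet> x > 0) \<and> highest_root P \<bullet> x < 1}"

definition bdd_dom_regions :: "'a::euclidean_space set \<Rightarrow> 'a set \<Rightarrow> nat \<Rightarrow> 'a set set" where
  "bdd_dom_regions \<Phi> P m = {R \<in> regions \<Phi> m. bounded R \<and> R \<subseteq> dominant_cone P}"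

definition is_wall :: "'a::euclidean_space set \<Rightarrow> nat \<Rightarrow> 'a set \<Rightarrow> 'a set \<Rightarrow> bool" where
  "is_wall \<Phi> m R H \<longleftrightarrow> H \<in> cat_hyps \<Phi> m \<and> aff_dim (H \<inter> closure R) = int DIM('a) - 1"

definition nonsep_walls :: "'a::euclidean_space set \<Rightarrow> 'a set \<Rightarrow> nat \<Rightarrow> 'a set \<Rightarrow> 'a set set" where
  "nonsep_walls \<Phi> P m R = {H. is_wall \<Phi> m R H \<and> (\<exists>\<alpha>\<in>\<Phi>. H = hyp \<alpha> (real m) \<and>
      ((R \<subseteq> hminus \<alpha> (real m) \<and> fund_alcove P \<subseteq> hminus \<alpha> (real m)) \<or>
       (R \<subseteq> hplus \<alpha> (real m) \<and> fund_alcove P \<subseteq> hplus \<alpha> (real m))))}"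

definition h_plus :: "'a::euclidean_space set \<Rightarrow> 'a set \<Rightarrow> nat \<Rightarrow> nat \<Rightarrow> nat" where
  "h_plus \<Phi> P m i = card {R \<in> bdd_dom_regions \<Phi> P m. card (nonsep_walls \<Phi> P m R) = DIM('a) - i}"

text \<open>f_plus Phi P m i denotes f^+_{i-1}(Phi,m), i = 0..rank, determined by
  sum_i f^+_{i-1} (x-1)^(l-i) = sum_i h^+_i x^(l-i).\<close>
definition f_plus :: "'a::euclidean_space set \<Rightarrow> 'a set \<Rightarrow> nat \<Rightarrow> nat \<Rightarrow> int" where
  "f_plus \<Phi> P m = (THE f. (\<forall>i>DIM('a). f i = 0) \<and>
     (\<forall>x::real. (\<Sum>i\<le>DIM('a). real_of_int (f i) * (x - 1) ^ (DIM('a) - i)) =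
                (\<Sum>i\<le>DIM('a). real (h_plus \<Phi> P m i) * x ^ (DIM('a) - i))))"

definition pairs_walls :: "'a::euclidean_space set \<Rightarrow> 'a set \<Rightarrow> nat \<Rightarrow> nat \<Rightarrow> ('a set \<times> 'a set set) set" where
  "pairs_walls \<Phi> P m k = {(R, S). R \<in> bdd_dom_regions \<Phi> P m \<and> S \<subseteq> nonsep_walls \<Phi> P m R \<and>
      card S = DIM('a) - k}"

definition sumset :: "'a::euclidean_space set \<Rightarrow> 'a set \<Rightarrow> 'a set" where
  "sumset A B = {a + b | a b. a \<in> A \<and> b \<in> B}"

definition is_ideal :: "'a::euclidean_space set \<Rightarrow> 'a set \<Rightarrow> bool" where
  "is_ideal P J \<longleftrightarrow> J \<subseteq> P \<and> (\<forall>\<alpha>\<in>J. \<forall>\<beta>\<in>P. root_le P \<beta> \<alpha> \<longrightarrow> \<beta> \<in> J)"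

definition chain_I :: "'a::euclidean_space set \<Rightarrow> nat \<Rightarrow> (nat \<Rightarrow> 'a set) \<Rightarrow> nat \<Rightarrow> 'a set" where
  "chain_I P m J i = P - J (min i m)"

text \<open>A chain J_0 \<subseteq> ... \<subseteq> J_m is represented by a function nat => set, which is
  normalised to be empty beyond index m (so that chains correspond bijectively to such functions).\<close>
definition pos_geom_chain :: "'a::euclidean_space set \<Rightarrow> nat \<Rightarrow> (nat \<Rightarrow> 'a set) \<Rightarrow> bool" where
  "pos_geom_chain P m J \<longleftrightarrow>
     (\<forall>i>m. J i = {}) \<and> J 0 = {} \<and> (\<forall>i\<le>m. is_ideal P (J i)) \<and> (\<forall>i<m. J i \<subseteq> J (Suc i)) \<and>
     (\<forall>i j. i + j \<le> m \<longrightarrow> sumset (J i) (J j) \<inter> P \<subseteq> J (i + j)) \<and>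
     (\<forall>i j. sumset (chain_I P m J i) (chain_I P m J j) \<inter> P \<subseteq> chain_I P m J (i + j)) \<and>
     simple_roots P \<subseteq> J m"

definition indecomposable :: "'a::euclidean_space set \<Rightarrow> nat \<Rightarrow> (nat \<Rightarrow> 'a set) \<Rightarrow> 'a \<Rightarrow> bool" where
  "indecomposable P m J \<alpha> \<longleftrightarrow>
     \<alpha> \<in> J m - J (m - 1) \<and> (\<forall>\<beta>\<in>J m - J (m - 1). root_le P \<alpha> \<beta> \<longrightarrow> \<beta> = \<alpha>) \<and>
     \<not> (\<exists>\<beta> \<gamma> i j. i \<ge> 1 \<and> j \<ge> 1 \<and> i + j = m \<and> \<beta> \<in> J i \<and> \<gamma> \<in> J j \<and> \<alpha> = \<beta> + \<gamma>)"

definition pairs_chains :: "'a::euclidean_space set \<Rightarrow> nat \<Rightarrow> nat \<Rightarrow> ((nat \<Rightarrow> 'a set) \<times> 'a set) set" where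
  "pairs_chains P m k = {(J, T). pos_geom_chain P m J \<and> T \<subseteq> {\<alpha>. indecomposable P m J \<alpha>} \<and>
      card T = DIM('a) - k}"

definition tilde_H :: "'a::euclidean_space \<Rightarrow> nat \<Rightarrow> int \<Rightarrow> 'a set" where
  "tilde_H \<alpha> r s = (if s < 0 then hminus \<alpha> (real r) else if s = 0 then hyp \<alpha> (real r) else hplus \<alpha> (real r))"

definition admissible_signs :: "'a::euclidean_space set \<Rightarrow> nat \<Rightarrow> ('a \<Rightarrow> nat \<Rightarrow> int) \<Rightarrow> bool" where
  "admissible_signs P m s \<longleftrightarrow> (\<forall>\<alpha>\<in>P. s \<alpha> 0 = 1 \<and> (\<forall>r. 0 < r \<and> r < m \<longrightarrow> s \<alpha> r \<in> {-1, 1}) \<and>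
      s \<alpha> m \<in> {-1, 0, 1})"

definition faces_plus :: "'a::euclidean_space set \<Rightarrow> nat \<Rightarrow> nat \<Rightarrow> 'a set set" where
  "faces_plus P m k = {F. \<exists>s. admissible_signs P m s \<and>
      F = (\<Inter>(\<alpha>, r)\<in>P \<times> {0..m}. tilde_H \<alpha> r (s \<alpha> r)) \<and>
      F \<noteq> {} \<and> aff_dim F = int k \<and> bounded F}"

end

theory Submission
  imports Defs "HOL-Library.Multiset"
begin

text \<open>
  A point \<open>x\<close> of the dominant cone lying on no hyperplane of level \<open>1, \<dots>, m - 1\<close> determines the
  chain of the sets \<open>{\<alpha>. (\<alpha>, x) \<le> i}\<close> and the set of roots with \<open>(\<alpha>, x) = m\<close>; this pair
  determines the cell of the arrangement containing \<open>x\<close>. The three families of the theorem are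
  counted by the pairs that arise in this way, because every pair consisting of a positive
  geometric chain and a set \<open>T\<close> of its indecomposable roots of rank \<open>m\<close> is realised by a point.

  To find that point, let \<open>r \<alpha>\<close> be the least total level of an expression of \<open>\<alpha>\<close> as a sum of
  roots in the chain. Then \<open>r \<alpha> + r \<beta> - 1 \<le> r (\<alpha> + \<beta>) \<le> r \<alpha> + r \<beta>\<close>, and the second inequality
  is an equality when \<open>\<alpha>\<close> is a sum of elements of \<open>T\<close>. So prescribing \<open>(\<alpha>, x) = r \<alpha>\<close> for the
  sums of elements of \<open>T\<close> and \<open>r \<alpha> - 1 < (\<alpha>, x) < r \<alpha>\<close> for the other positive roots amounts to
  upper bounds on all roots that are subadditive, and such a system of inequalities is solvable.

  The roots with \<open>(\<alpha>, x) = m\<close> are pairwise obtuse and lie in an open half-space. Hence they are linearly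
  independent, which gives the dimension of the cells and shows that at most \<open>\<ell>\<close> walls can occur.
\<close>

section \<open>Linear algebra and counting\<close>

text \<open>The obstacle is realisation. By linear programming duality, a system of equations and
  strict inequalities on all roots is solvable only if every nonnegative relation among the roots
  respects the bounds, whereas the chain conditions speak of sums of two roots only. The
  minimisation in \<open>subadditive_separation\<close> bridges this gap, because a reflection moves
  a root along a string whose steps are sums of two roots. The loss of 1 in the lower bound for
  \<open>r\<close> has a single source. When \<alpha> + \<beta> is written as a sum of positive
  roots, the summands can be shared out between \<alpha> and \<beta> with at most one of them broken
  into two roots (\<open>mset_split\<close>), and the condition on the complements of the ideals
  prices that break at 1. Indecomposability forbids the break or compensates for it, which is why
  \<open>r\<close> is additive along \<open>T\<close>. The relation between f and h is the expansion
  of x^n in powers of x - 1, so its coefficients count subsets of walls.\<close>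

lemma bounded_bounded_inner_spanning:
  fixes S :: "'a::euclidean_space set"
  assumes "finite S" "span S = UNIV"
  shows "bounded {x. \<forall>s\<in>S. \<bar>s \<bullet> x\<bar> \<le> B}"
proof -
  have "\<exists>c. b = (\<Sum>s\<in>S. c s *\<^sub>R s)" for b
  proof -
    have "b \<in> range (\<lambda>u. \<Sum>s\<in>S. u s *\<^sub>R s)"
      using assms span_finite[of S] by auto
    thus ?thesis by auto
  qed
  then obtain c where c: "\<And>b. b = (\<Sum>s\<in>S. c b s *\<^sub>R s)" by metis
  have "norm x \<le> (\<Sum>b\<in>Basis. \<Sum>s\<in>S. \<bar>c b s\<bar> * B)" if "\<forall>s\<in>S. \<bar>s \<bullet> x\<bar> \<le> B" for x :: 'a
  proof -
    have "norm x \<le> (\<Sum>b\<in>Basis. \<bar>x \<bullet> b\<bar>)" by (rule norm_le_l1)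
    also have "\<dots> \<le> (\<Sum>b\<in>Basis. \<Sum>s\<in>S. \<bar>c b s\<bar> * B)"
    proof (rule sum_mono)
      fix b :: 'a
      have "x \<bullet> b = (\<Sum>s\<in>S. c b s * (s \<bullet> x))"
        by (subst c[of b]) (simp add: inner_sum_right inner_commute)
      also have "\<bar>\<dots>\<bar> \<le> (\<Sum>s\<in>S. \<bar>c b s * (s \<bullet> x)\<bar>)" by (rule sum_abs)
      also have "\<dots> \<le> (\<Sum>s\<in>S. \<bar>c b s\<bar> * B)"
        using that by (intro sum_mono) (auto simp: abs_mult intro!: mult_left_mono)
      finally show "\<bar>x \<bullet> b\<bar> \<le> (\<Sum>s\<in>S. \<bar>c b s\<bar> * B)" .
    qed
    finally show ?thesis .
  qed
  thus ?thesis by (auto simp: bounded_iff)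
qed

text \<open>Separate a linear relation into its positive part \<open>u\<close> and its negative part
  \<open>w\<close>. They are equal as vectors and have disjoint supports, so obtuseness gives u
  \<bullet> u = u \<bullet> w \<le> 0. The half-space then turns u = 0 into the vanishing of all
  positive coefficients.\<close>

lemma obtuse_independent:
  fixes S :: "'a::euclidean_space set"
  assumes fin: "finite S" and half: "\<And>s. s \<in> S \<Longrightarrow> 0 < s \<bullet> v"
    and obtuse: "\<And>s t. s \<in> S \<Longrightarrow> t \<in> S \<Longrightarrow> s \<noteq> t \<Longrightarrow> s \<bullet> t \<le> 0"
  shows "independent S"
proof (rule independent_if_scalars_zero[OF fin])
  fix c :: "'a \<Rightarrow> real" and s
  assume sum0: "(\<Sum>x\<in>S. c x *\<^sub>R x) = 0" and s: "s \<in> S"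
  have key: "d s \<le> 0" if d0: "(\<Sum>x\<in>S. d x *\<^sub>R x) = 0" and s: "s \<in> S" for d :: "'a \<Rightarrow> real" and s
  proof -
    define u where "u = (\<Sum>x\<in>S. max (d x) 0 *\<^sub>R x)"
    define w where "w = (\<Sum>x\<in>S. max (- d x) 0 *\<^sub>R x)"
    have "u - w = (\<Sum>x\<in>S. d x *\<^sub>R x)"
      unfolding u_def w_def sum_subtractf[symmetric]
      by (intro sum.cong refl) (auto simp: max_def algebra_simps)
    hence uw: "u = w" using d0 by simp
    have "u \<bullet> u = u \<bullet> w" using uw by simp
    also have "\<dots> = (\<Sum>x\<in>S. \<Sum>y\<in>S. max (d x) 0 * max (- d y) 0 * (x \<bullet> y))"
      unfolding u_def w_def by (simp add: inner_sum_left inner_sum_right sum_distrib_left algebra_simps)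
        (subst sum.swap, simp add: mult_ac)
    also have "\<dots> \<le> 0"
    proof (intro sum_nonpos)
      fix x y assume xy: "x \<in> S" "y \<in> S"
      show "max (d x) 0 * max (- d y) 0 * (x \<bullet> y) \<le> 0"
      proof (cases "x = y")
        \<comment> \<open>A coefficient and its negative cannot both have a nonzero positive
          part.\<close>
        case True thus ?thesis by (auto simp: max_def)
      next
        case False
        from obtuse[OF xy this] show ?thesis by (intro mult_nonneg_nonpos) auto
      qed
    qed
    finally have "u = 0" using inner_ge_zero[of u] inner_eq_zero_iff[of u] by linarith
    hence "(\<Sum>x\<in>S. max (d x) 0 * (x \<bullet> v)) = 0"
      unfolding u_def by (metis (mono_tags, lifting) inner_scaleR_left inner_sum_left inner_zero_left sum.cong)
    moreover have "\<forall>x\<in>S. 0 \<le> max (d x) 0 * (x \<bullet> v)" using half by (metis less_imp_le max.cobounded2 mult_nonneg_nonneg)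
    ultimately have "max (d s) 0 * (s \<bullet> v) = 0" using fin s by (simp add: sum_nonneg_eq_0_iff)
    thus ?thesis using half[OF s] by auto
  qed
  have "(\<Sum>x\<in>S. (- c x) *\<^sub>R x) = 0" using sum0 by (simp add: sum_negf)
  from key[OF this s] key[OF sum0 s] show "c s = 0" by simp
qed

lemma orthogonal_spans:
  fixes A B :: "'a::euclidean_space set"
  assumes orth: "\<And>a b. a \<in> A \<Longrightarrow> b \<in> B \<Longrightarrow> a \<bullet> b = 0" and "x \<in> span A" "y \<in> span B"
  shows "x \<bullet> y = 0"
proof -
  have "orthogonal a y" if "a \<in> A" for a
    by (rule orthogonal_to_span[OF assms(3)]) (use orth that in \<open>simp add: orthogonal_def\<close>)
  hence "orthogonal y x"
    by (intro orthogonal_to_span[OF assms(2)]) (simp add: orthogonal_commute)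
  thus ?thesis by (simp add: orthogonal_def inner_commute)
qed

lemma affine_hull_eq_hyperplane:
  fixes a :: "'a::euclidean_space"
  assumes "A \<subseteq> {x. a \<bullet> x = c}" "a \<noteq> 0" "aff_dim A = int DIM('a) - 1"
  shows "affine hull A = {x. a \<bullet> x = c}"
proof -
  have "aff_dim A = aff_dim {x. a \<bullet> x = c}" using assms by simp
  hence "affine hull A = affine hull {x. a \<bullet> x = c}" using aff_dim_eq_full_gen[OF assms(1)] by simp
  thus ?thesis by (simp add: affine_hull_eq affine_hyperplane)
qed

lemma hyperplane_subset_imp_parallel:
  fixes a b :: "'a::euclidean_space"
  assumes sub: "{x. a \<bullet> x = c} \<subseteq> {x. b \<bullet> x = d}" and a: "a \<noteq> 0"
  obtains l where "b = l *\<^sub>R a"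
proof
  define p where "p = (c / (a \<bullet> a)) *\<^sub>R a"
  \<comment> \<open>\<open>p\<close> is a point of the first hyperplane and \<open>u\<close> the
    component of \<open>b\<close> orthogonal to \<open>a\<close>. Moving from \<open>p\<close> by
    \<open>u\<close> stays in that hyperplane, so \<open>b\<close> cannot see
    \<open>u\<close>.\<close>
  define u where "u = b - ((b \<bullet> a) / (a \<bullet> a)) *\<^sub>R a"
  have "a \<bullet> p = c" "a \<bullet> u = 0" using a by (auto simp: p_def u_def inner_diff_right inner_commute)
  hence "p \<in> {x. a \<bullet> x = c}" "p + u \<in> {x. a \<bullet> x = c}" by (simp_all add: inner_add_right)
  hence "b \<bullet> p = d" "b \<bullet> (p + u) = d" using sub by blast+
  hence "b \<bullet> u = 0" by (simp add: inner_add_right)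
  hence "u \<bullet> u = 0" using \<open>a \<bullet> u = 0\<close> by (simp add: u_def inner_diff_left inner_commute)
  thus "b = ((b \<bullet> a) / (a \<bullet> a)) *\<^sub>R a" by (simp add: u_def)
qed

text \<open>The solution set is a translate of the orthogonal complement of
  \<open>span Z\<close>.\<close>

lemma aff_dim_affine_system:
  fixes Z :: "'a::euclidean_space set"
  assumes Z: "independent Z" and x: "\<And>t. t \<in> Z \<Longrightarrow> t \<bullet> x = c t"
  shows "aff_dim {y. \<forall>t\<in>Z. t \<bullet> y = c t} = int DIM('a) - int (card Z)"
proof -
  define L where "L = {y :: 'a. \<forall>t\<in>Z. t \<bullet> y = 0}"
  have "{y. \<forall>t\<in>Z. t \<bullet> y = c t} = (+) x ` L"
  proof (intro equalityI subsetI)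
    fix y assume "y \<in> {y. \<forall>t\<in>Z. t \<bullet> y = c t}"
    hence "y - x \<in> L" using x by (auto simp: L_def inner_diff_right)
    thus "y \<in> (+) x ` L" by (intro image_eqI[of _ _ "y - x"]) auto
  qed (use x in \<open>auto simp: L_def inner_add_right\<close>)
  moreover have "subspace L" by (auto simp: L_def subspace_def inner_add_right)
  moreover have "L = {y \<in> UNIV. \<forall>x\<in>span Z. orthogonal x y}"
  proof (intro equalityI subsetI)
    fix y assume y: "y \<in> L"
    have "orthogonal x y" if "x \<in> span Z" for x
    proof -
      have "orthogonal y x"
        by (rule orthogonal_to_span[OF that]) (use y in \<open>simp add: L_def orthogonal_def inner_commute\<close>)
      thus ?thesis by (simp add: orthogonal_commute)
    qed
    thus "y \<in> {y \<in> UNIV. \<forall>x\<in>span Z. orthogonal x y}" by simp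
  qed (auto simp: L_def orthogonal_def span_base)
  hence "dim L + dim (span Z) = DIM('a)"
    using dim_subspace_orthogonal_to_vectors[of "span Z" UNIV] by simp
  hence "dim L + card Z = DIM('a)" using dim_eq_card_independent[OF Z] by simp
  ultimately show ?thesis by (simp add: aff_dim_translation_eq aff_dim_subspace)
qed

text \<open>Writing cells with \<open>sgn\<close> treats open half-spaces and hyperplanes
  alike.\<close>

lemma convex_sgn_inner: "convex {y :: 'a::euclidean_space. sgn (a \<bullet> y - c) = s}"
proof -
  consider "s = 1" | "s = -1" | "s = 0" | "s \<noteq> 1" "s \<noteq> -1" "s \<noteq> 0" by blast
  thus ?thesis
  proof cases
    case 1
    hence "{y. sgn (a \<bullet> y - c) = s} = {y. a \<bullet> y > c}" by (auto simp: sgn_if)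
    thus ?thesis by (simp add: convex_halfspace_gt)
  next
    case 2
    hence "{y. sgn (a \<bullet> y - c) = s} = {y. a \<bullet> y < c}" by (auto simp: sgn_if)
    thus ?thesis by (simp add: convex_halfspace_lt)
  next
    case 3
    hence "{y. sgn (a \<bullet> y - c) = s} = {y. a \<bullet> y = c}" by (auto simp: sgn_if)
    thus ?thesis by (simp add: convex_hyperplane)
  next
    case 4
    hence "{y. sgn (a \<bullet> y - c) = s} = {}" by (auto simp: sgn_if)
    thus ?thesis by simp
  qed
qed

lemma sgn_diff_iff:
  fixes a b c :: real
  shows "sgn (a - c) = sgn (b - c) \<longleftrightarrow> (a < c \<longleftrightarrow> b < c) \<and> (a = c \<longleftrightarrow> b = c)"
  by (auto simp: sgn_if)

text \<open>This selects the summand to subtract: a positive inner product between distinct roots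
  makes their difference a root.\<close>

lemma sum_mset_inner_pos_ex:
  fixes y :: "'a::real_inner"
  assumes "0 < \<Sum>\<^sub># M \<bullet> y"
  shows "\<exists>c\<in>#M. 0 < c \<bullet> y"
proof (rule ccontr)
  assume "\<not> ?thesis"
  hence "\<Sum>\<^sub># M \<bullet> y \<le> 0"
    by (induction M) (auto simp: inner_add_left not_less intro: add_nonpos_nonpos)
  thus False using assms by simp
qed

lemma sum_mset_inner_eq_0:
  fixes y :: "'a::real_inner"
  assumes "\<And>x. x \<in># M \<Longrightarrow> 0 \<le> x \<bullet> y" "\<Sum>\<^sub># M \<bullet> y \<le> 0" "x \<in># M"
  shows "x \<bullet> y = 0"
proof -
  obtain M' where M': "M = add_mset x M'" using assms(3) by (metis insert_DiffM)
  have "\<forall>z\<in>#M'. 0 \<le> z \<bullet> y" using assms(1) M' by simp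
  hence "0 \<le> \<Sum>\<^sub># M' \<bullet> y" by (induction M') (auto simp: inner_add_left)
  thus ?thesis using assms(1)[of x] assms(2) M' by (simp add: inner_add_left)
qed

lemma nonneg_comb_sum_mset:
  fixes M :: "'a::euclidean_space multiset"
  assumes "finite S" "set_mset M \<subseteq> S"
  shows "nonneg_comb S (\<Sum>\<^sub># M)"
proof -
  have "\<Sum>\<^sub># M = (\<Sum>s\<in>S. real (count M s) *\<^sub>R s)"
    using assms(2)
  proof (induction M)
    case (add x M)
    have "(\<Sum>s\<in>S. real (count (add_mset x M) s) *\<^sub>R s)
        = (\<Sum>s\<in>S. real (count M s) *\<^sub>R s + (if s = x then s else 0))"
      by (intro sum.cong) (auto simp: algebra_simps)
    also have "\<dots> = \<Sum>\<^sub># M + x" using add assms(1) by (simp add: sum.distrib sum.delta)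
    finally show ?case by (simp add: add.commute)
  qed simp
  thus ?thesis unfolding nonneg_comb_def by (intro exI[of _ "\<lambda>s. real (count M s)"]) auto
qed

lemma nonneg_comb_add:
  assumes "nonneg_comb S x" "nonneg_comb S y"
  shows "nonneg_comb S (x + y)"
proof -
  obtain c d where "\<forall>s\<in>S. 0 \<le> c s" "x = (\<Sum>s\<in>S. c s *\<^sub>R s)" "\<forall>s\<in>S. 0 \<le> d s" "y = (\<Sum>s\<in>S. d s *\<^sub>R s)"
    using assms unfolding nonneg_comb_def by blast
  thus ?thesis unfolding nonneg_comb_def
    by (intro exI[of _ "\<lambda>s. c s + d s"]) (auto simp: scaleR_add_left sum.distrib)
qed

text \<open>Write x as (x - 1) + 1. With \<open>n\<close> walls at a region, the coefficients count
  the sets of \<open>j\<close> walls; padding the sum up to \<open>D\<close> gives all regions the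
  same range of summation.\<close>

lemma binomial_expand_minus_1:
  fixes x :: real
  assumes "n \<le> D"
  shows "(\<Sum>j\<le>D. real (n choose j) * (x - 1) ^ j) = x ^ n"
proof -
  have "x ^ n = ((x - 1) + 1) ^ n" by simp
  also have "\<dots> = (\<Sum>j\<le>n. real (n choose j) * (x - 1) ^ j)" by (subst binomial_ring) simp
  also have "\<dots> = (\<Sum>j\<le>D. real (n choose j) * (x - 1) ^ j)"
    using assms by (intro sum.mono_neutral_left) auto
  finally show ?thesis by simp
qed

lemma sum_atMost_rev: "(\<Sum>i\<le>D. f (D - i)) = (\<Sum>j\<le>D. f j)" for f :: "nat \<Rightarrow> 'b::comm_monoid_add"
  by (rule sum.reindex_bij_witness[where i = "\<lambda>i. D - i" and j = "\<lambda>i. D - i"]) auto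

text \<open>The families to be counted are images of one set of points under different maps. Maps
  with the same fibres have equinumerous images, so no inverse has to be written down.\<close>

lemma bij_betw_images:
  assumes "\<And>x y. x \<in> X \<Longrightarrow> y \<in> X \<Longrightarrow> f x = f y \<longleftrightarrow> g x = g y"
  shows "bij_betw (g \<circ> inv_into X f) (f ` X) (g ` X)"
proof -
  have inv: "g (inv_into X f (f x)) = g x" if "x \<in> X" for x
    using assms[of "inv_into X f (f x)" x] that by (auto simp: inv_into_into f_inv_into_f)
  show ?thesis
  proof (rule bij_betwI')
    fix u v assume "u \<in> f ` X" "v \<in> f ` X"
    thus "(g \<circ> inv_into X f) u = (g \<circ> inv_into X f) v \<longleftrightarrow> u = v" using inv assms by auto
  next
    fix u assume "u \<in> f ` X"
    thus "(g \<circ> inv_into X f) u \<in> g ` X" using inv by auto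
  next
    fix v assume "v \<in> g ` X"
    thus "\<exists>u\<in>f ` X. v = (g \<circ> inv_into X f) u" using inv by auto
  qed
qed

lemma card_images_eq:
  assumes "\<And>x y. x \<in> X \<Longrightarrow> y \<in> X \<Longrightarrow> f x = f y \<longleftrightarrow> g x = g y"
  shows "card (f ` X) = card (g ` X)"
  using bij_betw_same_card[OF bij_betw_images] assms by blast

section \<open>Subadditive bounds on roots\<close>

locale positive_roots =
  fixes \<Phi> P :: "'a::euclidean_space set"
  assumes rs: "root_system \<Phi>" and crys: "crystallographic \<Phi>" and pos: "positive_system \<Phi> P"
begin

lemma finite_roots: "finite \<Phi>" and zero_not_root: "0 \<notin> \<Phi>" and span_roots: "span \<Phi> = UNIV"
  using rs by (auto simp: root_system_def)

lemma reflect_root: "\<alpha> \<in> \<Phi> \<Longrightarrow> \<beta> \<in> \<Phi> \<Longrightarrow> rreflect \<alpha> \<beta> \<in> \<Phi>"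
  using rs by (auto simp: root_system_def)

lemma scaleR_root_iff: "\<alpha> \<in> \<Phi> \<Longrightarrow> c *\<^sub>R \<alpha> \<in> \<Phi> \<longleftrightarrow> c = 1 \<or> c = -1"
  using rs by (auto simp: root_system_def)

lemma uminus_root: "\<alpha> \<in> \<Phi> \<Longrightarrow> - \<alpha> \<in> \<Phi>"
  using scaleR_root_iff[of \<alpha> "-1"] by simp

lemma root_inner_pos: "\<alpha> \<in> \<Phi> \<Longrightarrow> 0 < \<alpha> \<bullet> \<alpha>"
  using zero_not_root by auto

lemma cartan_int:
  assumes "\<alpha> \<in> \<Phi>" "\<beta> \<in> \<Phi>"
  obtains p :: int where "2 * (\<beta> \<bullet> \<alpha>) = p * (\<alpha> \<bullet> \<alpha>)"
proof -
  have "2 * (\<beta> \<bullet> \<alpha>) / (\<alpha> \<bullet> \<alpha>) \<in> \<int>" using crys assms by (auto simp: crystallographic_def)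
  then obtain p :: int where "2 * (\<beta> \<bullet> \<alpha>) / (\<alpha> \<bullet> \<alpha>) = p" by (auto elim: Ints_cases)
  with root_inner_pos[OF assms(1)] show ?thesis by (intro that[of p]) (auto simp: field_simps)
qed

lemma reflect_eq: "\<alpha> \<in> \<Phi> \<Longrightarrow> 2 * (\<beta> \<bullet> \<alpha>) = c * (\<alpha> \<bullet> \<alpha>) \<Longrightarrow> rreflect \<alpha> \<beta> = \<beta> - c *\<^sub>R \<alpha>"
  using root_inner_pos[of \<alpha>] by (simp add: rreflect_def)

text \<open>Strict Cauchy-Schwarz keeps the product of the two Cartan integers below 4. Both are
  negative, so one of them is -1, and the corresponding reflection produces the sum.\<close>

lemma add_root:
  assumes a: "\<alpha> \<in> \<Phi>" and b: "\<beta> \<in> \<Phi>" and neg: "\<alpha> \<bullet> \<beta> < 0" and ne: "\<alpha> \<noteq> - \<beta>"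
  shows "\<alpha> + \<beta> \<in> \<Phi>"
proof -
  have pa: "0 < \<alpha> \<bullet> \<alpha>" and pb: "0 < \<beta> \<bullet> \<beta>" using a b root_inner_pos by auto
  obtain p :: int where p: "2 * (\<beta> \<bullet> \<alpha>) = p * (\<alpha> \<bullet> \<alpha>)" using cartan_int[OF a b] by blast
  obtain q :: int where q: "2 * (\<alpha> \<bullet> \<beta>) = q * (\<beta> \<bullet> \<beta>)" using cartan_int[OF b a] by blast
  have strict: "(\<alpha> \<bullet> \<beta>)\<^sup>2 < (\<alpha> \<bullet> \<alpha>) * (\<beta> \<bullet> \<beta>)"
  proof (rule ccontr)
    assume "\<not> ?thesis"
    moreover have "(\<alpha> \<bullet> \<beta>)\<^sup>2 \<le> (\<alpha> \<bullet> \<alpha>) * (\<beta> \<bullet> \<beta>)" by (rule Cauchy_Schwarz_ineq)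
    ultimately have eq: "(\<alpha> \<bullet> \<beta>)\<^sup>2 = (\<alpha> \<bullet> \<alpha>) * (\<beta> \<bullet> \<beta>)" by simp
    \<comment> \<open>Equality in Cauchy-Schwarz makes the roots proportional with this negative
      factor, so they would be opposite.\<close>
    define c where "c = (\<alpha> \<bullet> \<beta>) / (\<beta> \<bullet> \<beta>)"
    have c: "c * (\<beta> \<bullet> \<beta>) = \<alpha> \<bullet> \<beta>" using pb by (simp add: c_def)
    have c2: "c * (\<alpha> \<bullet> \<beta>) = \<alpha> \<bullet> \<alpha>" using pb eq by (simp add: c_def power2_eq_square)
    have "(\<alpha> - c *\<^sub>R \<beta>) \<bullet> (\<alpha> - c *\<^sub>R \<beta>) = \<alpha> \<bullet> \<alpha> - 2 * (c * (\<alpha> \<bullet> \<beta>)) + c * (c * (\<beta> \<bullet> \<beta>))"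
      by (simp add: algebra_simps inner_commute)
    also have "\<dots> = 0" by (simp add: c c2)
    finally have eq': "\<alpha> = c *\<^sub>R \<beta>" by simp
    hence "c = 1 \<or> c = -1" using a b scaleR_root_iff by blast
    moreover have "c < 0" unfolding c_def using neg pb by (simp add: divide_neg_pos)
    ultimately show False using eq' ne by auto
  qed
  have "real_of_int (p * q) * ((\<alpha> \<bullet> \<alpha>) * (\<beta> \<bullet> \<beta>)) = 4 * (\<alpha> \<bullet> \<beta>)\<^sup>2"
    using p q by (simp add: power2_eq_square inner_commute) algebra
  also have "\<dots> < 4 * ((\<alpha> \<bullet> \<alpha>) * (\<beta> \<bullet> \<beta>))" using strict by simp
  finally have "real_of_int (p * q) < 4" using pa pb by (simp add: mult_less_cancel_right)
  hence pq: "p * q < 4" by linarith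
  have "real_of_int p * (\<alpha> \<bullet> \<alpha>) < 0" "real_of_int q * (\<beta> \<bullet> \<beta>) < 0"
    using p q neg by (simp_all add: inner_commute)
  hence "p < 0" "q < 0" using pa pb by (simp_all add: mult_less_0_iff)
  hence "p = -1 \<or> q = -1"
  proof -
    { assume "p \<le> -2" "q \<le> -2"
      hence "2 * 2 \<le> (- p) * (- q)" by (intro mult_mono) auto
      hence False using pq by simp }
    thus ?thesis using \<open>p < 0\<close> \<open>q < 0\<close> by (cases "p \<le> -2"; cases "q \<le> -2") auto
  qed
  thus ?thesis
  proof
    assume "p = -1"
    hence "rreflect \<alpha> \<beta> = \<beta> - (-1) *\<^sub>R \<alpha>" using reflect_eq[OF a p] by simp
    thus ?thesis using reflect_root[OF a b] by (simp add: add.commute)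
  next
    assume "q = -1"
    hence "rreflect \<beta> \<alpha> = \<alpha> - (-1) *\<^sub>R \<beta>" using reflect_eq[OF b q] by simp
    thus ?thesis using reflect_root[OF b a] by simp
  qed
qed

lemma diff_root: "\<alpha> \<in> \<Phi> \<Longrightarrow> \<beta> \<in> \<Phi> \<Longrightarrow> 0 < \<alpha> \<bullet> \<beta> \<Longrightarrow> \<alpha> \<noteq> \<beta> \<Longrightarrow> \<alpha> - \<beta> \<in> \<Phi>"
  using add_root[of \<alpha> "- \<beta>"] uminus_root[of \<beta>] by simp

text \<open>The mirror image of \<beta> is reached by adding \<alpha> k times, where -k is the
  Cartan integer. Each partial sum is a root and no step lowers \<open>v\<close>, since
  \<open>v \<alpha>\<close> is nonnegative. Excluding \<beta> = -\<alpha> keeps 0 off this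
  path.\<close>

lemma superadditive_le_reflect:
  fixes v :: "'a \<Rightarrow> real"
  assumes super: "\<And>\<alpha> \<beta>. \<alpha> \<in> \<Phi> \<Longrightarrow> \<beta> \<in> \<Phi> \<Longrightarrow> \<alpha> + \<beta> \<in> \<Phi> \<Longrightarrow> v \<alpha> + v \<beta> \<le> v (\<alpha> + \<beta>)"
    and a: "\<alpha> \<in> \<Phi>" and va: "0 \<le> v \<alpha>"
    and b: "\<beta> \<in> \<Phi>" and neg: "\<beta> \<bullet> \<alpha> < 0" and ne: "\<beta> \<noteq> - \<alpha>"
  shows "v \<beta> \<le> v (rreflect \<alpha> \<beta>)"
proof -
  have *: "\<beta> \<in> \<Phi> \<Longrightarrow> \<beta> \<noteq> - \<alpha> \<Longrightarrow> 2 * (\<beta> \<bullet> \<alpha>) = - real k * (\<alpha> \<bullet> \<alpha>) \<Longrightarrow> k \<ge> 1 \<Longrightarrow> v \<beta> \<le> v (rreflect \<alpha> \<beta>)"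
    for k \<beta>
  proof (induction k arbitrary: \<beta> rule: less_induct)
    case (less k)
    have refl: "rreflect \<alpha> \<beta> = \<beta> + real k *\<^sub>R \<alpha>" using reflect_eq[OF a less.prems(3)] by simp
    have "2 * (\<beta> \<bullet> \<alpha>) < 0" using less.prems root_inner_pos[OF a] by simp
    hence ba: "\<beta> + \<alpha> \<in> \<Phi>" using less.prems a by (intro add_root) auto
    hence vba: "v \<beta> \<le> v (\<beta> + \<alpha>)" using super[OF less.prems(1) a] va by simp
    show ?case
    proof (cases "k = 1")
      case True thus ?thesis using refl vba by simp
    next
      case False
      hence k2: "k \<ge> 2" using less.prems by simp
      \<comment> \<open>The induction removes one step at each end of the string: the mirror image
        of \<beta> + \<alpha> is one step short of that of \<beta>.\<close>
      have pr: "2 * ((\<beta> + \<alpha>) \<bullet> \<alpha>) = - real (k - 2) * (\<alpha> \<bullet> \<alpha>)"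
        using less.prems(3) k2 by (simp add: inner_add_left of_nat_diff algebra_simps)
      have refl': "rreflect \<alpha> (\<beta> + \<alpha>) + \<alpha> = rreflect \<alpha> \<beta>"
        using reflect_eq[OF a pr] refl k2
        by (simp add: of_nat_diff algebra_simps scaleR_2)
      have "v (\<beta> + \<alpha>) \<le> v (rreflect \<alpha> (\<beta> + \<alpha>))"
      proof (cases "k = 2")
        case True thus ?thesis using reflect_eq[OF a pr] by simp
      next
        case False
        have "\<beta> + \<alpha> \<noteq> - \<alpha>"
        proof
          assume "\<beta> + \<alpha> = - \<alpha>"
          hence "\<beta> = (-2) *\<^sub>R \<alpha>" by (simp add: scaleR_2 algebra_simps eq_neg_iff_add_eq_0)
          thus False using scaleR_root_iff[OF a, of "-2"] less.prems(1) by simp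
        qed
        thus ?thesis using less.IH[of "k - 2" "\<beta> + \<alpha>"] ba pr False k2 by simp
      qed
      also have "\<dots> \<le> v (rreflect \<alpha> \<beta>)"
        using super[OF reflect_root[OF a ba] a] reflect_root[OF a less.prems(1)] va unfolding refl' by simp
      finally show ?thesis using vba by simp
    qed
  qed
  obtain p :: int where p: "2 * (\<beta> \<bullet> \<alpha>) = p * (\<alpha> \<bullet> \<alpha>)" using cartan_int[OF a b] by blast
  have "p < 0" using p neg root_inner_pos[OF a] by (metis mult_less_0_iff mult_zero_left not_less_iff_gr_or_eq of_int_less_0_iff zero_less_numeral order.asym)
  hence "2 * (\<beta> \<bullet> \<alpha>) = - real (nat (- p)) * (\<alpha> \<bullet> \<alpha>)" using p by simp
  from *[OF b ne this] \<open>p < 0\<close> show ?thesis by simp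
qed

lemma rreflect_inner: "rreflect \<alpha> \<beta> \<bullet> \<alpha> = - (\<beta> \<bullet> \<alpha>)" if "\<alpha> \<in> \<Phi>"
  using root_inner_pos[OF that] by (simp add: rreflect_def inner_diff_left)

lemma rreflect_rreflect: "rreflect \<alpha> (rreflect \<alpha> \<beta>) = \<beta>" if "\<alpha> \<in> \<Phi>"
  using rreflect_inner[OF that, of \<beta>] unfolding rreflect_def[of \<alpha> "rreflect \<alpha> \<beta>"]
  by (simp add: rreflect_def)

lemma rreflect_self: "rreflect \<alpha> \<alpha> = - \<alpha>" if "\<alpha> \<in> \<Phi>"
  using root_inner_pos[OF that] by (simp add: rreflect_def scaleR_2)

text \<open>Any minimiser of the sum of the exponentials of the excesses \<open>\<alpha> \<bullet> x - U \<alpha>\<close> is a solution: its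
  gradient vanishes, whereas pairing each root with its mirror image shows that the derivative in
  the direction of a violated root is positive.\<close>
lemma subadditive_separation:
  fixes U :: "'a \<Rightarrow> real"
  assumes sub: "\<And>\<alpha> \<beta>. \<alpha> \<in> \<Phi> \<Longrightarrow> \<beta> \<in> \<Phi> \<Longrightarrow> \<alpha> + \<beta> \<in> \<Phi> \<Longrightarrow> U (\<alpha> + \<beta>) \<le> U \<alpha> + U \<beta>"
    and opp: "\<And>\<alpha>. \<alpha> \<in> \<Phi> \<Longrightarrow> 0 \<le> U \<alpha> + U (- \<alpha>)"
  obtains x where "\<And>\<alpha>. \<alpha> \<in> \<Phi> \<Longrightarrow> \<alpha> \<bullet> x \<le> U \<alpha>"
    and "\<And>\<alpha>. \<alpha> \<in> \<Phi> \<Longrightarrow> 0 < U \<alpha> + U (- \<alpha>) \<Longrightarrow> \<alpha> \<bullet> x < U \<alpha>"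
proof -
  define G where "G x = (\<Sum>\<alpha>\<in>\<Phi>. exp (\<alpha> \<bullet> x - U \<alpha>))" for x
  define C where "C = {x. G x \<le> G 0}"
  have cont: "continuous_on UNIV G" unfolding G_def by (intro continuous_intros)
  obtain \<alpha>0 where "\<alpha>0 \<in> \<Phi>"
  proof -
    have "\<Phi> \<noteq> {}"
    proof
      assume "\<Phi> = {}"
      hence "(UNIV :: 'a set) = {0}" using span_roots by simp
      thus False using nonzero_Basis nonempty_Basis by blast
    qed
    thus ?thesis using that by blast
  qed
  hence G0: "0 < G 0" unfolding G_def using finite_roots by (intro sum_pos) auto
  \<comment> \<open>Each exponential is at most the whole sum, which bounds every root from above on
    \<open>C\<close>. Using this for \<alpha> and -\<alpha> makes \<open>C\<close> bounded, so a
    minimum is attained.\<close>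
  have "\<bar>\<alpha> \<bullet> x\<bar> \<le> (\<Sum>\<alpha>\<in>\<Phi>. \<bar>U \<alpha>\<bar>) + \<bar>ln (G 0)\<bar>" if x: "x \<in> C" and a: "\<alpha> \<in> \<Phi>" for x \<alpha>
  proof -
    have *: "\<beta> \<bullet> x \<le> (\<Sum>\<alpha>\<in>\<Phi>. \<bar>U \<alpha>\<bar>) + \<bar>ln (G 0)\<bar>" if b: "\<beta> \<in> \<Phi>" for \<beta>
    proof -
      have "exp (\<beta> \<bullet> x - U \<beta>) \<le> G x" unfolding G_def using b finite_roots
        by (intro member_le_sum) auto
      also have "\<dots> \<le> G 0" using x by (simp add: C_def)
      finally have "\<beta> \<bullet> x - U \<beta> \<le> ln (G 0)" using G0 by (simp add: ln_ge_iff)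
      moreover have "\<bar>U \<beta>\<bar> \<le> (\<Sum>\<alpha>\<in>\<Phi>. \<bar>U \<alpha>\<bar>)" using b finite_roots by (intro member_le_sum) auto
      ultimately show ?thesis by linarith
    qed
    from *[OF a] *[OF uminus_root[OF a]] show ?thesis by (simp add: abs_le_iff)
  qed
  hence "bounded C"
    using bounded_subset[OF bounded_bounded_inner_spanning[OF finite_roots span_roots]] by blast
  moreover have "closed C" unfolding C_def
    using cont by (intro closed_Collect_le) (auto intro: continuous_intros)
  ultimately have "compact C" by (simp add: compact_eq_bounded_closed)
  moreover have "0 \<in> C" by (simp add: C_def)
  ultimately obtain x where x: "x \<in> C" "\<And>y. y \<in> C \<Longrightarrow> G x \<le> G y"
    using continuous_attains_inf[of C G] continuous_on_subset[OF cont] by blast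
  have min: "G x \<le> G y" for y
    using x(1) x(2)[of y] x(2)[OF \<open>0 \<in> C\<close>] by (cases "y \<in> C") (auto simp: C_def)
  define v where "v \<alpha> = \<alpha> \<bullet> x - U \<alpha>" for \<alpha>
  have grad: "(\<Sum>\<beta>\<in>\<Phi>. exp (v \<beta>) * (\<beta> \<bullet> \<alpha>)) = 0" for \<alpha>
  proof (rule DERIV_local_min)
    show "((\<lambda>t. G (x + t *\<^sub>R \<alpha>)) has_real_derivative (\<Sum>\<beta>\<in>\<Phi>. exp (v \<beta>) * (\<beta> \<bullet> \<alpha>))) (at 0)"
      unfolding G_def v_def inner_add_right inner_scaleR_right
      by (auto intro!: derivative_eq_intros sum.cong)
    show "0 < (1::real)" "\<forall>y. \<bar>0 - y\<bar> < 1 \<longrightarrow> G (x + 0 *\<^sub>R \<alpha>) \<le> G (x + y *\<^sub>R \<alpha>)" using min by auto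
  qed
  have super: "v \<alpha> + v \<beta> \<le> v (\<alpha> + \<beta>)" if "\<alpha> \<in> \<Phi>" "\<beta> \<in> \<Phi>" "\<alpha> + \<beta> \<in> \<Phi>" for \<alpha> \<beta>
    using sub[OF that] by (simp add: v_def inner_add_left)
  have opp': "v \<alpha> + v (- \<alpha>) = - (U \<alpha> + U (- \<alpha>))" for \<alpha> by (simp add: v_def)
  have key: False if a: "\<alpha> \<in> \<Phi>" and va: "0 \<le> v \<alpha>" and less: "v (- \<alpha>) < v \<alpha>" for \<alpha>
  proof -
    let ?s = "rreflect \<alpha>"
    let ?f = "\<lambda>\<beta>. (exp (v \<beta>) - exp (v (?s \<beta>))) * (\<beta> \<bullet> \<alpha>)"
    \<comment> \<open>The root -\<alpha> is treated apart: its sum with \<alpha> is 0, where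
      superadditivity is silent, and \<open>less\<close> takes its place.\<close>
    have mono: "v \<beta> \<le> v (?s \<beta>)" if "\<beta> \<in> \<Phi>" "\<beta> \<bullet> \<alpha> < 0" for \<beta>
    proof (cases "\<beta> = - \<alpha>")
      case True
      thus ?thesis using less rreflect_rreflect[OF a, of \<alpha>] rreflect_self[OF a] by simp
    next
      case False
      thus ?thesis using superadditive_le_reflect[of v, OF super a va that] by simp
    qed
    have "(\<Sum>\<beta>\<in>\<Phi>. exp (v \<beta>) * (\<beta> \<bullet> \<alpha>)) = (\<Sum>\<beta>\<in>\<Phi>. exp (v (?s \<beta>)) * (?s \<beta> \<bullet> \<alpha>))"
      by (rule sum.reindex_bij_witness[where i = ?s and j = ?s])
        (auto simp: rreflect_rreflect[OF a] reflect_root[OF a])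
    also have "\<dots> = - (\<Sum>\<beta>\<in>\<Phi>. exp (v (?s \<beta>)) * (\<beta> \<bullet> \<alpha>))"
      by (simp add: rreflect_inner[OF a] sum_negf)
    finally have "(\<Sum>\<beta>\<in>\<Phi>. (exp (v \<beta>) - exp (v (?s \<beta>))) * (\<beta> \<bullet> \<alpha>)) = 0"
      using grad[of \<alpha>] by (simp add: algebra_simps sum_subtractf)
    moreover have "0 \<le> (exp (v \<beta>) - exp (v (?s \<beta>))) * (\<beta> \<bullet> \<alpha>)" if b: "\<beta> \<in> \<Phi>" for \<beta>
    proof (cases "\<beta> \<bullet> \<alpha> < 0")
      case True
      thus ?thesis using mono[OF b True] by (intro mult_nonpos_nonpos) auto
    next
      case False
      show ?thesis
      proof (cases "\<beta> \<bullet> \<alpha> = 0")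
        case False
        with \<open>\<not> \<beta> \<bullet> \<alpha> < 0\<close> have "?s \<beta> \<bullet> \<alpha> < 0" by (simp add: rreflect_inner[OF a])
        from mono[OF reflect_root[OF a b] this] \<open>\<not> \<beta> \<bullet> \<alpha> < 0\<close> show ?thesis
          by (intro mult_nonneg_nonneg) (auto simp: rreflect_rreflect[OF a])
      qed simp
    qed
    ultimately have "\<forall>\<beta>\<in>\<Phi>. ?f \<beta> = 0"
      using sum_nonneg_eq_0_iff[OF finite_roots, of ?f] by simp
    hence "?f \<alpha> = 0" using a by (rule bspec)
    thus False using less root_inner_pos[OF a] by (simp add: rreflect_self[OF a])
  qed
  show ?thesis
  proof
    fix \<alpha> assume a: "\<alpha> \<in> \<Phi>"
    \<comment> \<open>A violation means \<open>v \<alpha> > 0\<close>. As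
      \<open>v \<alpha> + v (- \<alpha>)\<close> is never positive,
      \<open>v (- \<alpha>) < v \<alpha>\<close> and \<open>key\<close> applies; a positive gap
      excludes \<open>v \<alpha> = 0\<close> in the same way.\<close>
    show "\<alpha> \<bullet> x \<le> U \<alpha>"
      using key[OF a] opp[OF a] opp'[of \<alpha>] by (force simp: v_def)
    show "\<alpha> \<bullet> x < U \<alpha>" if "0 < U \<alpha> + U (- \<alpha>)"
      using key[OF a] that opp'[of \<alpha>] by (force simp: v_def)
  qed
qed

section \<open>Sums of positive roots\<close>

text \<open>One fixed functional that is positive on \<open>P\<close> plays the role of the height:
  it shows that nonempty sums of positive roots are nonzero, decides the sign of a root and singles
  out maximal roots.\<close>

definition height_vec :: 'a where
  "height_vec = (SOME v. (\<forall>\<alpha>\<in>\<Phi>. \<alpha> \<bullet> v \<noteq> 0) \<and> P = {\<alpha>\<in>\<Phi>. \<alpha> \<bullet> v > 0})"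

lemma height_vec: "\<And>\<alpha>. \<alpha> \<in> \<Phi> \<Longrightarrow> \<alpha> \<bullet> height_vec \<noteq> 0" and P_eq: "P = {\<alpha>\<in>\<Phi>. \<alpha> \<bullet> height_vec > 0}"
  using someI_ex[OF pos[unfolded positive_system_def]] unfolding height_vec_def by blast+

lemma P_root: "\<alpha> \<in> P \<Longrightarrow> \<alpha> \<in> \<Phi>" and P_height: "\<alpha> \<in> P \<Longrightarrow> 0 < \<alpha> \<bullet> height_vec"
  using P_eq by auto

lemma P_subset: "P \<subseteq> \<Phi>" using P_root by blast

lemma finite_P: "finite P" using finite_subset[OF P_subset finite_roots] .

lemma zero_notin_P: "0 \<notin> P" using P_root zero_not_root by blast

lemma P_I: "\<alpha> \<in> \<Phi> \<Longrightarrow> 0 < \<alpha> \<bullet> height_vec \<Longrightarrow> \<alpha> \<in> P"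
  using P_eq by auto

lemma root_cases: "\<alpha> \<in> \<Phi> \<Longrightarrow> \<alpha> \<in> P \<or> - \<alpha> \<in> P"
  using height_vec[of \<alpha>] uminus_root[of \<alpha>] P_I[of \<alpha>] P_I[of "- \<alpha>"] by fastforce

lemma uminus_notin_P: "\<alpha> \<in> P \<Longrightarrow> - \<alpha> \<notin> P"
  using P_height[of \<alpha>] P_height[of "- \<alpha>"] by auto

lemma P_inner_pos: "\<alpha> \<in> P \<Longrightarrow> 0 < \<alpha> \<bullet> \<alpha>" using P_root root_inner_pos by blast

lemma span_P: "span P = UNIV"
proof -
  have "\<Phi> \<subseteq> span P"
  proof
    fix \<alpha> assume "\<alpha> \<in> \<Phi>"
    thus "\<alpha> \<in> span P" using root_cases[of \<alpha>] span_base[of \<alpha> P] span_neg[OF span_base, of "- \<alpha>" P] by auto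
  qed
  hence "span \<Phi> \<subseteq> span P" by (simp add: span_minimal)
  thus ?thesis using span_roots by auto
qed

lemma sum_mset_height_nonneg: "set_mset M \<subseteq> P \<Longrightarrow> 0 \<le> \<Sum>\<^sub># M \<bullet> height_vec"
  by (induction M) (auto simp: inner_add_left intro!: add_nonneg_nonneg dest: P_height)

lemma sum_mset_height_pos: "set_mset M \<subseteq> P \<Longrightarrow> M \<noteq> {#} \<Longrightarrow> 0 < \<Sum>\<^sub># M \<bullet> height_vec"
  by (cases M) (auto simp: inner_add_left intro!: add_pos_nonneg sum_mset_height_nonneg dest: P_height)

text \<open>A summand with positive inner product with the whole sum can be subtracted and leaves a
  root. Iterated, this orders any expression of a root so that all partial sums are roots.\<close>

lemma mset_pull:
  assumes M: "set_mset M \<subseteq> P" and g: "\<Sum>\<^sub># M \<in> P" and sz: "size M \<ge> 2"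
  obtains c M' where "M = add_mset c M'" "\<Sum>\<^sub># M' \<in> P"
proof -
  obtain c where c: "c \<in># M" "0 < c \<bullet> \<Sum>\<^sub># M"
    using sum_mset_inner_pos_ex[of M "\<Sum>\<^sub># M"] P_inner_pos[OF g] by blast
  then obtain M' where M': "M = add_mset c M'" by (metis insert_DiffM)
  have "M' \<noteq> {#}" using sz M' by auto
  hence pos: "0 < \<Sum>\<^sub># M' \<bullet> height_vec" using M M' sum_mset_height_pos by auto
  hence "\<Sum>\<^sub># M \<noteq> c" using M' by auto
  hence "\<Sum>\<^sub># M - c \<in> \<Phi>" using c g M by (intro diff_root) (auto dest: P_root simp: inner_commute)
  hence "\<Sum>\<^sub># M' \<in> P" using pos M' by (intro P_I) auto
  thus ?thesis using that M' by blast
qed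

text \<open>Some summand \<open>c\<close> has positive inner product with \<alpha> or with \<beta>,
  say with \<alpha>, so \<alpha> and \<open>c\<close> are equal or differ by a root. If \<alpha> - c
  is positive, hand \<open>c\<close> to \<alpha> and recurse. If c - \<alpha> is positive,
  \<open>c\<close> is the one summand that is broken and the recursion stops.\<close>

lemma mset_split:
  assumes "set_mset M \<subseteq> P" "\<alpha> \<in> P" "\<beta> \<in> P" "\<alpha> + \<beta> = \<Sum>\<^sub># M"
  shows "(\<exists>A B. M = A + B \<and> \<alpha> = \<Sum>\<^sub># A \<and> \<beta> = \<Sum>\<^sub># B) \<or>
    (\<exists>A B c c1 c2. M = A + B + {#c#} \<and> c1 \<in> P \<and> c2 \<in> P \<and> c = c1 + c2 \<and>
       \<alpha> = \<Sum>\<^sub># A + c1 \<and> \<beta> = \<Sum>\<^sub># B + c2)" (is "?S M \<alpha> \<beta>")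
  using assms
proof (induction "size M" arbitrary: M \<alpha> \<beta>)
  case 0
  hence "(\<alpha> + \<beta>) \<bullet> height_vec = 0" by simp
  with P_height[OF 0(3)] P_height[OF 0(4)] show ?case by (simp add: inner_add_left)
next
  case (Suc n)
  have sym: "?S M a b \<longleftrightarrow> ?S M b a" for a b
  proof -
    have "?S M b a" if "?S M a b" for a b
      using that
    proof (elim disjE exE conjE)
      fix A B assume "M = A + B" "a = \<Sum>\<^sub># A" "b = \<Sum>\<^sub># B"
      thus "?S M b a" by (intro disjI1 exI[of _ B] exI[of _ A]) (auto simp: add.commute)
    next
      fix A B c c1 c2
      assume "M = A + B + {#c#}" "c1 \<in> P" "c2 \<in> P" "c = c1 + c2" "a = \<Sum>\<^sub># A + c1" "b = \<Sum>\<^sub># B + c2"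
      thus "?S M b a"
        by (intro disjI2 exI[of _ B] exI[of _ A] exI[of _ c] exI[of _ c2] exI[of _ c1]) (auto simp: add.commute)
    qed
    thus ?thesis by blast
  qed
  have step: "?S M a b" if ab: "a \<in> P" "b \<in> P" "a + b = \<Sum>\<^sub># M" and c: "c \<in># M" "0 < c \<bullet> a" for a b c
  proof -
    obtain M' where M': "M = add_mset c M'" using c by (metis insert_DiffM)
    have cP: "c \<in> P" using c Suc.prems by auto
    show ?thesis
    proof (cases "a = c")
      case True
      thus ?thesis using M' ab by (intro disjI1 exI[of _ "{#c#}"] exI[of _ M']) auto
    next
      case False
      hence r: "a - c \<in> \<Phi>" using c ab cP by (intro diff_root) (auto dest: P_root simp: inner_commute)
      show ?thesis
      proof (cases "a - c \<in> P")
        case True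
        have "?S M' (a - c) b"
          using Suc.hyps(2) Suc.prems(1) M' ab True by (intro Suc.hyps(1)) (auto simp: algebra_simps)
        thus ?thesis
        proof (elim disjE exE conjE)
          fix A B assume "M' = A + B" "a - c = \<Sum>\<^sub># A" "b = \<Sum>\<^sub># B"
          thus ?thesis using M'
            by (intro disjI1 exI[of _ "add_mset c A"] exI[of _ B]) (auto simp: algebra_simps)
        next
          fix A B d c1 c2
          assume "M' = A + B + {#d#}" "c1 \<in> P" "c2 \<in> P" "d = c1 + c2" "a - c = \<Sum>\<^sub># A + c1" "b = \<Sum>\<^sub># B + c2"
          thus ?thesis using M'
            by (intro disjI2 exI[of _ "add_mset c A"] exI[of _ B] exI[of _ d] exI[of _ c1] exI[of _ c2])
              (auto simp: algebra_simps)
        qed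
      next
        case False
        \<comment> \<open>Here \<alpha> is a proper part of \<open>c\<close>; the remainder c -
          \<alpha> and all other summands go to \<beta>.\<close>
        hence "c - a \<in> P" using root_cases[OF r] by simp
        thus ?thesis using M' ab
          by (intro disjI2 exI[of _ "{#}"] exI[of _ M'] exI[of _ c] exI[of _ a] exI[of _ "c - a"])
            (auto simp: algebra_simps)
      qed
    qed
  qed
  have "\<alpha> + \<beta> \<noteq> 0"
  proof
    assume "\<alpha> + \<beta> = 0"
    hence "(\<alpha> + \<beta>) \<bullet> height_vec = 0" by simp
    thus False using P_height[OF Suc.prems(2)] P_height[OF Suc.prems(3)] by (simp add: inner_add_left)
  qed
  hence "0 < \<Sum>\<^sub># M \<bullet> (\<alpha> + \<beta>)" using Suc.prems(4) by simp
  then obtain c where c: "c \<in># M" "0 < c \<bullet> (\<alpha> + \<beta>)" using sum_mset_inner_pos_ex by blast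
  hence "0 < c \<bullet> \<alpha> \<or> 0 < c \<bullet> \<beta>" by (auto simp: inner_add_right)
  moreover have "\<beta> + \<alpha> = \<Sum>\<^sub># M" using Suc.prems(4) by (simp add: add.commute)
  ultimately show ?case
    using step[OF Suc.prems(2,3,4) c(1)] step[OF Suc.prems(3,2) _ c(1)] sym[of \<alpha> \<beta>] by argo
qed

section \<open>Simple roots and the root poset\<close>

definition simples :: "'a set" where
  "simples = {\<alpha>\<in>P. \<not> (\<exists>\<beta>\<in>P. \<exists>\<gamma>\<in>P. \<alpha> = \<beta> + \<gamma>)}"

lemma simples_P: "simples \<subseteq> P" by (auto simp: simples_def)

lemma finite_simples: "finite simples" using finite_subset[OF simples_P finite_P] .

lemma simples_obtuse:
  assumes "\<alpha> \<in> simples" "\<beta> \<in> simples" "\<alpha> \<noteq> \<beta>"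
  shows "\<alpha> \<bullet> \<beta> \<le> 0"
proof (rule ccontr)
  assume "\<not> ?thesis"
  hence "\<alpha> - \<beta> \<in> \<Phi>" using assms simples_P by (intro diff_root) (auto dest: P_root)
  hence "\<alpha> - \<beta> \<in> P \<or> \<beta> - \<alpha> \<in> P" using root_cases by fastforce
  moreover have "\<alpha> = (\<alpha> - \<beta>) + \<beta>" "\<beta> = (\<beta> - \<alpha>) + \<alpha>" by auto
  ultimately show False using assms unfolding simples_def by blast
qed

lemma independent_simples: "independent simples"
  using simples_P P_height simples_obtuse by (intro obtuse_independent[of _ height_vec] finite_simples) auto

lemma sum_of_simples:
  assumes "\<alpha> \<in> P"
  obtains M where "set_mset M \<subseteq> simples" "\<Sum>\<^sub># M = \<alpha>"
proof -
  have "\<exists>M. set_mset M \<subseteq> simples \<and> \<Sum>\<^sub># M = \<alpha>"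
    using assms
  \<comment> \<open>Heights are real numbers, so the induction counts the positive roots of smaller
    height.\<close>
  proof (induction "card {\<beta>\<in>P. \<beta> \<bullet> height_vec < \<alpha> \<bullet> height_vec}" arbitrary: \<alpha> rule: less_induct)
    case less
    show ?case
    proof (cases "\<alpha> \<in> simples")
      case True
      thus ?thesis by (intro exI[of _ "{#\<alpha>#}"]) auto
    next
      case False
      then obtain \<beta> \<gamma> where bg: "\<beta> \<in> P" "\<gamma> \<in> P" "\<alpha> = \<beta> + \<gamma>"
        using less.prems by (auto simp: simples_def)
      have *: "\<exists>M. set_mset M \<subseteq> simples \<and> \<Sum>\<^sub># M = \<delta>" if "\<delta> \<in> P" "\<delta> \<bullet> height_vec < \<alpha> \<bullet> height_vec" for \<delta>
        using that finite_P by (intro less.hyps psubset_card_mono) auto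
      have "\<beta> \<bullet> height_vec < \<alpha> \<bullet> height_vec" "\<gamma> \<bullet> height_vec < \<alpha> \<bullet> height_vec" using bg P_height by (auto simp: inner_add_left)
      then obtain M N where "set_mset M \<subseteq> simples" "\<Sum>\<^sub># M = \<beta>" "set_mset N \<subseteq> simples" "\<Sum>\<^sub># N = \<gamma>"
        using *[OF bg(1)] *[OF bg(2)] by blast
      thus ?thesis using bg by (intro exI[of _ "M + N"]) auto
    qed
  qed
  thus ?thesis using that by blast
qed

lemma span_simples: "span simples = UNIV"
proof -
  have "P \<subseteq> span simples"
  proof
    fix \<alpha> assume "\<alpha> \<in> P"
    then obtain M where "set_mset M \<subseteq> simples" "\<Sum>\<^sub># M = \<alpha>" using sum_of_simples by blast
    then obtain c where "\<alpha> = (\<Sum>s\<in>simples. c s *\<^sub>R s)"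
      using nonneg_comb_sum_mset[OF finite_simples] unfolding nonneg_comb_def by blast
    thus "\<alpha> \<in> span simples" by (simp add: span_base span_scale span_sum)
  qed
  hence "span P \<subseteq> span simples" by (simp add: span_minimal)
  thus ?thesis using span_P by auto
qed

lemma nonneg_comb_simples: "\<alpha> \<in> P \<Longrightarrow> nonneg_comb simples \<alpha>"
  using sum_of_simples nonneg_comb_sum_mset[OF finite_simples] by metis

text \<open>For uniqueness, expand a simple root \<open>s\<close> nonnegatively over
  \<open>D\<close>, and each member of \<open>D\<close> nonnegatively over \<open>simples\<close>.
  Nothing can cancel, so a member of \<open>D\<close> used with positive coefficient is a multiple
  of \<open>s\<close>, hence \<open>s\<close> itself. Independence leaves no room in
  \<open>D\<close> beyond the spanning set \<open>simples\<close>.\<close>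

lemma simple_roots_eq: "simple_roots P = simples"
  unfolding simple_roots_def
proof (rule the_equality)
  show "simples \<subseteq> P \<and> independent simples \<and> (\<forall>\<alpha>\<in>P. nonneg_comb simples \<alpha>)"
    using simples_P independent_simples nonneg_comb_simples by blast
next
  fix D assume D: "D \<subseteq> P \<and> independent D \<and> (\<forall>\<alpha>\<in>P. nonneg_comb D \<alpha>)"
  have finD: "finite D" using D finite_P finite_subset by blast
  have sub: "simples \<subseteq> D"
  proof
    fix s assume s: "s \<in> simples"
    then obtain c where c: "\<forall>d\<in>D. 0 \<le> c d" "s = (\<Sum>d\<in>D. c d *\<^sub>R d)"
      using D simples_P unfolding nonneg_comb_def by blast
    have "\<forall>d\<in>D. \<exists>e. (\<forall>t\<in>simples. 0 \<le> e t) \<and> d = (\<Sum>t\<in>simples. e t *\<^sub>R t)"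
      using D nonneg_comb_simples unfolding nonneg_comb_def by blast
    then obtain e where e: "\<And>d t. d \<in> D \<Longrightarrow> t \<in> simples \<Longrightarrow> 0 \<le> e d t"
      "\<And>d. d \<in> D \<Longrightarrow> d = (\<Sum>t\<in>simples. e d t *\<^sub>R t)" by metis
    have "s = (\<Sum>d\<in>D. c d *\<^sub>R (\<Sum>t\<in>simples. e d t *\<^sub>R t))" using c(2) e(2) by simp
    also have "\<dots> = (\<Sum>t\<in>simples. (\<Sum>d\<in>D. c d * e d t) *\<^sub>R t)"
      by (simp add: scaleR_sum_right scaleR_sum_left) (rule sum.swap)
    finally have "(\<Sum>t\<in>simples. (\<Sum>d\<in>D. c d * e d t) *\<^sub>R t) - s = 0" by simp
    hence "(\<Sum>t\<in>simples. ((\<Sum>d\<in>D. c d * e d t) - (if t = s then 1 else 0)) *\<^sub>R t) = 0"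
      using s finite_simples by (simp add: scaleR_diff_left sum_subtractf if_distrib[of "\<lambda>c. c *\<^sub>R _"] cong: if_cong)
    hence z: "(\<Sum>d\<in>D. c d * e d t) = (if t = s then 1 else 0)" if "t \<in> simples" for t
      using independentD[OF independent_simples finite_simples subset_refl _ that,
        of "\<lambda>t. (\<Sum>d\<in>D. c d * e d t) - (if t = s then 1 else 0)"] by simp
    have "\<exists>d\<in>D. 0 < c d"
    proof (rule ccontr)
      assume "\<not> ?thesis"
      hence "\<forall>d\<in>D. c d = 0" using c(1) by force
      thus False using z[OF s] by simp
    qed
    then obtain d where d: "d \<in> D" "0 < c d" by blast
    have "e d t = 0" if t: "t \<in> simples" "t \<noteq> s" for t
    proof -
      have "(\<Sum>d\<in>D. c d * e d t) = 0" using z t by simp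
      hence "c d * e d t = 0" using sum_nonneg_eq_0_iff[OF finD, of "\<lambda>d. c d * e d t"] c(1) e(1) t(1) d(1) by auto
      thus ?thesis using d by simp
    qed
    hence "(\<Sum>t\<in>simples. e d t *\<^sub>R t) = (\<Sum>t\<in>simples. if t = s then e d s *\<^sub>R s else 0)"
      by (intro sum.cong) auto
    hence ds: "d = e d s *\<^sub>R s" using e(2)[OF d(1)] s finite_simples by simp
    have "e d s *\<^sub>R s \<in> \<Phi>" using D d(1) P_root ds by auto
    hence "e d s = 1 \<or> e d s = -1" using scaleR_root_iff[of s] s simples_P P_root by blast
    hence "e d s = 1" using e(1)[OF d(1) s] by auto
    thus "s \<in> D" using ds d(1) by simp
  qed
  show "D = simples"
  proof (rule ccontr)
    assume "D \<noteq> simples"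
    then obtain d where "d \<in> D" "d \<notin> simples" using sub by blast
    hence "simples \<subseteq> D - {d}" using sub by blast
    hence "d \<in> span (D - {d})" using span_simples span_mono by blast
    thus False using D \<open>d \<in> D\<close> dependent_def by blast
  qed
qed

text \<open>The vector that represents a coordinate functional of the basis \<open>simples\<close>.
  It serves to move a point in the direction of one simple root only, and to read off the
  coefficient of that root.\<close>

lemma fundamental_coweight:
  assumes "\<sigma> \<in> simples"
  obtains w where "\<sigma> \<bullet> w = 1" "\<And>\<tau>. \<tau> \<in> simples \<Longrightarrow> \<tau> \<noteq> \<sigma> \<Longrightarrow> \<tau> \<bullet> w = 0"
proof -
  obtain f :: "'a \<Rightarrow> real" where f: "linear f" "\<forall>x\<in>simples. f x = (if x = \<sigma> then 1 else 0)"
    using linear_independent_extend[OF independent_simples, of "\<lambda>x. if x = \<sigma> then 1 else 0"] by blast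
  have eq: "x \<bullet> (\<Sum>b\<in>Basis. f b *\<^sub>R b) = f x" for x
  proof -
    have "f x = f (\<Sum>b\<in>Basis. (x \<bullet> b) *\<^sub>R b)" by (simp add: euclidean_representation)
    also have "\<dots> = (\<Sum>b\<in>Basis. (x \<bullet> b) * f b)"
      using f(1) by (simp add: linear_sum linear_scale)
    finally show ?thesis by (simp add: inner_sum_right mult.commute)
  qed
  show ?thesis
    using f(2) assms by (intro that[of "\<Sum>b\<in>Basis. f b *\<^sub>R b"]) (simp_all only: eq if_True if_False simp_thms)
qed

lemma root_le_refl: "\<alpha> \<in> P \<Longrightarrow> root_le P \<alpha> \<alpha>"
  unfolding root_le_def nonneg_comb_def by (intro conjI exI[of _ "\<lambda>_. 0"]) auto

lemma root_le_trans: "root_le P \<alpha> \<beta> \<Longrightarrow> root_le P \<beta> \<gamma> \<Longrightarrow> root_le P \<alpha> \<gamma>"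
  unfolding root_le_def using nonneg_comb_add[of P "\<beta> - \<alpha>" "\<gamma> - \<beta>"] by simp

lemma nonneg_comb_P: "\<alpha> \<in> P \<Longrightarrow> nonneg_comb P \<alpha>"
  using nonneg_comb_sum_mset[OF finite_P, of "{#\<alpha>#}"] by simp

lemma root_le_add: "\<alpha> \<in> P \<Longrightarrow> \<beta> \<in> P \<Longrightarrow> \<alpha> + \<beta> \<in> P \<Longrightarrow> root_le P \<alpha> (\<alpha> + \<beta>)"
  by (simp add: root_le_def nonneg_comb_P)

end

section \<open>Realising geometric chains\<close>

locale geometric_chain = positive_roots +
  fixes m :: nat and J :: "nat \<Rightarrow> 'a set"
  assumes m_pos: "1 \<le> m" and chain: "pos_geom_chain P m J"
begin

lemma J_empty: "J 0 = {}" and simples_J: "simples \<subseteq> J m"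
  using chain by (simp_all add: pos_geom_chain_def simple_roots_eq)

lemma J_is_ideal: "i \<le> m \<Longrightarrow> is_ideal P (J i)"
  using chain by (simp add: pos_geom_chain_def)

lemma J_P: "i \<le> m \<Longrightarrow> J i \<subseteq> P"
  using J_is_ideal[of i] by (simp add: is_ideal_def)

lemma J_ideal: "i \<le> m \<Longrightarrow> \<alpha> \<in> J i \<Longrightarrow> root_le P \<beta> \<alpha> \<Longrightarrow> \<beta> \<in> J i"
  using J_is_ideal[of i] by (auto simp: is_ideal_def root_le_def)

lemma J_add:
  assumes "i + j \<le> m" "\<alpha> \<in> J i" "\<beta> \<in> J j" "\<alpha> + \<beta> \<in> P"
  shows "\<alpha> + \<beta> \<in> J (i + j)"
proof -
  have "sumset (J i) (J j) \<inter> P \<subseteq> J (i + j)" using chain assms(1) by (simp add: pos_geom_chain_def)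
  moreover have "\<alpha> + \<beta> \<in> sumset (J i) (J j)" using assms unfolding sumset_def by blast
  ultimately show ?thesis using assms(4) by blast
qed

lemma I_add:
  assumes "\<alpha> \<in> P - J (min i m)" "\<beta> \<in> P - J (min j m)" "\<alpha> + \<beta> \<in> P"
  shows "\<alpha> + \<beta> \<notin> J (min (i + j) m)"
proof -
  have "sumset (chain_I P m J i) (chain_I P m J j) \<inter> P \<subseteq> chain_I P m J (i + j)"
    using chain by (simp add: pos_geom_chain_def)
  moreover have "\<alpha> + \<beta> \<in> sumset (chain_I P m J i) (chain_I P m J j)"
    using assms unfolding sumset_def chain_I_def by blast
  ultimately have "\<alpha> + \<beta> \<in> chain_I P m J (i + j)" using assms(3) by blast
  thus ?thesis by (simp add: chain_I_def)
qed

lemma J_mono: "i \<le> j \<Longrightarrow> j \<le> m \<Longrightarrow> J i \<subseteq> J j"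
proof (induction j rule: dec_induct)
  case (step n)
  have "J n \<subseteq> J (Suc n)" using chain step.prems by (simp add: pos_geom_chain_def)
  thus ?case using step by auto
qed simp

section \<open>Least total level of an expression\<close>

definition lev :: "'a \<Rightarrow> nat" where
  "lev \<gamma> = (LEAST i. \<gamma> \<in> J i)"

lemma lev: "\<gamma> \<in> J m \<Longrightarrow> \<gamma> \<in> J (lev \<gamma>)" and lev_le_m: "\<gamma> \<in> J m \<Longrightarrow> lev \<gamma> \<le> m"
  and lev_le: "\<gamma> \<in> J i \<Longrightarrow> lev \<gamma> \<le> i"
  unfolding lev_def by (auto intro: LeastI Least_le)

lemma lev_pos: "\<gamma> \<in> J m \<Longrightarrow> 1 \<le> lev \<gamma>"
  using lev[of \<gamma>] J_empty by (cases "lev \<gamma>") auto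

definition wt :: "'a multiset \<Rightarrow> nat" where
  "wt M = (\<Sum>\<gamma>\<in>#M. lev \<gamma>)"

lemma wt_simps [simp]: "wt {#} = 0" "wt (add_mset c M) = lev c + wt M" "wt (M + N) = wt M + wt N"
  by (auto simp: wt_def)

lemma wt_pos: "set_mset M \<subseteq> J m \<Longrightarrow> M \<noteq> {#} \<Longrightarrow> 1 \<le> wt M"
  by (cases M) (auto dest: lev_pos)

lemma Jm_P: "J m \<subseteq> P" by (simp add: J_P)

text \<open>\<open>mset_pull\<close> supplies an order of summation in which all partial sums are
  positive roots, so \<open>J_add\<close> applies at every step.\<close>

lemma sum_mset_J:
  assumes "set_mset M \<subseteq> J m" "\<Sum>\<^sub># M \<in> P" "wt M \<le> m"
  shows "\<Sum>\<^sub># M \<in> J (wt M)"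
  using assms
proof (induction "size M" arbitrary: M)
  case 0
  thus ?case using zero_notin_P by simp
next
  case (Suc n)
  show ?case
  proof (cases n)
    case 0
    then obtain c where "M = {#c#}" using Suc.hyps(2) by (metis One_nat_def size_1_singleton_mset)
    thus ?thesis using lev Suc.prems by simp
  next
    case (Suc n')
    have sz: "size M \<ge> 2" using Suc.hyps(2) Suc by simp
    have "set_mset M \<subseteq> P" using Suc.prems(1) Jm_P by blast
    then obtain c M' where M': "M = add_mset c M'" "\<Sum>\<^sub># M' \<in> P"
      using mset_pull[OF _ Suc.prems(2) sz] by blast
    have "\<Sum>\<^sub># M' \<in> J (wt M')" using M' Suc.prems Suc.hyps by (intro Suc.hyps(1)) auto
    moreover have "c \<in> J (lev c)" using lev M' Suc.prems by auto
    ultimately show ?thesis using J_add[of "lev c" "wt M'" c "\<Sum>\<^sub># M'"] M' Suc.prems by auto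
  qed
qed

text \<open>Up to \<open>m\<close> this is the index at which a root enters the chain
  (\<open>J_iff_r\<close>); it also assigns a value to the roots outside \<open>J m\<close>. The
  simple roots lie in \<open>J m\<close>, so every positive root has an expression.\<close>

definition r :: "'a \<Rightarrow> nat" where
  "r \<alpha> = (LEAST n. \<exists>M. set_mset M \<subseteq> J m \<and> \<Sum>\<^sub># M = \<alpha> \<and> wt M = n)"

lemma r_obtain:
  assumes "\<alpha> \<in> P"
  obtains M where "set_mset M \<subseteq> J m" "\<Sum>\<^sub># M = \<alpha>" "wt M = r \<alpha>"
proof -
  obtain M where "set_mset M \<subseteq> simples" "\<Sum>\<^sub># M = \<alpha>" using sum_of_simples[OF assms] .
  hence "\<exists>n M. set_mset M \<subseteq> J m \<and> \<Sum>\<^sub># M = \<alpha> \<and> wt M = n" using simples_J by blast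
  from LeastI_ex[OF this] show ?thesis using that unfolding r_def by blast
qed

lemma r_le: "set_mset M \<subseteq> J m \<Longrightarrow> \<Sum>\<^sub># M = \<alpha> \<Longrightarrow> r \<alpha> \<le> wt M"
  unfolding r_def by (rule Least_le) blast

lemma r_pos:
  assumes "\<alpha> \<in> P"
  shows "1 \<le> r \<alpha>"
proof -
  obtain M where M: "set_mset M \<subseteq> J m" "\<Sum>\<^sub># M = \<alpha>" "wt M = r \<alpha>" using r_obtain[OF assms] .
  have "M \<noteq> {#}" using M assms zero_notin_P by auto
  thus ?thesis using wt_pos M by metis
qed

lemma J_iff_r:
  assumes "i \<le> m" "\<alpha> \<in> P"
  shows "\<alpha> \<in> J i \<longleftrightarrow> r \<alpha> \<le> i"
proof
  assume a: "\<alpha> \<in> J i"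
  hence "set_mset {#\<alpha>#} \<subseteq> J m" using J_mono[OF assms(1)] by auto
  from r_le[OF this] have "r \<alpha> \<le> lev \<alpha>" by simp
  thus "r \<alpha> \<le> i" using lev_le[OF a] by simp
next
  assume le: "r \<alpha> \<le> i"
  obtain M where M: "set_mset M \<subseteq> J m" "\<Sum>\<^sub># M = \<alpha>" "wt M = r \<alpha>" using r_obtain[OF assms(2)] .
  hence "\<alpha> \<in> J (r \<alpha>)" using sum_mset_J[of M] le assms by auto
  thus "\<alpha> \<in> J i" using J_mono[OF le assms(1)] by blast
qed

lemma r_le_add:
  assumes "set_mset A \<subseteq> J m" "c \<in> P"
  shows "r (\<Sum>\<^sub># A + c) \<le> wt A + r c"
proof -
  obtain M where M: "set_mset M \<subseteq> J m" "\<Sum>\<^sub># M = c" "wt M = r c" using r_obtain[OF assms(2)] .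
  thus ?thesis using r_le[of "A + M"] assms by simp
qed

lemma r_subadd:
  assumes "\<alpha> \<in> P" "\<beta> \<in> P"
  shows "r (\<alpha> + \<beta>) \<le> r \<alpha> + r \<beta>"
proof -
  obtain M where M: "set_mset M \<subseteq> J m" "\<Sum>\<^sub># M = \<alpha>" "wt M = r \<alpha>" using r_obtain[OF assms(1)] .
  thus ?thesis using r_le_add[of M \<beta>] assms by simp
qed

text \<open>Neither part has entered the chain one index before its value of \<open>r\<close>. By
  the condition on complements, their sum has not entered at \<open>r c1 + r c2 - 2\<close>
  either.\<close>

lemma r_split:
  assumes c: "c1 \<in> P" "c2 \<in> P" "c1 + c2 \<in> J m"
  shows "r c1 + r c2 \<le> lev (c1 + c2) + 1"
proof -
  let ?i = "r c1 - 1" and ?j = "r c2 - 1"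
  have p: "1 \<le> r c1" "1 \<le> r c2" using r_pos c by auto
  have "c1 \<notin> J (min ?i m)" "c2 \<notin> J (min ?j m)"
    using J_iff_r[of "min ?i m" c1] J_iff_r[of "min ?j m" c2] c p by auto
  hence "c1 + c2 \<notin> J (min (?i + ?j) m)" using I_add c Jm_P by blast
  hence "\<not> lev (c1 + c2) \<le> min (?i + ?j) m" using lev[OF c(3)] J_mono[of "lev (c1 + c2)" "min (?i + ?j) m"] by auto
  \<comment> \<open>The truncation at \<open>m\<close> is harmless because \<open>lev\<close> is at
    most \<open>m\<close> on \<open>J m\<close>.\<close>
  thus ?thesis using lev_le_m[OF c(3)] p by linarith
qed

text \<open>Share out an optimal expression of the sum by \<open>mset_split\<close>; only a broken
  summand costs anything, and by \<open>r_split\<close> it costs at most 1.\<close>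

lemma r_superadd:
  assumes "\<alpha> \<in> P" "\<beta> \<in> P" "\<alpha> + \<beta> \<in> P"
  shows "r \<alpha> + r \<beta> \<le> r (\<alpha> + \<beta>) + 1"
proof -
  obtain M where M: "set_mset M \<subseteq> J m" "\<Sum>\<^sub># M = \<alpha> + \<beta>" "wt M = r (\<alpha> + \<beta>)" using r_obtain[OF assms(3)] .
  have "set_mset M \<subseteq> P" using M Jm_P by blast
  from mset_split[OF this assms(1,2) M(2)[symmetric]] show ?thesis
  proof (elim disjE exE conjE)
    fix A B assume *: "M = A + B" "\<alpha> = \<Sum>\<^sub># A" "\<beta> = \<Sum>\<^sub># B"
    hence "r \<alpha> \<le> wt A" "r \<beta> \<le> wt B" using r_le M(1) by auto
    thus ?thesis using M(3) * by simp
  next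
    fix A B c c1 c2
    assume *: "M = A + B + {#c#}" "c1 \<in> P" "c2 \<in> P" "c = c1 + c2" "\<alpha> = \<Sum>\<^sub># A + c1" "\<beta> = \<Sum>\<^sub># B + c2"
    hence "r \<alpha> \<le> wt A + r c1" "r \<beta> \<le> wt B + r c2" "r c1 + r c2 \<le> lev c + 1"
      using r_le_add[of A c1] r_le_add[of B c2] r_split[of c1 c2] M(1) by auto
    thus ?thesis using M(3) * by simp
  qed
qed

section \<open>Additivity along indecomposable roots\<close>

lemma indecomposable_J: "indecomposable P m J \<alpha> \<Longrightarrow> \<alpha> \<in> J m"
  and indecomposable_P: "indecomposable P m J \<alpha> \<Longrightarrow> \<alpha> \<in> P"
  using Jm_P by (auto simp: indecomposable_def)

lemma r_indecomposable:
  assumes "indecomposable P m J t"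
  shows "r t = m"
proof -
  have "\<not> r t \<le> m - 1" using J_iff_r[of "m - 1" t] assms indecomposable_P[OF assms] by (auto simp: indecomposable_def)
  thus ?thesis using J_iff_r[of m t] indecomposable_J[OF assms] indecomposable_P[OF assms] by simp
qed

text \<open>Otherwise the root has an expression of weight exactly \<open>m\<close> with at least
  two summands. Pulling off one summand writes it as a sum of two members of the chain with positive
  indices adding up to \<open>m\<close>, which is forbidden.\<close>

lemma indecomposable_weight:
  assumes t: "indecomposable P m J (\<Sum>\<^sub># A + c)" and A: "set_mset A \<subseteq> J m" "A \<noteq> {#}" and c: "c \<in> P"
  shows "m < wt A + r c"
proof (rule ccontr)
  assume "\<not> ?thesis"
  hence eq: "wt A + r c = m" using r_le_add[OF A(1) c] r_indecomposable[OF t] by simp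
  obtain N where N: "set_mset N \<subseteq> J m" "\<Sum>\<^sub># N = c" "wt N = r c" using r_obtain[OF c] .
  have tP: "\<Sum>\<^sub># (A + N) \<in> P" using N indecomposable_P[OF t] by simp
  have "N \<noteq> {#}" using N c zero_notin_P by auto
  hence "1 \<le> size A" "1 \<le> size N" using A by (auto simp: Suc_le_eq nonempty_has_size)
  hence sz: "2 \<le> size (A + N)" by simp
  have AN: "set_mset (A + N) \<subseteq> J m" using A N by auto
  hence "set_mset (A + N) \<subseteq> P" using Jm_P by blast
  from mset_pull[OF this tP sz] obtain d M' where M': "A + N = add_mset d M'" "\<Sum>\<^sub># M' \<in> P" .
  have w: "lev d + wt M' = m" using eq N M'(1) by (metis wt_simps(2,3))
  have J': "d \<in> J m" "set_mset M' \<subseteq> J m" using AN M'(1) by auto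
  have "M' \<noteq> {#}" using M' zero_notin_P by auto
  hence "1 \<le> wt M'" "1 \<le> lev d" using J' wt_pos lev_pos by auto
  moreover have "\<Sum>\<^sub># M' \<in> J (wt M')" using sum_mset_J[OF J'(2) M'(2)] w by simp
  moreover have "\<Sum>\<^sub># A + c = d + \<Sum>\<^sub># M'"
    using arg_cong[OF M'(1), of sum_mset] N by simp
  ultimately show False using t w lev[OF J'(1)] unfolding indecomposable_def by blast
qed

lemma r_indecomposable_add:
  assumes t: "indecomposable P m J t" and d: "\<delta> \<in> P" "t + \<delta> \<in> P"
  shows "r (t + \<delta>) = m + r \<delta>"
proof (rule antisym)
  have tP: "t \<in> P" using t indecomposable_P by blast
  show "r (t + \<delta>) \<le> m + r \<delta>" using r_subadd[OF tP d(1)] r_indecomposable[OF t] by simp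
  obtain M where M: "set_mset M \<subseteq> J m" "\<Sum>\<^sub># M = t + \<delta>" "wt M = r (t + \<delta>)" using r_obtain[OF d(2)] .
  have "set_mset M \<subseteq> P" using M Jm_P by blast
  from mset_split[OF this tP d(1) M(2)[symmetric]] show "m + r \<delta> \<le> r (t + \<delta>)"
  proof (elim disjE exE conjE)
    fix A B assume *: "M = A + B" "t = \<Sum>\<^sub># A" "\<delta> = \<Sum>\<^sub># B"
    hence "r t \<le> wt A" "r \<delta> \<le> wt B" using r_le M(1) by auto
    thus ?thesis using M(3) * r_indecomposable[OF t] by simp
  next
    fix A B c c1 c2
    assume *: "M = A + B + {#c#}" "c1 \<in> P" "c2 \<in> P" "c = c1 + c2" "t = \<Sum>\<^sub># A + c1" "\<delta> = \<Sum>\<^sub># B + c2"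
    have c: "c \<in> J m" using * M(1) by auto
    \<comment> \<open>If only a part of \<open>c\<close> were needed for \<open>t\<close>, then
      \<open>c\<close> would lie strictly above \<open>t\<close> in \<open>J m\<close> and outside
      \<open>J (m - 1)\<close>, against maximality.\<close>
    have A: "A \<noteq> {#}"
    proof
      assume "A = {#}"
      hence ct: "c = t + c2" using * by simp
      hence le: "root_le P t c" using root_le_add[OF tP \<open>c2 \<in> P\<close>] c Jm_P by auto
      hence "c \<notin> J (m - 1)" using J_ideal[of "m - 1" c t] t by (auto simp: indecomposable_def)
      hence "c = t" using t c le by (auto simp: indecomposable_def)
      thus False using ct \<open>c2 \<in> P\<close> zero_notin_P by simp
    qed
    \<comment> \<open>The strict inequality gains the 1 that breaking \<open>c\<close>
      loses.\<close>
    have "m < wt A + r c1" using indecomposable_weight[of A c1] A M(1) * t by auto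
    moreover have "r \<delta> \<le> wt B + r c2" "r c1 + r c2 \<le> lev c + 1"
      using r_le_add[of B c2] r_split[of c1 c2] M(1) * by auto
    ultimately show ?thesis using M(3) * by simp
  qed
qed

text \<open>The summands must be added one at a time without leaving the roots. It is enough that
  some \<open>t\<close> can be removed from the total or added to \<delta>; the next root addition
  is then of the kind handled by \<open>r_indecomposable_add\<close>.\<close>

lemma r_add_indecomposables:
  assumes "\<And>t. t \<in># ts \<Longrightarrow> indecomposable P m J t" "\<delta> \<in> P" "\<Sum>\<^sub># ts + \<delta> \<in> P"
  shows "r (\<Sum>\<^sub># ts + \<delta>) = m * size ts + r \<delta>"
  using assms
proof (induction "size ts" arbitrary: ts \<delta>)
  case 0
  thus ?case by simp
next
  case (Suc n)
  define \<gamma> where "\<gamma> = \<Sum>\<^sub># ts + \<delta>"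
  have tsP: "set_mset ts \<subseteq> P" using Suc.prems indecomposable_P by blast
  have ne: "ts \<noteq> {#}" using Suc.hyps(2) by auto
  \<comment> \<open>If neither were possible, the sum of \<open>ts\<close> would have nonpositive
    inner product with the total and with -\<delta>, hence with itself.\<close>
  have "(\<exists>t\<in>#ts. 0 < t \<bullet> \<gamma>) \<or> (\<exists>t\<in>#ts. t \<bullet> \<delta> < 0)"
  proof (rule ccontr)
    assume "\<not> ?thesis"
    hence *: "\<not> 0 < \<Sum>\<^sub># ts \<bullet> \<gamma>" "\<not> 0 < \<Sum>\<^sub># ts \<bullet> (- \<delta>)"
      using sum_mset_inner_pos_ex[of ts \<gamma>] sum_mset_inner_pos_ex[of ts "- \<delta>"] by auto
    hence "\<Sum>\<^sub># ts \<bullet> \<Sum>\<^sub># ts \<le> 0" by (simp add: \<gamma>_def inner_add_right)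
    hence "\<Sum>\<^sub># ts = 0" by (metis inner_gt_zero_iff not_le)
    thus False using sum_mset_height_pos[OF tsP ne] by simp
  qed
  thus ?case
  proof (elim disjE bexE)
    fix t assume t: "t \<in># ts" "0 < t \<bullet> \<gamma>"
    then obtain ts' where ts': "ts = add_mset t ts'" by (metis insert_DiffM)
    have it: "indecomposable P m J t" using Suc.prems t by blast
    have "0 < (\<Sum>\<^sub># ts' + \<delta>) \<bullet> height_vec"
      using P_height[OF Suc.prems(2)] sum_mset_height_nonneg[of ts'] tsP ts' by (simp add: inner_add_left)
    moreover have eq: "\<gamma> - t = \<Sum>\<^sub># ts' + \<delta>" using ts' by (simp add: \<gamma>_def)
    moreover have "\<gamma> - t \<in> \<Phi>"
    proof (rule diff_root)
      show "\<gamma> \<in> \<Phi>" "t \<in> \<Phi>" using Suc.prems(3) P_root indecomposable_P[OF it] by (auto simp: \<gamma>_def)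
      show "0 < \<gamma> \<bullet> t" using t by (simp add: inner_commute)
      show "\<gamma> \<noteq> t" using eq calculation by auto
    qed
    ultimately have "\<Sum>\<^sub># ts' + \<delta> \<in> P" by (auto intro: P_I)
    moreover from this have "r (\<Sum>\<^sub># ts' + \<delta>) = m * size ts' + r \<delta>"
      using Suc.prems Suc.hyps ts' by (intro Suc.hyps(1)) auto
    ultimately show ?case
      using r_indecomposable_add[OF it, of "\<Sum>\<^sub># ts' + \<delta>"] Suc.prems(3) ts' by (simp add: add.assoc)
  next
    fix t assume t: "t \<in># ts" "t \<bullet> \<delta> < 0"
    then obtain ts' where ts': "ts = add_mset t ts'" by (metis insert_DiffM)
    have it: "indecomposable P m J t" using Suc.prems t by blast
    have tP: "t \<in> P" using it indecomposable_P by blast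
    have "t + \<delta> \<in> \<Phi>"
      using t tP Suc.prems(2) P_root uminus_notin_P[OF Suc.prems(2)] by (intro add_root) auto
    hence td: "t + \<delta> \<in> P" using P_height[OF tP] P_height[OF Suc.prems(2)] by (intro P_I) (auto simp: inner_add_left)
    have "r (\<Sum>\<^sub># ts' + (t + \<delta>)) = m * size ts' + r (t + \<delta>)"
      using Suc.prems Suc.hyps ts' td by (intro Suc.hyps(1)) (auto simp: algebra_simps)
    thus ?case using r_indecomposable_add[OF it Suc.prems(2) td] ts' by (simp add: algebra_simps)
  qed
qed

text \<open>Prescribing \<open>(\<alpha>, x) = m\<close> on \<open>T\<close> forces \<open>(\<gamma>, x) = r \<gamma>\<close> on \<open>nat_cone T\<close>.\<close>
definition nat_cone :: "'a set \<Rightarrow> 'a set" where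
  "nat_cone T = {\<gamma>\<in>P. \<exists>M. M \<noteq> {#} \<and> set_mset M \<subseteq> T \<and> \<Sum>\<^sub># M = \<gamma>}"

lemma r_nat_cone:
  assumes T: "T \<subseteq> {\<alpha>. indecomposable P m J \<alpha>}" and M: "M \<noteq> {#}" "set_mset M \<subseteq> T" "\<Sum>\<^sub># M \<in> P"
  shows "r (\<Sum>\<^sub># M) = m * size M"
proof -
  obtain t M' where M': "M = add_mset t M'" using M(1) by (meson multiset_cases)
  have t: "indecomposable P m J t" using M T M' by auto
  have "r (\<Sum>\<^sub># M' + t) = m * size M' + r t"
    using M M' T indecomposable_P[OF t] by (intro r_add_indecomposables) (auto simp: add.commute)
  thus ?thesis using M' r_indecomposable[OF t] by (simp add: add.commute)
qed

lemma r_add_nat_cone: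
  assumes T: "T \<subseteq> {\<alpha>. indecomposable P m J \<alpha>}" and a: "\<alpha> \<in> nat_cone T" and b: "\<beta> \<in> P" and ab: "\<alpha> + \<beta> \<in> P"
  shows "r (\<alpha> + \<beta>) = r \<alpha> + r \<beta>"
proof -
  obtain M where M: "M \<noteq> {#}" "set_mset M \<subseteq> T" "\<Sum>\<^sub># M = \<alpha>" "\<alpha> \<in> P" using a by (auto simp: nat_cone_def)
  have "r \<alpha> = m * size M" using r_nat_cone[OF T M(1,2)] M(3,4) by simp
  moreover have "r (\<Sum>\<^sub># M + \<beta>) = m * size M + r \<beta>"
    using M T b ab by (intro r_add_indecomposables) auto
  ultimately show ?thesis using M(3) by simp
qed

lemma nat_cone_add_mem:
  assumes "\<alpha> \<in> nat_cone T" "\<beta> \<in> nat_cone T" "\<alpha> + \<beta> \<in> P"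
  shows "\<alpha> + \<beta> \<in> nat_cone T"
proof -
  obtain M N where "M \<noteq> {#}" "set_mset M \<subseteq> T" "\<Sum>\<^sub># M = \<alpha>" "set_mset N \<subseteq> T" "\<Sum>\<^sub># N = \<beta>"
    using assms by (auto simp: nat_cone_def)
  thus ?thesis using assms(3) unfolding nat_cone_def by (auto intro!: exI[of _ "M + N"])
qed

text \<open>If the split breaks an element \<open>c\<close> of \<open>T\<close>, equality forces
  \<open>r c1 + r c2 = m\<close>, which decomposes \<open>c\<close> inside the chain. So no element
  is broken and both parts are sums over \<open>T\<close>.\<close>

lemma nat_cone_summand:
  assumes T: "T \<subseteq> {\<alpha>. indecomposable P m J \<alpha>}" and a: "\<alpha> \<in> P" and b: "\<beta> \<in> P"
    and ab: "\<alpha> + \<beta> \<in> nat_cone T" and eq: "r (\<alpha> + \<beta>) = r \<alpha> + r \<beta>"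
  shows "\<alpha> \<in> nat_cone T \<and> \<beta> \<in> nat_cone T"
proof -
  obtain M where M: "M \<noteq> {#}" "set_mset M \<subseteq> T" "\<Sum>\<^sub># M = \<alpha> + \<beta>" "\<alpha> + \<beta> \<in> P" using ab by (auto simp: nat_cone_def)
  have rM: "r (\<alpha> + \<beta>) = m * size M" using r_nat_cone[OF T M(1,2)] M(3,4) by simp
  have "set_mset M \<subseteq> P" using M T indecomposable_P by blast
  from mset_split[OF this a b M(3)[symmetric]] show ?thesis
  proof (elim disjE exE conjE)
    fix A B assume *: "M = A + B" "\<alpha> = \<Sum>\<^sub># A" "\<beta> = \<Sum>\<^sub># B"
    have "A \<noteq> {#}" "B \<noteq> {#}" using * a b zero_notin_P by auto
    thus ?thesis using * M a b unfolding nat_cone_def by auto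
  next
    fix A B c c1 c2
    assume *: "M = A + B + {#c#}" "c1 \<in> P" "c2 \<in> P" "c = c1 + c2" "\<alpha> = \<Sum>\<^sub># A + c1" "\<beta> = \<Sum>\<^sub># B + c2"
    have c: "indecomposable P m J c" using * M(2) T by auto
    have "r \<alpha> = m * size A + r c1" "r \<beta> = m * size B + r c2"
      using * M(2) T a b by (auto intro!: r_add_indecomposables)
    hence sum: "r c1 + r c2 = m" using eq rM *(1) by (simp add: algebra_simps)
    have "1 \<le> r c1" "1 \<le> r c2" using * r_pos by auto
    moreover have "c1 \<in> J (r c1)" "c2 \<in> J (r c2)" using J_iff_r * sum by auto
    ultimately have False using c sum *(4) unfolding indecomposable_def by blast
    thus ?thesis ..
  qed
qed

text \<open>An upper bound on -\<alpha> is a lower bound on \<alpha>, so \<open>U\<close> encodes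
  the whole system as upper bounds on all roots. It remains to check pairs of roots whose sum is a
  root.\<close>

lemma exists_point:
  assumes T: "T \<subseteq> {\<alpha>. indecomposable P m J \<alpha>}"
  obtains x where "\<And>\<alpha>. \<alpha> \<in> nat_cone T \<Longrightarrow> \<alpha> \<bullet> x = real (r \<alpha>)"
    and "\<And>\<alpha>. \<alpha> \<in> P \<Longrightarrow> \<alpha> \<notin> nat_cone T \<Longrightarrow> real (r \<alpha>) - 1 < \<alpha> \<bullet> x \<and> \<alpha> \<bullet> x < real (r \<alpha>)"
proof -
  define L where "L \<alpha> = real (r \<alpha>) - (if \<alpha> \<in> nat_cone T then 0 else 1)" for \<alpha>
  define U where "U \<alpha> = (if \<alpha> \<in> P then real (r \<alpha>) else - L (- \<alpha>))" for \<alpha>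
  have E_P: "\<alpha> \<in> nat_cone T \<Longrightarrow> \<alpha> \<in> P" for \<alpha> by (simp add: nat_cone_def)
  have U_pos: "U \<alpha> = real (r \<alpha>)" and U_neg: "U (- \<alpha>) = - L \<alpha>" if "\<alpha> \<in> P" for \<alpha>
    using that uminus_notin_P[OF that] by (auto simp: U_def)
  \<comment> \<open>These are the subadditivity of \<open>U\<close> for the possible signs: two
    positive roots, two negative roots, and roots of opposite sign with positive or negative
    sum.\<close>
  have three: "real (r (\<alpha> + \<beta>)) \<le> r \<alpha> + r \<beta> \<and> L \<alpha> + L \<beta> \<le> L (\<alpha> + \<beta>) \<and>
      r \<alpha> + L \<beta> \<le> r (\<alpha> + \<beta>) \<and> L (\<alpha> + \<beta>) \<le> L \<alpha> + r \<beta>"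
    if ab: "\<alpha> \<in> P" "\<beta> \<in> P" "\<alpha> + \<beta> \<in> P" for \<alpha> \<beta>
  proof -
    have sub: "r (\<alpha> + \<beta>) \<le> r \<alpha> + r \<beta>" using r_subadd ab by blast
    have super: "r \<alpha> + r \<beta> \<le> r (\<alpha> + \<beta>) + 1" using r_superadd ab by blast
    have eqE: "r (\<alpha> + \<beta>) = r \<alpha> + r \<beta>" if "\<alpha> \<in> nat_cone T \<or> \<beta> \<in> nat_cone T"
      using that r_add_nat_cone[OF T, of \<alpha> \<beta>] r_add_nat_cone[OF T, of \<beta> \<alpha>] ab by (auto simp: add.commute)
    have EE: "\<alpha> + \<beta> \<in> nat_cone T" if "\<alpha> \<in> nat_cone T" "\<beta> \<in> nat_cone T" using nat_cone_add_mem that ab by blast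
    have "\<alpha> + \<beta> \<in> nat_cone T \<Longrightarrow> r (\<alpha> + \<beta>) = r \<alpha> + r \<beta> \<Longrightarrow> \<alpha> \<in> nat_cone T \<and> \<beta> \<in> nat_cone T"
      using nat_cone_summand[OF T ab(1,2)] .
    \<comment> \<open>Where the lower bound on the sum is tight but that on a part is not,
      integrality turns the strict inequality into the missing unit.\<close>
    hence "r (\<alpha> + \<beta>) + 1 \<le> r \<alpha> + r \<beta>" if "\<alpha> + \<beta> \<in> nat_cone T" "\<not> (\<alpha> \<in> nat_cone T \<and> \<beta> \<in> nat_cone T)"
      using that sub by (cases "r (\<alpha> + \<beta>) = r \<alpha> + r \<beta>") auto
    thus ?thesis using sub super eqE EE unfolding L_def by (auto split: if_splits)
  qed
  have sub: "U (\<alpha> + \<beta>) \<le> U \<alpha> + U \<beta>" if ab: "\<alpha> \<in> \<Phi>" "\<beta> \<in> \<Phi>" "\<alpha> + \<beta> \<in> \<Phi>" for \<alpha> \<beta>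
  proof -
    have mixed: "U (\<alpha> + \<beta>) \<le> U \<alpha> + U \<beta>" if a: "\<alpha> \<in> P" and b: "- \<beta> \<in> P" and ab: "\<alpha> + \<beta> \<in> \<Phi>" for \<alpha> \<beta>
    proof (cases "\<alpha> + \<beta> \<in> P")
      case True
      have "U \<beta> = - L (- \<beta>)" using U_neg[OF b] by simp
      thus ?thesis using three[of "\<alpha> + \<beta>" "- \<beta>"] True a b U_pos by simp
    next
      case False
      hence n: "- (\<alpha> + \<beta>) \<in> P" using root_cases[OF ab] by simp
      have "U \<beta> = - L (- \<beta>)" "U (\<alpha> + \<beta>) = - L (- (\<alpha> + \<beta>))" using U_neg[OF b] U_neg[OF n] by (simp_all only: minus_minus)
      moreover have "- (\<alpha> + \<beta>) + \<alpha> = - \<beta>" by simp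
      ultimately show ?thesis using three[of "- (\<alpha> + \<beta>)" \<alpha>] n a b U_pos by simp
    qed
    consider "\<alpha> \<in> P" "\<beta> \<in> P" | "\<alpha> \<in> P" "- \<beta> \<in> P" | "- \<alpha> \<in> P" "\<beta> \<in> P" | "- \<alpha> \<in> P" "- \<beta> \<in> P"
      using ab root_cases by blast
    thus ?thesis
    proof cases
      case 1
      hence "\<alpha> + \<beta> \<in> P" using ab(3) P_height[of \<alpha>] P_height[of \<beta>] by (intro P_I) (auto simp: inner_add_left)
      thus ?thesis using three[OF 1] 1 U_pos by simp
    next
      case 2
      thus ?thesis using mixed ab by blast
    next
      case 3
      thus ?thesis using mixed[of \<beta> \<alpha>] ab by (simp add: add.commute)
    next
      case 4
      hence n: "- \<alpha> + - \<beta> \<in> P"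
        using uminus_root[OF ab(3)] P_height[of "- \<alpha>"] P_height[of "- \<beta>"]
        by (intro P_I) (auto simp: inner_diff_left inner_add_left)
      have "U \<alpha> = - L (- \<alpha>)" "U \<beta> = - L (- \<beta>)" "U (\<alpha> + \<beta>) = - L (- \<alpha> + - \<beta>)"
        using U_neg[OF 4(1)] U_neg[OF 4(2)] U_neg[OF n] by (simp_all only: minus_add_distrib[symmetric] minus_minus)
      thus ?thesis using three[OF 4 n] by simp
    qed
  qed
  \<comment> \<open>The gap between the bounds vanishes exactly on the cone, where weak inequalities
    become equations; elsewhere the strict part of \<open>subadditive_separation\<close>
    applies.\<close>
  have oppP: "U \<alpha> + U (- \<alpha>) = (if \<alpha> \<in> nat_cone T then 0 else 1)" if "\<alpha> \<in> P" for \<alpha>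
    using U_pos[OF that] U_neg[OF that] by (simp add: L_def)
  have opp: "0 \<le> U \<alpha> + U (- \<alpha>)" if "\<alpha> \<in> \<Phi>" for \<alpha>
    using root_cases[OF that] oppP[of \<alpha>] oppP[of "- \<alpha>"] by (auto split: if_splits)
  obtain x where x: "\<And>\<alpha>. \<alpha> \<in> \<Phi> \<Longrightarrow> \<alpha> \<bullet> x \<le> U \<alpha>"
    "\<And>\<alpha>. \<alpha> \<in> \<Phi> \<Longrightarrow> 0 < U \<alpha> + U (- \<alpha>) \<Longrightarrow> \<alpha> \<bullet> x < U \<alpha>"
    using subadditive_separation[of U, OF sub opp] by blast
  show ?thesis
  proof
    fix \<alpha> assume a: "\<alpha> \<in> nat_cone T"
    hence aP: "\<alpha> \<in> P" by (rule E_P)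
    have "\<alpha> \<bullet> x \<le> r \<alpha>" "- \<alpha> \<bullet> x \<le> - r \<alpha>"
      using x(1)[of \<alpha>] x(1)[of "- \<alpha>"] U_pos[OF aP] U_neg[OF aP] P_root[OF aP] uminus_root a by (auto simp: L_def)
    thus "\<alpha> \<bullet> x = real (r \<alpha>)" by simp
  next
    fix \<alpha> assume a: "\<alpha> \<in> P" "\<alpha> \<notin> nat_cone T"
    have "U (- \<alpha>) + U \<alpha> = 1" using oppP[OF a(1)] a(2) by simp
    hence "\<alpha> \<bullet> x < r \<alpha>" "- \<alpha> \<bullet> x < - (real (r \<alpha>) - 1)"
      using x(2)[of \<alpha>] x(2)[of "- \<alpha>"] U_pos[OF a(1)] U_neg[OF a(1)] P_root[OF a(1)] uminus_root[of \<alpha>] a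
      by (auto simp: L_def)
    thus "real (r \<alpha>) - 1 < \<alpha> \<bullet> x \<and> \<alpha> \<bullet> x < real (r \<alpha>)" by simp
  qed
qed

end

context positive_roots
begin

section \<open>Cells, faces and regions\<close>

text \<open>Level \<open>m\<close> is left open, so that the same notion covers interior points of
  regions and points of the faces contained in hyperplanes of level \<open>m\<close>.\<close>

definition generic :: "nat \<Rightarrow> 'a \<Rightarrow> bool" where
  "generic m x \<longleftrightarrow> (\<forall>\<alpha>\<in>P. 0 < \<alpha> \<bullet> x \<and> (\<forall>r. 0 < r \<and> r < m \<longrightarrow> \<alpha> \<bullet> x \<noteq> real r))"

definition cell :: "nat \<Rightarrow> 'a \<Rightarrow> 'a set" where
  "cell m x = {y. \<forall>\<alpha>\<in>P. \<forall>r\<le>m. sgn (\<alpha> \<bullet> y - real r) = sgn (\<alpha> \<bullet> x - real r)}"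

text \<open>The weak inequality places a contact root in \<open>J m\<close>, so a face has the chain
  of the region on the lower side of its contact hyperplanes. The value beyond \<open>m\<close>
  matches \<open>pos_geom_chain\<close>.\<close>

definition chain_of :: "nat \<Rightarrow> 'a \<Rightarrow> nat \<Rightarrow> 'a set" where
  "chain_of m x i = (if i \<le> m then {\<alpha>\<in>P. \<alpha> \<bullet> x \<le> real i} else {})"

definition contact_roots :: "nat \<Rightarrow> 'a \<Rightarrow> 'a set" where
  "contact_roots m x = {\<alpha>\<in>P. \<alpha> \<bullet> x = real m}"

definition simples_le :: "nat \<Rightarrow> 'a \<Rightarrow> bool" where
  "simples_le m x \<longleftrightarrow> (\<forall>\<sigma>\<in>simples. \<sigma> \<bullet> x \<le> real m)"

lemma cell_self: "x \<in> cell m x" by (simp add: cell_def)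

lemma cell_eq_iff: "cell m x = cell m y \<longleftrightarrow> y \<in> cell m x"
proof
  assume "cell m x = cell m y"
  thus "y \<in> cell m x" using cell_self by simp
next
  assume "y \<in> cell m x"
  thus "cell m x = cell m y" by (simp add: cell_def)
qed

lemma convex_cell: "convex (cell m x)"
proof -
  have "cell m x = (\<Inter>\<alpha>\<in>P. \<Inter>r\<in>{..m}. {y. sgn (\<alpha> \<bullet> y - real r) = sgn (\<alpha> \<bullet> x - real r)})"
    by (auto simp: cell_def)
  thus ?thesis by (simp add: convex_INT convex_sgn_inner)
qed

lemma generic_cell:
  assumes "generic m x" "y \<in> cell m x"
  shows "generic m y"
proof -
  have *: "(\<alpha> \<bullet> y < real r \<longleftrightarrow> \<alpha> \<bullet> x < real r) \<and> (\<alpha> \<bullet> y = real r \<longleftrightarrow> \<alpha> \<bullet> x = real r)" if "\<alpha> \<in> P" "r \<le> m" for \<alpha> r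
    using assms(2) that unfolding cell_def sgn_diff_iff by blast
  show ?thesis unfolding generic_def
  proof (intro ballI conjI allI impI)
    fix \<alpha> assume a: "\<alpha> \<in> P"
    show "0 < \<alpha> \<bullet> y" using *[OF a, of 0] assms(1) a by (auto simp: generic_def)
    fix r assume "0 < r \<and> r < m"
    thus "\<alpha> \<bullet> y \<noteq> real r" using *[OF a, of r] assms(1) a by (auto simp: generic_def)
  qed
qed

lemma sgn_eq_if:
  assumes "generic m x" "generic m y" and a: "\<alpha> \<in> P" "r \<le> m"
    and chain_of: "chain_of m x = chain_of m y" and contact_roots: "r = m \<Longrightarrow> \<alpha> \<bullet> x = real m \<longleftrightarrow> \<alpha> \<bullet> y = real m"
  shows "sgn (\<alpha> \<bullet> y - real r) = sgn (\<alpha> \<bullet> x - real r)"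
proof -
  have le: "\<alpha> \<bullet> y \<le> real r \<longleftrightarrow> \<alpha> \<bullet> x \<le> real r"
    using fun_cong[OF chain_of, of r] a by (auto simp: chain_of_def)
  have "\<alpha> \<bullet> y = real r \<longleftrightarrow> \<alpha> \<bullet> x = real r"
  proof (cases "r = m")
    case False
    thus ?thesis using assms(1,2) a by (cases "r = 0") (auto simp: generic_def)
  qed (use contact_roots in auto)
  thus ?thesis using le by (auto simp: sgn_if)
qed

lemma mem_cell_iff:
  assumes "generic m x" "generic m y"
  shows "y \<in> cell m x \<longleftrightarrow> chain_of m x = chain_of m y \<and> contact_roots m x = contact_roots m y"
proof
  assume "y \<in> cell m x"
  hence *: "(\<alpha> \<bullet> y < real r \<longleftrightarrow> \<alpha> \<bullet> x < real r) \<and> (\<alpha> \<bullet> y = real r \<longleftrightarrow> \<alpha> \<bullet> x = real r)" if "\<alpha> \<in> P" "r \<le> m" for \<alpha> r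
    using that unfolding cell_def sgn_diff_iff by blast
  have "chain_of m x i = chain_of m y i" for i unfolding chain_of_def using * by (auto simp: order_le_less)
  moreover have "contact_roots m x = contact_roots m y" unfolding contact_roots_def using * by blast
  ultimately show "chain_of m x = chain_of m y \<and> contact_roots m x = contact_roots m y" by blast
next
  assume *: "chain_of m x = chain_of m y \<and> contact_roots m x = contact_roots m y"
  show "y \<in> cell m x" unfolding cell_def mem_Collect_eq
  proof (intro ballI allI impI)
    fix \<alpha> r assume a: "\<alpha> \<in> P" "r \<le> m"
    have "\<alpha> \<in> contact_roots m x \<longleftrightarrow> \<alpha> \<in> contact_roots m y" using * by simp
    thus "sgn (\<alpha> \<bullet> y - real r) = sgn (\<alpha> \<bullet> x - real r)"
      using a * by (intro sgn_eq_if[OF assms a]) (auto simp: contact_roots_def)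
  qed
qed

lemma cell_eq_iff_chain_contact:
  assumes "generic m x" "generic m y"
  shows "cell m x = cell m y \<longleftrightarrow> chain_of m x = chain_of m y \<and> contact_roots m x = contact_roots m y"
  using mem_cell_iff[OF assms] cell_eq_iff by simp

text \<open>If a simple root exceeds \<open>m\<close>, move in the direction of its coweight. Roots
  that involve it already exceed \<open>m\<close> and do not decrease, and all others stay constant,
  so the cell contains a ray.\<close>

lemma bounded_cell_iff:
  assumes x: "generic m x"
  shows "bounded (cell m x) \<longleftrightarrow> simples_le m x"
proof
  assume simples_le: "simples_le m x"
  have "cell m x \<subseteq> {y. \<forall>\<sigma>\<in>simples. \<bar>\<sigma> \<bullet> y\<bar> \<le> real m}"
  proof (intro subsetI CollectI ballI)
    fix y \<sigma> assume y: "y \<in> cell m x" and s: "\<sigma> \<in> simples"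
    have sP: "\<sigma> \<in> P" using s simples_P by blast
    have "sgn (\<sigma> \<bullet> y - real m) = sgn (\<sigma> \<bullet> x - real m)" using y sP by (simp add: cell_def)
    hence "\<sigma> \<bullet> y \<le> real m" using simples_le s by (auto simp: simples_le_def sgn_if split: if_splits)
    moreover have "0 < \<sigma> \<bullet> y" using generic_cell[OF x y] sP by (simp add: generic_def)
    ultimately show "\<bar>\<sigma> \<bullet> y\<bar> \<le> real m" by simp
  qed
  thus "bounded (cell m x)"
    using bounded_subset[OF bounded_bounded_inner_spanning[OF finite_simples span_simples]] by blast
next
  assume bdd: "bounded (cell m x)"
  show "simples_le m x"
  proof (rule ccontr)
    assume "\<not> simples_le m x"
    then obtain \<sigma> where s: "\<sigma> \<in> simples" "real m < \<sigma> \<bullet> x" by (auto simp: simples_le_def not_le)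
    obtain w where w: "\<sigma> \<bullet> w = 1" "\<And>\<tau>. \<tau> \<in> simples \<Longrightarrow> \<tau> \<noteq> \<sigma> \<Longrightarrow> \<tau> \<bullet> w = 0"
      using fundamental_coweight[OF s(1)] by blast
    have w0: "0 \<le> \<tau> \<bullet> w" if "\<tau> \<in> simples" for \<tau> using w that by (cases "\<tau> = \<sigma>") auto
    have mem: "x + t *\<^sub>R w \<in> cell m x" if t: "0 \<le> t" for t
      unfolding cell_def mem_Collect_eq
    proof (intro ballI allI impI)
      fix \<alpha> r assume a: "\<alpha> \<in> P" "r \<le> m"
      obtain M where M: "set_mset M \<subseteq> simples" "\<Sum>\<^sub># M = \<alpha>" using sum_of_simples[OF a(1)] .
      show "sgn (\<alpha> \<bullet> (x + t *\<^sub>R w) - real r) = sgn (\<alpha> \<bullet> x - real r)"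
      proof (cases "\<sigma> \<in># M")
        case True
        then obtain M' where M': "M = add_mset \<sigma> M'" by (metis insert_DiffM)
        have nn: "0 \<le> \<Sum>\<^sub># N \<bullet> u" if "set_mset N \<subseteq> simples" "\<And>\<tau>. \<tau> \<in> simples \<Longrightarrow> 0 \<le> \<tau> \<bullet> u" for N and u :: 'a
          using that(1) by (induction N) (auto simp: inner_add_left that(2))
        have "0 \<le> \<tau> \<bullet> x" if "\<tau> \<in> simples" for \<tau> using x that simples_P by (force simp: generic_def)
        hence "0 \<le> \<Sum>\<^sub># M' \<bullet> x" "0 \<le> \<Sum>\<^sub># M \<bullet> w" using nn[of M' x] nn[of M w] M M' w0 by auto
        hence "\<alpha> \<bullet> x > real m" "0 \<le> \<alpha> \<bullet> w" using M M' s by (auto simp: inner_add_left)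
        moreover have "0 \<le> t * (\<alpha> \<bullet> w)" using t calculation by simp
        moreover have "real r \<le> real m" using a by simp
        ultimately show ?thesis by (simp add: inner_add_right)
      next
        case False
        hence "\<forall>\<tau>\<in>#M. \<tau> \<bullet> w = 0" using w(2) M by blast
        hence "\<Sum>\<^sub># M \<bullet> w = 0" by (induction M) (auto simp: inner_add_left)
        thus ?thesis using M by (simp add: inner_add_right)
      qed
    qed
    obtain B where B: "\<And>y. y \<in> cell m x \<Longrightarrow> norm y \<le> B" using bdd by (auto simp: bounded_iff)
    \<comment> \<open>With this \<open>t\<close>, Cauchy-Schwarz reads \<sigma> \<bullet> x + t
      \<le> t.\<close>
    define t where "t = norm \<sigma> * B"
    have B0: "0 \<le> B" using B[OF cell_self] norm_ge_zero[of x] by linarith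
    have "\<sigma> \<bullet> (x + t *\<^sub>R w) \<le> norm \<sigma> * norm (x + t *\<^sub>R w)" by (rule norm_cauchy_schwarz)
    also have "\<dots> \<le> t" unfolding t_def using B[OF mem[of t]] B0 by (intro mult_left_mono) (auto simp: t_def)
    finally have "\<sigma> \<bullet> x \<le> 0" using w by (simp add: inner_add_right)
    thus False using s by simp
  qed
qed

text \<open>Contact roots with positive inner product would differ by a root that vanishes at
  \<open>x\<close>, but all positive roots are positive there. So they are pairwise obtuse.\<close>

lemma independent_contact_roots:
  assumes "generic m x"
  shows "independent (contact_roots m x)"
proof (rule obtuse_independent)
  show "finite (contact_roots m x)" using finite_P by (simp add: contact_roots_def)
  show "0 < s \<bullet> x" if "s \<in> contact_roots m x" for s using that assms by (auto simp: contact_roots_def generic_def)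
  show "s \<bullet> t \<le> 0" if st: "s \<in> contact_roots m x" "t \<in> contact_roots m x" "s \<noteq> t" for s t
  proof (rule ccontr)
    assume "\<not> ?thesis"
    hence r: "s - t \<in> \<Phi>" using st P_root by (intro diff_root) (auto simp: contact_roots_def)
    have "(s - t) \<bullet> x = 0" using st by (simp add: contact_roots_def inner_diff_left)
    moreover have "s - t \<in> P \<or> - (s - t) \<in> P" using root_cases[OF r] .
    ultimately show False using assms by (auto simp: generic_def inner_diff_left)
  qed
qed

text \<open>A generic point attains equality at level \<open>m\<close> only. Hence the cell is the
  affine space of the contact equations intersected with the open set of all strict conditions, and
  has the dimension of that space.\<close>

lemma aff_dim_cell:
  assumes x: "generic m x"
  shows "aff_dim (cell m x) = int DIM('a) - int (card (contact_roots m x))"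
proof -
  define K where "K = {(\<alpha>, r). \<alpha> \<in> P \<and> r \<le> m \<and> \<alpha> \<bullet> x \<noteq> real r}"
  define Q where "Q = (\<Inter>(\<alpha>, r)\<in>K. {y. sgn (\<alpha> \<bullet> y - real r) = sgn (\<alpha> \<bullet> x - real r)})"
  define H where "H = {y. \<forall>t\<in>contact_roots m x. t \<bullet> y = real m}"
  have eq: "cell m x = H \<inter> Q"
  proof (intro equalityI subsetI)
    fix y assume y: "y \<in> cell m x"
    hence "y \<in> Q" by (auto simp: cell_def Q_def K_def)
    moreover have "t \<bullet> y = real m" if "t \<in> contact_roots m x" for t
    proof -
      have "sgn (t \<bullet> y - real m) = sgn (t \<bullet> x - real m)" using that y by (simp add: cell_def contact_roots_def)
      thus ?thesis using that by (simp add: contact_roots_def sgn_0_0)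
    qed
    hence "y \<in> H" by (simp add: H_def)
    ultimately show "y \<in> H \<inter> Q" by blast
  next
    fix y assume y: "y \<in> H \<inter> Q"
    show "y \<in> cell m x" unfolding cell_def mem_Collect_eq
    proof (intro ballI allI impI)
      fix \<alpha> r assume a: "\<alpha> \<in> P" "r \<le> m"
      show "sgn (\<alpha> \<bullet> y - real r) = sgn (\<alpha> \<bullet> x - real r)"
      proof (cases "\<alpha> \<bullet> x = real r")
        case True
        hence "\<not> (0 < r \<and> r < m)" "r \<noteq> 0" using x a unfolding generic_def by force+
        hence "r = m" using a by linarith
        thus ?thesis using True y a by (auto simp: H_def contact_roots_def)
      next
        case False
        hence "(\<alpha>, r) \<in> K" using a by (simp add: K_def)
        thus ?thesis using y by (auto simp: Q_def)
      qed
    qed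
  qed
  have "K \<subseteq> P \<times> {..m}" by (auto simp: K_def)
  hence "finite K" using finite_P finite_subset by blast
  moreover have "open {y. sgn (\<alpha> \<bullet> y - real r) = sgn (\<alpha> \<bullet> x - real r)}" if "(\<alpha>, r) \<in> K" for \<alpha> r
  proof (cases "\<alpha> \<bullet> x < real r")
    case True
    hence "{y. sgn (\<alpha> \<bullet> y - real r) = sgn (\<alpha> \<bullet> x - real r)} = {y. \<alpha> \<bullet> y < real r}" by (auto simp: sgn_if)
    thus ?thesis by (simp add: open_halfspace_lt)
  next
    case False
    hence "\<alpha> \<bullet> x > real r" using that by (auto simp: K_def)
    hence "{y. sgn (\<alpha> \<bullet> y - real r) = sgn (\<alpha> \<bullet> x - real r)} = {y. \<alpha> \<bullet> y > real r}" by (auto simp: sgn_if)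
    thus ?thesis by (simp add: open_halfspace_gt)
  qed
  ultimately have "open Q" unfolding Q_def by (intro open_INT) auto
  moreover have "convex H"
  proof -
    have "H = (\<Inter>t\<in>contact_roots m x. {y. t \<bullet> y = real m})" by (auto simp: H_def)
    thus ?thesis by (simp add: convex_INT convex_hyperplane)
  qed
  moreover have "H \<inter> Q \<noteq> {}" using eq cell_self by blast
  ultimately have "aff_dim (H \<inter> Q) = aff_dim H" by (simp add: aff_dim_convex_Int_open)
  also have "\<dots> = int DIM('a) - int (card (contact_roots m x))" unfolding H_def
    by (rule aff_dim_affine_system[OF independent_contact_roots[OF x], of x]) (simp add: contact_roots_def)
  finally show ?thesis using eq by simp
qed

text \<open>A set of codimension 1 spans its hyperplane, and the hyperplane determines the positive
  root because proportional roots are equal or opposite. Its use is to refute that a facet lies in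
  two hyperplanes.\<close>

lemma facet_unique_hyperplane:
  assumes "\<alpha> \<in> P" "\<beta> \<in> P" "A \<subseteq> hyp \<alpha> c" "A \<subseteq> hyp \<beta> d" "aff_dim A = int DIM('a) - 1"
  shows "\<alpha> = \<beta> \<and> c = d"
proof -
  have a0: "\<alpha> \<noteq> 0" using assms zero_notin_P by blast
  have hull: "affine hull A = {x. \<alpha> \<bullet> x = c}"
    using assms a0 by (intro affine_hull_eq_hyperplane) (auto simp: hyp_def)
  have "affine hull A \<subseteq> {x. \<beta> \<bullet> x = d}"
    by (rule hull_minimal) (use assms in \<open>auto simp: hyp_def affine_hyperplane\<close>)
  hence "{x. \<alpha> \<bullet> x = c} \<subseteq> {x. \<beta> \<bullet> x = d}" using hull by simp
  then obtain l where l: "\<beta> = l *\<^sub>R \<alpha>" using hyperplane_subset_imp_parallel a0 by blast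
  hence "l = 1 \<or> l = -1" using scaleR_root_iff[of \<alpha> l] assms P_root by auto
  hence eq: "\<alpha> = \<beta>" using l assms uminus_notin_P by auto
  have "A \<noteq> {}"
  proof
    assume "A = {}"
    thus False using assms(5) by simp
  qed
  thus ?thesis using eq assms by (auto simp: hyp_def)
qed

lemma hyp_inj:
  assumes "\<alpha> \<in> P" "\<beta> \<in> P" "hyp \<alpha> c = hyp \<beta> c"
  shows "\<alpha> = \<beta>"
proof -
  have "\<alpha> \<noteq> 0" using assms zero_notin_P by blast
  hence "aff_dim (hyp \<alpha> c) = int DIM('a) - 1" unfolding hyp_def by simp
  thus ?thesis using facet_unique_hyperplane[of \<alpha> \<beta> "hyp \<alpha> c" c c] assms by simp
qed

section \<open>From points to geometric chains and back\<close>

lemma root_le_inner: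
  assumes "root_le P \<alpha> \<beta>" "generic m x"
  shows "\<alpha> \<bullet> x \<le> \<beta> \<bullet> x" and "\<alpha> \<bullet> x = \<beta> \<bullet> x \<Longrightarrow> \<alpha> = \<beta>"
proof -
  obtain c where c: "\<forall>s\<in>P. 0 \<le> c s" "\<beta> - \<alpha> = (\<Sum>s\<in>P. c s *\<^sub>R s)"
    using assms(1) unfolding root_le_def nonneg_comb_def by blast
  have nn: "0 \<le> c s * (s \<bullet> x)" if "s \<in> P" for s
  proof (rule mult_nonneg_nonneg)
    show "0 \<le> c s" using that c(1) by blast
    show "0 \<le> s \<bullet> x" using that assms(2) by (simp add: generic_def less_imp_le)
  qed
  have eq: "(\<beta> - \<alpha>) \<bullet> x = (\<Sum>s\<in>P. c s * (s \<bullet> x))" unfolding c(2) by (simp add: inner_sum_left)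
  have "0 \<le> (\<beta> - \<alpha>) \<bullet> x" unfolding eq using nn by (intro sum_nonneg)
  thus "\<alpha> \<bullet> x \<le> \<beta> \<bullet> x" by (simp add: inner_diff_left)
  assume "\<alpha> \<bullet> x = \<beta> \<bullet> x"
  hence "(\<Sum>s\<in>P. c s * (s \<bullet> x)) = 0" using eq by (simp add: inner_diff_left)
  hence "\<forall>s\<in>P. c s * (s \<bullet> x) = 0"
    using sum_nonneg_eq_0_iff[OF finite_P, of "\<lambda>s. c s * (s \<bullet> x)"] nn by simp
  hence "\<forall>s\<in>P. c s = 0" using assms(2) by (force simp: generic_def)
  hence "\<beta> - \<alpha> = 0" unfolding c(2) by (intro sum.neutral) auto
  thus "\<alpha> = \<beta>" by simp
qed

lemma pos_geom_chain_of:
  assumes x: "generic m x" "simples_le m x"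
  shows "pos_geom_chain P m (chain_of m x)"
proof -
  have 0: "chain_of m x 0 = {}" using x by (auto simp: chain_of_def generic_def not_le)
  have 1: "is_ideal P (chain_of m x i)" for i
    using root_le_inner(1)[OF _ x(1)] unfolding is_ideal_def chain_of_def
    by (auto intro: order_trans)
  have 2: "sumset (chain_of m x i) (chain_of m x j) \<inter> P \<subseteq> chain_of m x (i + j)" if "i + j \<le> m" for i j
    using that by (auto simp: sumset_def chain_of_def inner_add_left intro: add_mono)
  have 3: "sumset (chain_I P m (chain_of m x) i) (chain_I P m (chain_of m x) j) \<inter> P \<subseteq> chain_I P m (chain_of m x) (i + j)" for i j
  proof
    fix \<gamma> assume "\<gamma> \<in> sumset (chain_I P m (chain_of m x) i) (chain_I P m (chain_of m x) j) \<inter> P"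
    then obtain \<alpha> \<beta> where g: "\<gamma> = \<alpha> + \<beta>" "\<gamma> \<in> P" "\<alpha> \<in> chain_I P m (chain_of m x) i" "\<beta> \<in> chain_I P m (chain_of m x) j"
      unfolding sumset_def by blast
    hence "real (min i m) < \<alpha> \<bullet> x" "real (min j m) < \<beta> \<bullet> x" by (auto simp: chain_I_def chain_of_def)
    \<comment> \<open>Truncation at \<open>m\<close> is subadditive, so the complements add up
      beyond index \<open>m\<close> too.\<close>
    moreover have "real (min (i + j) m) \<le> real (min i m) + real (min j m)" by linarith
    ultimately show "\<gamma> \<in> chain_I P m (chain_of m x) (i + j)"
      using g by (auto simp: chain_I_def chain_of_def inner_add_left)
  qed
  have 4: "chain_of m x i \<subseteq> chain_of m x (Suc i)" if "i < m" for i using that by (auto simp: chain_of_def)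
  have 5: "simple_roots P \<subseteq> chain_of m x m"
    unfolding simple_roots_eq using x(2) simples_P by (auto simp: chain_of_def simples_le_def)
  have 6: "\<forall>i>m. chain_of m x i = {}" by (simp add: chain_of_def)
  show ?thesis unfolding pos_geom_chain_def using 0 1 2 3 4 5 6 by blast
qed

text \<open>A larger root takes a larger value at \<open>x\<close>, hence exceeds \<open>m\<close>.
  A decomposition would have to attain its bounds at levels strictly between 0 and \<open>m\<close>,
  which a generic point avoids.\<close>

lemma contact_roots_indecomposable:
  assumes x: "generic m x" and m: "1 \<le> m"
  shows "contact_roots m x \<subseteq> {\<alpha>. indecomposable P m (chain_of m x) \<alpha>}"
proof
  fix t assume "t \<in> contact_roots m x"
  hence t: "t \<in> P" "t \<bullet> x = real m" by (auto simp: contact_roots_def)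
  have 1: "t \<in> chain_of m x m - chain_of m x (m - 1)" using t m by (simp add: chain_of_def)
  have 2: "\<beta> = t" if "\<beta> \<in> chain_of m x m - chain_of m x (m - 1)" "root_le P t \<beta>" for \<beta>
  proof -
    have "\<beta> \<bullet> x \<le> real m" using that by (auto simp: chain_of_def)
    thus ?thesis using root_le_inner[OF that(2) x] t by force
  qed
  have 3: False if "i \<ge> 1" "j \<ge> 1" "i + j = m" "\<beta> \<in> chain_of m x i" "\<gamma> \<in> chain_of m x j" "t = \<beta> + \<gamma>" for \<beta> \<gamma> i j
  proof -
    have "\<beta> \<bullet> x \<le> real i" "\<gamma> \<bullet> x \<le> real j" "\<beta> \<in> P" using that by (auto simp: chain_of_def)
    moreover have "\<beta> \<bullet> x \<noteq> real i" using x that calculation by (auto simp: generic_def)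
    ultimately have "t \<bullet> x < real (i + j)" using that by (simp add: inner_add_left)
    thus False using t that by simp
  qed
  show "t \<in> {\<alpha>. indecomposable P m (chain_of m x) \<alpha>}"
    unfolding indecomposable_def mem_Collect_eq using 1 2 3 by blast
qed

text \<open>At the point of \<open>exists_point\<close>, \<open>r\<close> is the ceiling of the
  value. Only roots in the cone take integer values, and these are multiples of \<open>m\<close>;
  the value \<open>m\<close> itself comes from a single element of \<open>T\<close>.\<close>

lemma exists_generic:
  assumes m: "1 \<le> m" and J: "pos_geom_chain P m J" and T: "T \<subseteq> {\<alpha>. indecomposable P m J \<alpha>}"
  obtains x where "generic m x" "simples_le m x" "chain_of m x = J" "contact_roots m x = T"
proof -
  interpret geometric_chain \<Phi> P m J by unfold_locales (use m J in auto)
  obtain x where x: "\<And>\<alpha>. \<alpha> \<in> nat_cone T \<Longrightarrow> \<alpha> \<bullet> x = real (r \<alpha>)"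
    "\<And>\<alpha>. \<alpha> \<in> P \<Longrightarrow> \<alpha> \<notin> nat_cone T \<Longrightarrow> real (r \<alpha>) - 1 < \<alpha> \<bullet> x \<and> \<alpha> \<bullet> x < real (r \<alpha>)"
    using exists_point[OF T] by blast
  have r_cone: "\<exists>n\<ge>1. r \<alpha> = m * n \<and> (n = 1 \<longrightarrow> \<alpha> \<in> T)" if a: "\<alpha> \<in> nat_cone T" for \<alpha>
  proof -
    obtain M where M: "M \<noteq> {#}" "set_mset M \<subseteq> T" "\<Sum>\<^sub># M = \<alpha>" "\<alpha> \<in> P" using a by (auto simp: nat_cone_def)
    have "r \<alpha> = m * size M" using r_nat_cone[OF T M(1,2)] M(3,4) by simp
    moreover have "1 \<le> size M" using M(1) by (simp add: Suc_le_eq nonempty_has_size)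
    moreover have "\<alpha> \<in> T" if "size M = 1"
    proof -
      from size_1_singleton_mset[OF that] obtain c where "M = {#c#}" by blast
      thus ?thesis using M by simp
    qed
    ultimately show ?thesis by blast
  qed
  have le_iff: "\<alpha> \<bullet> x \<le> real i \<longleftrightarrow> r \<alpha> \<le> i" if a: "\<alpha> \<in> P" for \<alpha> i
  proof (cases "\<alpha> \<in> nat_cone T")
    case False
    hence *: "real (r \<alpha>) - 1 < \<alpha> \<bullet> x \<and> \<alpha> \<bullet> x < real (r \<alpha>)" using x(2) a by blast
    show ?thesis
    proof
      assume "\<alpha> \<bullet> x \<le> real i"
      hence "real (r \<alpha>) < real (i + 1)" using * by simp
      thus "r \<alpha> \<le> i" unfolding of_nat_less_iff by simp
    next
      assume "r \<alpha> \<le> i"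
      hence "real (r \<alpha>) \<le> real i" by simp
      thus "\<alpha> \<bullet> x \<le> real i" using * by linarith
    qed
  qed (use x(1) in simp)
  have eq_iff: "\<alpha> \<bullet> x = real i \<longleftrightarrow> \<alpha> \<in> nat_cone T \<and> r \<alpha> = i" if a: "\<alpha> \<in> P" for \<alpha> i
  proof (cases "\<alpha> \<in> nat_cone T")
    case False
    hence *: "real (r \<alpha>) - 1 < \<alpha> \<bullet> x \<and> \<alpha> \<bullet> x < real (r \<alpha>)" using x(2) a by blast
    have "\<alpha> \<bullet> x \<noteq> real i"
    proof
      assume eq: "\<alpha> \<bullet> x = real i"
      hence "real (r \<alpha>) < real (i + 1)" "real i < real (r \<alpha>)" using * by simp_all
      thus False unfolding of_nat_less_iff by simp
    qed
    thus ?thesis using False by simp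
  qed (use x(1) in simp)
  have pos: "0 < \<alpha> \<bullet> x" if a: "\<alpha> \<in> P" for \<alpha>
  proof -
    have "\<not> \<alpha> \<bullet> x \<le> real 0" using le_iff[OF a, of 0] r_pos[OF a] by simp
    thus ?thesis by simp
  qed
  have gen: "generic m x"
    unfolding generic_def
  proof (intro ballI conjI allI impI)
    fix \<alpha> k assume a: "\<alpha> \<in> P"
    show "0 < \<alpha> \<bullet> x" by (rule pos[OF a])
    assume k: "0 < k \<and> k < m"
    show "\<alpha> \<bullet> x \<noteq> real k"
    proof
      assume "\<alpha> \<bullet> x = real k"
      hence e: "\<alpha> \<in> nat_cone T" "r \<alpha> = k" using eq_iff[OF a] by auto
      then obtain n where "1 \<le> n" "k = m * n" using r_cone by blast
      hence "m \<le> k" by simp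
      thus False using k by simp
    qed
  qed
  have chain_of: "chain_of m x = J"
  proof
    fix i
    show "chain_of m x i = J i"
    proof (cases "i \<le> m")
      case True
      thus ?thesis unfolding chain_of_def using J_P[OF True] J_iff_r[OF True] le_iff by auto
    next
      case False
      thus ?thesis unfolding chain_of_def using J by (simp add: pos_geom_chain_def)
    qed
  qed
  have "simples \<subseteq> chain_of m x m" using simples_J chain_of by simp
  hence simples_le: "simples_le m x" by (auto simp: simples_le_def chain_of_def)
  have contact_roots: "contact_roots m x = T"
  proof (intro equalityI subsetI)
    fix \<alpha> assume "\<alpha> \<in> contact_roots m x"
    hence "\<alpha> \<in> nat_cone T" "r \<alpha> = m" using eq_iff[of \<alpha> m] by (auto simp: contact_roots_def)
    then obtain n where n: "n \<ge> 1" "m = m * n" "n = 1 \<longrightarrow> \<alpha> \<in> T" using r_cone by metis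
    hence "n = 1" using m by simp
    thus "\<alpha> \<in> T" using n by simp
  next
    fix t assume t: "t \<in> T"
    hence it: "indecomposable P m J t" using T by blast
    hence tP: "t \<in> P" using indecomposable_P by blast
    have "t \<in> nat_cone T" using t tP unfolding nat_cone_def by (auto intro!: exI[of _ "{#t#}"])
    hence "t \<bullet> x = real m" using x(1) r_indecomposable[OF it] by simp
    thus "t \<in> contact_roots m x" using tP by (simp add: contact_roots_def)
  qed
  show ?thesis using that gen simples_le chain_of contact_roots by blast
qed

section \<open>Faces, chains and regions as images of points\<close>

lemma faces_plus_eq:
  assumes m: "1 \<le> m" and k: "k \<le> DIM('a)"
  shows "faces_plus P m k = cell m ` {x. generic m x \<and> simples_le m x \<and> card (contact_roots m x) = DIM('a) - k}"
proof -
  have mem: "(y \<in> tilde_H \<alpha> r s) = (sgn (\<alpha> \<bullet> y - real r) = real_of_int (sgn s))" for y \<alpha> :: 'a and r s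
    by (auto simp: tilde_H_def hminus_def hyp_def hplus_def sgn_if)
  have dim: "aff_dim (cell m x) = int k \<longleftrightarrow> card (contact_roots m x) = DIM('a) - k" if "generic m x" for x
    using aff_dim_cell[OF that] aff_dim_geq[of "cell m x"] k by auto
  show ?thesis
  proof (intro equalityI subsetI)
    fix F assume "F \<in> faces_plus P m k"
    then obtain s where s: "admissible_signs P m s" and F: "F = (\<Inter>(\<alpha>, r)\<in>P \<times> {0..m}. tilde_H \<alpha> r (s \<alpha> r))"
      and ne: "F \<noteq> {}" and d: "aff_dim F = int k" and b: "bounded F"
      unfolding faces_plus_def by blast
    obtain x where xF: "x \<in> F" using ne by blast
    have F': "y \<in> F \<longleftrightarrow> (\<forall>\<alpha>\<in>P. \<forall>r\<le>m. sgn (\<alpha> \<bullet> y - real r) = real_of_int (sgn (s \<alpha> r)))" for y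
      unfolding F by (auto simp: mem)
    have sx: "sgn (\<alpha> \<bullet> x - real r) = real_of_int (sgn (s \<alpha> r))" if "\<alpha> \<in> P" "r \<le> m" for \<alpha> r
      using xF F' that by blast
    have Fc: "F = cell m x" unfolding cell_def using F' sx by auto
    have "generic m x" unfolding generic_def
    proof (intro ballI conjI allI impI)
      fix \<alpha> r assume a: "\<alpha> \<in> P"
      have "s \<alpha> 0 = 1" using s a by (simp add: admissible_signs_def)
      thus "0 < \<alpha> \<bullet> x" using sx[OF a, of 0] by (simp add: sgn_1_pos)
      assume r: "0 < r \<and> r < m"
      hence "s \<alpha> r \<in> {-1, 1}" using s a by (simp add: admissible_signs_def)
      hence "sgn (\<alpha> \<bullet> x - real r) \<noteq> 0" using sx[OF a, of r] r by auto
      thus "\<alpha> \<bullet> x \<noteq> real r" by auto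
    qed
    thus "F \<in> cell m ` {x. generic m x \<and> simples_le m x \<and> card (contact_roots m x) = DIM('a) - k}"
      using Fc b d dim bounded_cell_iff by blast
  next
    fix F assume "F \<in> cell m ` {x. generic m x \<and> simples_le m x \<and> card (contact_roots m x) = DIM('a) - k}"
    then obtain x where x: "generic m x" "simples_le m x" "card (contact_roots m x) = DIM('a) - k" and F: "F = cell m x"
      by blast
    define s :: "'a \<Rightarrow> nat \<Rightarrow> int" where
      "s \<alpha> r = (if \<alpha> \<bullet> x < real r then -1 else if \<alpha> \<bullet> x = real r then 0 else 1)" for \<alpha> r
    have sgn_s: "real_of_int (sgn (s \<alpha> r)) = sgn (\<alpha> \<bullet> x - real r)" for \<alpha> r
      by (auto simp: s_def)
    have "F = (\<Inter>(\<alpha>, r)\<in>P \<times> {0..m}. tilde_H \<alpha> r (s \<alpha> r))"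
      unfolding F cell_def by (auto simp: mem sgn_s)
    moreover have "admissible_signs P m s"
      using x(1) by (auto simp: admissible_signs_def s_def generic_def)
    moreover have "F \<noteq> {}" "aff_dim F = int k" "bounded F"
      using F cell_self dim x bounded_cell_iff by blast+
    ultimately show "F \<in> faces_plus P m k" unfolding faces_plus_def by blast
  qed
qed

lemma pairs_chains_eq:
  assumes m: "1 \<le> m"
  shows "pairs_chains P m k =
    (\<lambda>x. (chain_of m x, contact_roots m x)) ` {x. generic m x \<and> simples_le m x \<and> card (contact_roots m x) = DIM('a) - k}"
proof (intro equalityI subsetI)
  fix p assume "p \<in> pairs_chains P m k"
  then obtain J T where p: "p = (J, T)" "pos_geom_chain P m J" "T \<subseteq> {\<alpha>. indecomposable P m J \<alpha>}" "card T = DIM('a) - k"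
    unfolding pairs_chains_def by blast
  obtain x where "generic m x" "simples_le m x" "chain_of m x = J" "contact_roots m x = T" using exists_generic[OF m p(2,3)] .
  thus "p \<in> (\<lambda>x. (chain_of m x, contact_roots m x)) ` {x. generic m x \<and> simples_le m x \<and> card (contact_roots m x) = DIM('a) - k}"
    using p by (intro image_eqI[of _ _ x]) auto
next
  fix p assume "p \<in> (\<lambda>x. (chain_of m x, contact_roots m x)) ` {x. generic m x \<and> simples_le m x \<and> card (contact_roots m x) = DIM('a) - k}"
  thus "p \<in> pairs_chains P m k"
    unfolding pairs_chains_def using pos_geom_chain_of contact_roots_indecomposable[OF _ m] by fastforce
qed

text \<open>The cell is convex and avoids all hyperplanes, and a connected set that avoids them
  cannot change the sign of any root minus its level.\<close>

lemma component_eq_cell: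
  assumes x: "generic m x" "contact_roots m x = {}"
  shows "x \<notin> \<Union> (cat_hyps \<Phi> m)"
    and "connected_component_set (UNIV - \<Union> (cat_hyps \<Phi> m)) x = cell m x"
proof -
  let ?U = "UNIV - \<Union> (cat_hyps \<Phi> m)"
  have cU: "cell m x \<subseteq> ?U"
  proof
    fix y assume y: "y \<in> cell m x"
    have gy: "generic m y" by (rule generic_cell[OF x(1) y])
    have zy: "contact_roots m y = {}" using mem_cell_iff[OF x(1) gy] y x(2) by simp
    have "\<alpha> \<bullet> y \<noteq> real r" if a: "\<alpha> \<in> \<Phi>" "r \<le> m" for \<alpha> r
    proof (cases "\<alpha> \<in> P")
      case True
      have "\<alpha> \<notin> contact_roots m y" using zy by simp
      hence "r = m \<Longrightarrow> \<alpha> \<bullet> y \<noteq> real r" using True by (simp add: contact_roots_def)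
      moreover have "r < m \<Longrightarrow> \<alpha> \<bullet> y \<noteq> real r"
        using gy True unfolding generic_def by (cases "r = 0") force+
      ultimately show ?thesis using a(2) by linarith
    next
      case False
      hence "0 < (- \<alpha>) \<bullet> y" using root_cases[OF a(1)] gy unfolding generic_def by blast
      \<comment> \<open>Negative roots have no hyperplane in the dominant cone, since all levels are
        nonnegative.\<close>
      hence "\<alpha> \<bullet> y < 0" by simp
      moreover have "0 \<le> real r" by simp
      ultimately show ?thesis by linarith
    qed
    thus "y \<in> ?U" unfolding cat_hyps_def hyp_def by blast
  qed
  thus "x \<notin> \<Union> (cat_hyps \<Phi> m)" using cell_self by blast
  show "connected_component_set ?U x = cell m x"
  proof (intro equalityI)
    show "cell m x \<subseteq> connected_component_set ?U x"
      by (intro connected_component_maximal cell_self convex_connected convex_cell cU)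
    show "connected_component_set ?U x \<subseteq> cell m x"
    proof
      fix y assume "y \<in> connected_component_set ?U x"
      then obtain C where C: "connected C" "C \<subseteq> ?U" "x \<in> C" "y \<in> C"
        unfolding mem_Collect_eq connected_component_def by blast
      show "y \<in> cell m x" unfolding cell_def mem_Collect_eq sgn_diff_iff
      proof (intro ballI allI impI)
        fix \<alpha> r assume a: "\<alpha> \<in> P" "r \<le> m"
        have no: "\<alpha> \<bullet> z \<noteq> real r" if "z \<in> C" for z
        proof
          assume "\<alpha> \<bullet> z = real r"
          hence "z \<in> \<Union> (cat_hyps \<Phi> m)" using a P_root unfolding cat_hyps_def hyp_def by blast
          thus False using C(2) that by blast
        qed
        have "\<not> (\<alpha> \<bullet> x \<le> real r \<and> real r \<le> \<alpha> \<bullet> y)"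
          using connected_ivt_hyperplane[OF C(1,3,4), of \<alpha> "real r"] no by blast
        moreover have "\<not> (\<alpha> \<bullet> y \<le> real r \<and> real r \<le> \<alpha> \<bullet> x)"
          using connected_ivt_hyperplane[OF C(1,4,3), of \<alpha> "real r"] no by blast
        ultimately show "(\<alpha> \<bullet> y < real r \<longleftrightarrow> \<alpha> \<bullet> x < real r) \<and> (\<alpha> \<bullet> y = real r \<longleftrightarrow> \<alpha> \<bullet> x = real r)"
          using no[OF C(3)] no[OF C(4)] by linarith
      qed
    qed
  qed
qed

lemma bdd_dom_regions_eq:
  "bdd_dom_regions \<Phi> P m = cell m ` {x. generic m x \<and> simples_le m x \<and> contact_roots m x = {}}"
proof (intro equalityI subsetI)
  fix R assume "R \<in> bdd_dom_regions \<Phi> P m"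
  hence R: "R \<in> components (UNIV - \<Union> (cat_hyps \<Phi> m))" "bounded R" "R \<subseteq> dominant_cone P"
    by (auto simp: bdd_dom_regions_def regions_def)
  obtain x where x: "x \<in> UNIV - \<Union> (cat_hyps \<Phi> m)"
    "R = connected_component_set (UNIV - \<Union> (cat_hyps \<Phi> m)) x"
    using R(1) unfolding components_iff by blast
  have "x \<in> R" using x by (simp add: connected_component_refl)
  hence dom: "\<forall>\<alpha>\<in>P. 0 < \<alpha> \<bullet> x" using R(3) unfolding dominant_cone_def by blast
  have no: "\<alpha> \<bullet> x \<noteq> real r" if "\<alpha> \<in> P" "r \<le> m" for \<alpha> r
  proof
    assume "\<alpha> \<bullet> x = real r"
    hence "x \<in> \<Union> (cat_hyps \<Phi> m)" using that P_root unfolding cat_hyps_def hyp_def by blast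
    thus False using x(1) by blast
  qed
  have gx: "generic m x" unfolding generic_def using dom no by simp
  have zx: "contact_roots m x = {}" unfolding contact_roots_def using no by simp
  have "R = cell m x" using component_eq_cell(2)[OF gx zx] x(2) by simp
  moreover from this have "simples_le m x" using R(2) bounded_cell_iff[OF gx] by simp
  ultimately show "R \<in> cell m ` {x. generic m x \<and> simples_le m x \<and> contact_roots m x = {}}" using gx zx by blast
next
  fix R assume "R \<in> cell m ` {x. generic m x \<and> simples_le m x \<and> contact_roots m x = {}}"
  then obtain x where x: "generic m x" "simples_le m x" "contact_roots m x = {}" and R: "R = cell m x" by blast
  have "R \<in> regions \<Phi> m"
    unfolding regions_def R component_eq_cell(2)[OF x(1,3), symmetric]
    using component_eq_cell(1)[OF x(1,3)] by (intro componentsI) simp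
  moreover have "bounded R" using bounded_cell_iff[OF x(1)] x(2) R by simp
  moreover have "R \<subseteq> dominant_cone P"
    using generic_cell[OF x(1)] unfolding R dominant_cone_def generic_def by blast
  ultimately show "R \<in> bdd_dom_regions \<Phi> P m" by (simp add: bdd_dom_regions_def)
qed

section \<open>Closures and walls of regions\<close>

lemma closure_cell_le:
  assumes y: "y \<in> closure (cell m x)" and a: "\<alpha> \<in> P" "i \<le> m" and le: "\<alpha> \<bullet> x \<le> real i"
  shows "\<alpha> \<bullet> y \<le> real i"
proof -
  have "cell m x \<subseteq> {y. \<alpha> \<bullet> y \<le> real i}"
  proof
    fix z assume "z \<in> cell m x"
    hence "sgn (\<alpha> \<bullet> z - real i) = sgn (\<alpha> \<bullet> x - real i)" using a by (simp add: cell_def)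
    thus "z \<in> {y. \<alpha> \<bullet> y \<le> real i}" using le unfolding sgn_diff_iff by auto
  qed
  hence "closure (cell m x) \<subseteq> {y. \<alpha> \<bullet> y \<le> real i}"
    by (rule closure_minimal) (rule closed_halfspace_le)
  thus ?thesis using y by blast
qed

lemma closure_cell_nonneg:
  assumes y: "y \<in> closure (cell m x)" and a: "\<alpha> \<in> P" and x: "generic m x"
  shows "0 \<le> \<alpha> \<bullet> y"
proof -
  have "cell m x \<subseteq> {y. \<alpha> \<bullet> y \<ge> 0}"
    using generic_cell[OF x] a unfolding generic_def by (auto intro: less_imp_le)
  hence "closure (cell m x) \<subseteq> {y. \<alpha> \<bullet> y \<ge> 0}"
    by (rule closure_minimal) (rule closed_halfspace_ge)
  thus ?thesis using y by blast
qed

text \<open>Moving from a point of the face towards \<open>x\<close> changes only the contact signs: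
  the contact roots belong to the common chain, so their values drop below \<open>m\<close> at once
  and the open segment lies in the region.\<close>

lemma cell_subset_closure:
  assumes x: "generic m x" "contact_roots m x = {}" and z: "generic m z" and eq: "chain_of m z = chain_of m x"
  shows "cell m z \<subseteq> closure (cell m x)"
proof (cases "contact_roots m z = {}")
  case True
  hence "cell m z = cell m x" using cell_eq_iff_chain_contact[OF z x(1)] eq x(2) by simp
  thus ?thesis by (simp add: closure_subset)
next
  case False
  show ?thesis
  proof
    fix y assume y: "y \<in> cell m z"
    have gy: "generic m y" by (rule generic_cell[OF z y])
    have cy: "chain_of m y = chain_of m x" and zy: "contact_roots m y \<noteq> {}"
      using mem_cell_iff[OF z gy] y eq False by auto
    have "y \<noteq> x" using zy x(2) by auto
    have "open_segment y x \<subseteq> cell m x"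
    proof
      fix p assume "p \<in> open_segment y x"
      then obtain u where u: "0 < u" "u < 1" "p = (1 - u) *\<^sub>R y + u *\<^sub>R x"
        by (auto simp: in_segment)
      show "p \<in> cell m x" unfolding cell_def mem_Collect_eq
      proof (intro ballI allI impI)
        fix \<alpha> r assume a: "\<alpha> \<in> P" "r \<le> m"
        show "sgn (\<alpha> \<bullet> p - real r) = sgn (\<alpha> \<bullet> x - real r)"
        proof (cases "r = m \<and> \<alpha> \<bullet> y = real m")
          case True
          have "\<alpha> \<in> chain_of m y m" using True a by (simp add: chain_of_def)
          hence "\<alpha> \<bullet> x \<le> real m" unfolding cy by (simp add: chain_of_def)
          moreover have "\<alpha> \<notin> contact_roots m x" using x(2) by simp
          ultimately have lt: "\<alpha> \<bullet> x < real m" using a by (simp add: contact_roots_def)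
          have "\<alpha> \<bullet> p - real m = u * (\<alpha> \<bullet> x - real m)"
            using True by (simp add: u(3) inner_add_right algebra_simps)
          also have "\<dots> < 0" using u lt by (simp add: mult_pos_neg)
          finally show ?thesis using lt True by simp
        next
          case False
          have nx: "\<alpha> \<bullet> x \<noteq> real m" using x(2) a by (auto simp: contact_roots_def)
          have s: "sgn (\<alpha> \<bullet> y - real r) = sgn (\<alpha> \<bullet> x - real r)"
            by (rule sgn_eq_if[OF x(1) gy a]) (use cy False nx in auto)
          have "(1 - u) *\<^sub>R y + u *\<^sub>R x \<in> {w. sgn (\<alpha> \<bullet> w - real r) = sgn (\<alpha> \<bullet> x - real r)}"
            by (rule convexD[OF convex_sgn_inner]) (use s u in auto)
          thus ?thesis using u(3) by simp
        qed
      qed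
    qed
    hence "closure (open_segment y x) \<subseteq> closure (cell m x)" by (rule closure_mono)
    moreover have "y \<in> closure (open_segment y x)" using \<open>y \<noteq> x\<close> by simp
    ultimately show "y \<in> closure (cell m x)" by blast
  qed
qed

text \<open>The alcove lies below level 1, so not separating means that the region is below the
  wall. For an indecomposable \<open>t\<close>, the pair of the chain and \<open>{t}\<close> is
  realised by a cell of codimension 1 in the closure. Conversely, if the root of a wall were not
  indecomposable, its facet would lie in a second hyperplane.\<close>

lemma nonsep_walls_cell:
  assumes m: "1 \<le> m" and x: "generic m x" "simples_le m x" "contact_roots m x = {}"
    and alcove: "fund_alcove P \<noteq> {}" "\<And>\<alpha>. \<alpha> \<in> P \<Longrightarrow> fund_alcove P \<subseteq> hminus \<alpha> 1"
  shows "nonsep_walls \<Phi> P m (cell m x) =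
    (\<lambda>\<alpha>. hyp \<alpha> (real m)) ` {\<alpha>. indecomposable P m (chain_of m x) \<alpha>}"
proof -
  let ?R = "cell m x" and ?J = "chain_of m x"
  have chain: "pos_geom_chain P m ?J" by (rule pos_geom_chain_of[OF x(1,2)])
  have alc: "fund_alcove P \<subseteq> hminus \<alpha> (real m)" if "\<alpha> \<in> P" for \<alpha>
    using alcove(2)[OF that] m by (force simp: hminus_def)
  have lt: "?R \<subseteq> hminus \<alpha> (real m)" if a: "\<alpha> \<in> ?J m" for \<alpha>
  proof
    fix y assume y: "y \<in> ?R"
    have aP: "\<alpha> \<in> P" "\<alpha> \<bullet> x \<le> real m" using a by (auto simp: chain_of_def)
    moreover have "\<alpha> \<notin> contact_roots m x" using x(3) by simp
    ultimately have "\<alpha> \<bullet> x < real m" by (simp add: contact_roots_def)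
    moreover have "sgn (\<alpha> \<bullet> y - real m) = sgn (\<alpha> \<bullet> x - real m)" using y aP by (simp add: cell_def)
    ultimately show "y \<in> hminus \<alpha> (real m)" unfolding sgn_diff_iff hminus_def by simp
  qed
  show ?thesis
  proof (intro equalityI subsetI)
    fix H assume "H \<in> (\<lambda>\<alpha>. hyp \<alpha> (real m)) ` {\<alpha>. indecomposable P m ?J \<alpha>}"
    then obtain t where t: "indecomposable P m ?J t" and H: "H = hyp t (real m)" by blast
    have tJ: "t \<in> ?J m" using t by (simp add: indecomposable_def)
    hence tP: "t \<in> P" by (simp add: chain_of_def)
    obtain z where z: "generic m z" "simples_le m z" "chain_of m z = ?J" "contact_roots m z = {t}"
      using exists_generic[OF m chain, of "{t}"] t by blast
    have "cell m z \<subseteq> hyp t (real m)"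
    proof
      fix y assume y: "y \<in> cell m z"
      hence "contact_roots m z = contact_roots m y" using mem_cell_iff[OF z(1) generic_cell[OF z(1) y]] by blast
      hence "t \<in> contact_roots m y" using z(4) by blast
      thus "y \<in> hyp t (real m)" by (simp add: contact_roots_def hyp_def)
    qed
    hence sub: "cell m z \<subseteq> H \<inter> closure ?R"
      using cell_subset_closure[OF x(1,3) z(1,3)] H by blast
    have "aff_dim (cell m z) = int DIM('a) - 1" using aff_dim_cell[OF z(1)] z(4) by simp
    hence "int DIM('a) - 1 \<le> aff_dim (H \<inter> closure ?R)" using aff_dim_subset[OF sub] by simp
    moreover have "aff_dim (H \<inter> closure ?R) \<le> aff_dim H" by (rule aff_dim_subset) simp
    moreover have "t \<noteq> 0" using tP zero_notin_P by blast
    hence "aff_dim H = int DIM('a) - 1" unfolding H hyp_def by simp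
    ultimately have "aff_dim (H \<inter> closure ?R) = int DIM('a) - 1" by simp
    moreover have "H \<in> cat_hyps \<Phi> m" using H tP P_root unfolding cat_hyps_def by blast
    ultimately have "is_wall \<Phi> m ?R H" by (simp add: is_wall_def)
    thus "H \<in> nonsep_walls \<Phi> P m ?R"
      unfolding nonsep_walls_def using H lt[OF tJ] alc[OF tP] P_root[OF tP] by blast
  next
    fix H assume "H \<in> nonsep_walls \<Phi> P m ?R"
    then obtain \<alpha> where w: "is_wall \<Phi> m ?R H" and a: "\<alpha> \<in> \<Phi>" and H: "H = hyp \<alpha> (real m)"
      and side: "?R \<subseteq> hminus \<alpha> (real m) \<and> fund_alcove P \<subseteq> hminus \<alpha> (real m) \<or>
         ?R \<subseteq> hplus \<alpha> (real m) \<and> fund_alcove P \<subseteq> hplus \<alpha> (real m)"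
      unfolding nonsep_walls_def by blast
    define F where "F = H \<inter> closure ?R"
    have dF: "aff_dim F = int DIM('a) - 1" using w by (simp add: is_wall_def F_def)
    have "F \<noteq> {}"
    proof
      assume "F = {}"
      thus False using dF by simp
    qed
    then obtain y0 where y0: "y0 \<in> F" by blast
    have Fm: "\<alpha> \<bullet> y = real m" "y \<in> closure ?R" if "y \<in> F" for y
      using that by (auto simp: F_def H hyp_def)
    \<comment> \<open>The wall may be presented by a negative root, but then its positive level
      \<open>m\<close> is out of reach of the closure.\<close>
    have aP: "\<alpha> \<in> P"
    proof (rule ccontr)
      assume "\<alpha> \<notin> P"
      hence "- \<alpha> \<in> P" using root_cases[OF a] by blast
      hence "0 \<le> - \<alpha> \<bullet> y0" using closure_cell_nonneg[OF Fm(2)[OF y0] _ x(1)] by blast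
      thus False using Fm(1)[OF y0] m by simp
    qed
    have "\<not> fund_alcove P \<subseteq> hplus \<alpha> (real m)"
    proof
      assume sub: "fund_alcove P \<subseteq> hplus \<alpha> (real m)"
      obtain p where "p \<in> fund_alcove P" using alcove(1) by blast
      hence "p \<in> hplus \<alpha> (real m)" "p \<in> hminus \<alpha> (real m)" using sub alc[OF aP] by auto
      thus False by (simp add: hplus_def hminus_def)
    qed
    hence "?R \<subseteq> hminus \<alpha> (real m)" using side by blast
    hence "\<alpha> \<bullet> x < real m" using cell_self unfolding hminus_def by blast
    hence aJ: "\<alpha> \<in> ?J m" using aP by (simp add: chain_of_def)
    have aJ': "\<alpha> \<notin> ?J (m - 1)"
    proof
      assume "\<alpha> \<in> ?J (m - 1)"
      hence "\<alpha> \<bullet> x \<le> real (m - 1)" by (auto simp: chain_of_def split: if_splits)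
      hence "\<alpha> \<bullet> y0 \<le> real (m - 1)" using closure_cell_le[OF Fm(2)[OF y0] aP, of "m - 1"] by simp
      thus False using Fm(1)[OF y0] m by simp
    qed
    have FH: "F \<subseteq> hyp \<alpha> (real m)" by (simp add: F_def H)
    have max: "\<beta> = \<alpha>" if b: "\<beta> \<in> ?J m" "root_le P \<alpha> \<beta>" for \<beta>
    proof (rule ccontr)
      assume ne: "\<beta> \<noteq> \<alpha>"
      obtain c where c: "\<forall>s\<in>P. 0 \<le> c s" "\<beta> - \<alpha> = (\<Sum>s\<in>P. c s *\<^sub>R s)"
        using b(2) unfolding root_le_def nonneg_comb_def by blast
      have "\<exists>s\<in>P. c s \<noteq> 0"
      proof (rule ccontr)
        assume "\<not> ?thesis"
        hence "\<beta> - \<alpha> = 0" unfolding c(2) by (intro sum.neutral) auto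
        thus False using ne by simp
      qed
      then obtain s where s: "s \<in> P" "0 < c s" using c(1) by force
      \<comment> \<open>On the facet \<alpha> has the value \<open>m\<close> and \<beta> at most
        \<open>m\<close>, so every nonnegative term of the difference vanishes.\<close>
      have "F \<subseteq> hyp s 0"
      proof
        fix y assume y: "y \<in> F"
        have nn: "0 \<le> c t * (t \<bullet> y)" if "t \<in> P" for t
          using closure_cell_nonneg[OF Fm(2)[OF y] that x(1)] c(1) that by simp
        have bP: "\<beta> \<in> P" "\<beta> \<bullet> x \<le> real m" using b(1) by (auto simp: chain_of_def)
        have "\<beta> \<bullet> y \<le> real m" using closure_cell_le[OF Fm(2)[OF y] bP(1) order_refl bP(2)] .
        hence "(\<beta> - \<alpha>) \<bullet> y \<le> 0" using Fm(1)[OF y] by (simp add: inner_diff_left)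
        hence le0: "(\<Sum>t\<in>P. c t * (t \<bullet> y)) \<le> 0" unfolding c(2) by (simp add: inner_sum_left)
        have "c s * (s \<bullet> y) \<le> (\<Sum>t\<in>P. c t * (t \<bullet> y))"
          using s(1) nn finite_P by (intro member_le_sum) auto
        hence "c s * (s \<bullet> y) = 0" using nn[OF s(1)] le0 by linarith
        thus "y \<in> hyp s 0" using s(2) by (simp add: hyp_def)
      qed
      hence "real m = 0" using facet_unique_hyperplane[OF aP s(1) FH _ dF] by blast
      thus False using m by simp
    qed
    have dec: False
      if d: "i \<ge> 1" "j \<ge> 1" "i + j = m" "\<beta> \<in> ?J i" "\<gamma> \<in> ?J j" "\<alpha> = \<beta> + \<gamma>" for \<beta> \<gamma> i j
    proof -
      have bP: "\<beta> \<in> P" "\<beta> \<bullet> x \<le> real i" "i \<le> m" and gP: "\<gamma> \<in> P" "\<gamma> \<bullet> x \<le> real j" "j \<le> m"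
        using d by (auto simp: chain_of_def)
      \<comment> \<open>The two upper bounds add up to \<open>m\<close>, so both are attained on the
        facet.\<close>
      have "F \<subseteq> hyp \<beta> (real i)"
      proof
        fix y assume y: "y \<in> F"
        have "\<beta> \<bullet> y \<le> real i" "\<gamma> \<bullet> y \<le> real j"
          using closure_cell_le[OF Fm(2)[OF y] bP(1,3,2)] closure_cell_le[OF Fm(2)[OF y] gP(1,3,2)] by auto
        moreover have "\<beta> \<bullet> y + \<gamma> \<bullet> y = real i + real j"
          using Fm(1)[OF y] d(3,6) by (simp add: inner_add_left flip: of_nat_add)
        ultimately show "y \<in> hyp \<beta> (real i)" by (simp add: hyp_def)
      qed
      hence "\<alpha> = \<beta>" using facet_unique_hyperplane[OF aP bP(1) FH _ dF] by blast
      hence "\<gamma> = 0" using d(6) by simp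
      thus False using gP zero_notin_P by simp
    qed
    have "indecomposable P m ?J \<alpha>"
      unfolding indecomposable_def using aJ aJ' max dec by blast
    thus "H \<in> (\<lambda>\<alpha>. hyp \<alpha> (real m)) ` {\<alpha>. indecomposable P m ?J \<alpha>}" using H by blast
  qed
qed

section \<open>The highest root\<close>

text \<open>Pull off simple roots one at a time. If a partial sum \<open>b\<close> in one part met a
  simple root \<open>c\<close> of the other, reflecting b + c in \<open>c\<close> would make b - c a
  root. It cannot be positive, having coefficient -1 at \<open>c\<close>, nor negative, since then
  \<open>c\<close> would not be simple.\<close>

lemma root_in_span_part:
  assumes AB: "A \<union> B = simples" and orth: "\<And>a b. a \<in> A \<Longrightarrow> b \<in> B \<Longrightarrow> a \<bullet> b = 0"
    and "set_mset M \<subseteq> simples" "\<Sum>\<^sub># M \<in> P"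
  shows "\<Sum>\<^sub># M \<in> span A \<or> \<Sum>\<^sub># M \<in> span B"
  using assms(3,4)
proof (induction "size M" arbitrary: M)
  case 0
  thus ?case using zero_notin_P by simp
next
  case (Suc n)
  show ?case
  proof (cases "n = 0")
    case True
    hence "size M = 1" using Suc.hyps(2) by simp
    then obtain c where "M = {#c#}" using size_1_singleton_mset by blast
    moreover from this have "c \<in> A \<or> c \<in> B" using Suc.prems(1) AB by auto
    ultimately show ?thesis using span_base[of c A] span_base[of c B] by auto
  next
    case False
    have "size M \<ge> 2" "set_mset M \<subseteq> P" using False Suc.hyps(2) Suc.prems simples_P by auto
    then obtain c M' where M': "M = add_mset c M'" "\<Sum>\<^sub># M' \<in> P"
      using mset_pull[of M] Suc.prems by blast
    let ?b = "\<Sum>\<^sub># M'"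
    have cs: "c \<in> simples" using Suc.prems M' by auto
    have IH: "?b \<in> span A \<or> ?b \<in> span B" using Suc.hyps M' Suc.prems by auto
    have mixed: False
      if C: "?b \<in> span C" "C \<subseteq> simples" "c \<notin> C" "\<And>a. a \<in> C \<Longrightarrow> a \<bullet> c = 0" for C
    proof -
      have "?b \<bullet> c = 0" using orthogonal_spans[of C "{c}" ?b c] C by (simp add: span_base)
      hence "2 * (\<Sum>\<^sub># M \<bullet> c) = 2 * (c \<bullet> c)" using M' by (simp add: inner_add_left)
      hence "rreflect c (\<Sum>\<^sub># M) = \<Sum>\<^sub># M - 2 *\<^sub>R c"
        using cs simples_P P_root by (intro reflect_eq) auto
      also have "\<dots> = ?b - c" using M' by (simp add: scaleR_2)
      finally have "?b - c \<in> \<Phi>" using reflect_root[of c "\<Sum>\<^sub># M"] cs simples_P Suc.prems P_root by auto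
      hence "?b - c \<in> P \<or> c - ?b \<in> P" using root_cases by fastforce
      thus False
      proof
        assume p: "?b - c \<in> P"
        obtain w where w: "c \<bullet> w = 1" "\<And>\<tau>. \<tau> \<in> simples \<Longrightarrow> \<tau> \<noteq> c \<Longrightarrow> \<tau> \<bullet> w = 0"
          using fundamental_coweight[OF cs] by blast
        have "?b \<bullet> w = 0"
        proof (rule orthogonal_spans[of C "{w}"])
          show "a \<bullet> b = 0" if "a \<in> C" "b \<in> {w}" for a b
            using that w(2)[of a] C(2,3) by auto
        qed (use C in \<open>auto simp: span_base\<close>)
        hence neg: "(?b - c) \<bullet> w = -1" using w(1) by (simp add: inner_diff_left)
        obtain N where N: "set_mset N \<subseteq> simples" "\<Sum>\<^sub># N = ?b - c" using sum_of_simples[OF p] .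
        have "0 \<le> \<tau> \<bullet> w" if "\<tau> \<in> simples" for \<tau> using w that by (cases "\<tau> = c") auto
        hence "0 \<le> \<Sum>\<^sub># N \<bullet> w" using N(1) by (induction N) (auto simp: inner_add_left)
        thus False using N(2) neg by simp
      next
        assume p: "c - ?b \<in> P"
        have "c = (c - ?b) + ?b" by simp
        thus False using cs p M'(2) unfolding simples_def by blast
      qed
    qed
    have eq: "\<Sum>\<^sub># M = c + ?b" using M' by simp
    have orth': "b \<bullet> a = 0" if "a \<in> A" "b \<in> B" for a b using orth[OF that] by (simp add: inner_commute)
    from IH show ?thesis
    proof
      assume b: "?b \<in> span A"
      have "c \<in> A"
      proof (rule ccontr)
        assume "c \<notin> A"
        thus False using mixed[OF b] AB cs orth by blast
      qed
      thus ?thesis using eq b by (simp add: span_add span_base)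
    next
      assume b: "?b \<in> span B"
      have "c \<in> B"
      proof (rule ccontr)
        assume "c \<notin> B"
        thus False using mixed[OF b] AB cs orth' by blast
      qed
      thus ?thesis using eq b by (simp add: span_add span_base)
    qed
  qed
qed

text \<open>An orthogonal splitting of the simple roots extends to all roots by
  \<open>root_in_span_part\<close>; the two parts are disjoint because no root is orthogonal to
  itself.\<close>

lemma irreducible_simples:
  assumes irr: "irreducible_rs \<Phi>" and AB: "A \<union> B = simples" "A \<noteq> {}" "B \<noteq> {}"
  shows "\<exists>a\<in>A. \<exists>b\<in>B. a \<bullet> b \<noteq> 0"
proof (rule ccontr)
  assume "\<not> ?thesis"
  hence orth: "\<And>a b. a \<in> A \<Longrightarrow> b \<in> B \<Longrightarrow> a \<bullet> b = 0" by blast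
  have P_part: "\<alpha> \<in> span A \<or> \<alpha> \<in> span B" if a: "\<alpha> \<in> P" for \<alpha>
  proof -
    obtain M where M: "set_mset M \<subseteq> simples" "\<Sum>\<^sub># M = \<alpha>" using sum_of_simples[OF a] .
    thus ?thesis using root_in_span_part[OF AB(1) orth M(1)] a by blast
  qed
  have part: "\<alpha> \<in> span A \<or> \<alpha> \<in> span B" if a: "\<alpha> \<in> \<Phi>" for \<alpha>
    using root_cases[OF a] P_part[of \<alpha>] P_part[of "- \<alpha>"] span_neg[of "- \<alpha>" A] span_neg[of "- \<alpha>" B] by auto
  have sub: "A \<subseteq> \<Phi>" "B \<subseteq> \<Phi>" using AB simples_P P_subset by auto
  have o: "x \<bullet> y = 0" if "x \<in> \<Phi> \<inter> span A" "y \<in> \<Phi> \<inter> span B" for x y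
    using orthogonal_spans[OF orth] that by blast
  have 1: "\<Phi> \<inter> span A \<noteq> {}" "\<Phi> \<inter> span B \<noteq> {}" using sub AB span_base by blast+
  have 2: "(\<Phi> \<inter> span A) \<union> (\<Phi> \<inter> span B) = \<Phi>" using part by blast
  have 3: "(\<Phi> \<inter> span A) \<inter> (\<Phi> \<inter> span B) = {}"
  proof -
    have False if "x \<in> (\<Phi> \<inter> span A) \<inter> (\<Phi> \<inter> span B)" for x
      using o[of x x] that root_inner_pos[of x] by auto
    thus ?thesis by blast
  qed
  have "\<exists>A B. A \<noteq> {} \<and> B \<noteq> {} \<and> A \<union> B = \<Phi> \<and> A \<inter> B = {} \<and> (\<forall>a\<in>A. \<forall>b\<in>B. a \<bullet> b = 0)"
    by (intro exI[of _ "\<Phi> \<inter> span A"] exI[of _ "\<Phi> \<inter> span B"] conjI ballI 1 2 3 o)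
  thus False using irr unfolding irreducible_rs_def by contradiction
qed

lemma generic_0_iff: "generic 0 x \<longleftrightarrow> (\<forall>\<alpha>\<in>P. 0 < \<alpha> \<bullet> x)"
  by (simp add: generic_def)

lemma exists_maximal_above:
  assumes b: "\<beta> \<in> P"
  obtains \<theta> where "root_le P \<beta> \<theta>" "\<And>\<gamma>. root_le P \<theta> \<gamma> \<Longrightarrow> \<gamma> = \<theta>"
proof -
  let ?S = "{\<gamma>\<in>P. root_le P \<beta> \<gamma>}"
  have S: "finite ?S" "?S \<noteq> {}" using finite_P b root_le_refl by auto
  obtain \<theta> where t: "\<theta> \<in> ?S" "\<And>\<gamma>. \<gamma> \<in> ?S \<Longrightarrow> \<gamma> \<bullet> height_vec \<le> \<theta> \<bullet> height_vec"
  proof -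
    have "Max ((\<lambda>\<gamma>. \<gamma> \<bullet> height_vec) ` ?S) \<in> (\<lambda>\<gamma>. \<gamma> \<bullet> height_vec) ` ?S" using S by (intro Max_in) auto
    then obtain \<theta> where "\<theta> \<in> ?S" "\<theta> \<bullet> height_vec = Max ((\<lambda>\<gamma>. \<gamma> \<bullet> height_vec) ` ?S)" by force
    thus ?thesis using that S by simp
  qed
  have g: "generic 0 height_vec" using P_height by (simp add: generic_0_iff)
  show ?thesis
  proof
    show "root_le P \<beta> \<theta>" using t by simp
    fix \<gamma> assume le: "root_le P \<theta> \<gamma>"
    hence "root_le P \<beta> \<gamma>" using t(1) root_le_trans by blast
    hence "\<gamma> \<bullet> height_vec \<le> \<theta> \<bullet> height_vec" using t(2) le by (simp add: root_le_def)
    hence "\<theta> \<bullet> height_vec = \<gamma> \<bullet> height_vec" using root_le_inner(1)[OF le g] by simp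
    thus "\<gamma> = \<theta>" using root_le_inner(2)[OF le g] by simp
  qed
qed

lemma maximal_dominant:
  assumes t: "\<theta> \<in> P" "\<And>\<gamma>. root_le P \<theta> \<gamma> \<Longrightarrow> \<gamma> = \<theta>" and s: "\<sigma> \<in> P"
  shows "0 \<le> \<theta> \<bullet> \<sigma>"
proof (rule ccontr)
  assume "\<not> ?thesis"
  moreover have "\<theta> \<noteq> - \<sigma>" using t(1) s uminus_notin_P by auto
  ultimately have "\<theta> + \<sigma> \<in> \<Phi>" using t(1) s P_root by (intro add_root) auto
  hence "\<theta> + \<sigma> \<in> P" using P_height[OF t(1)] P_height[OF s] by (intro P_I) (auto simp: inner_add_left)
  hence "\<theta> + \<sigma> = \<theta>" using t root_le_add s by blast
  thus False using s zero_notin_P by simp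
qed

text \<open>A simple root \<open>b\<close> outside the support is obtuse to every summand, while
  \<theta> is dominant. So all these inner products vanish, which contradicts
  irreducibility.\<close>

lemma maximal_support:
  assumes irr: "irreducible_rs \<Phi>" and t: "\<theta> \<in> P" "\<And>\<gamma>. root_le P \<theta> \<gamma> \<Longrightarrow> \<gamma> = \<theta>"
    and M: "set_mset M \<subseteq> simples" "\<Sum>\<^sub># M = \<theta>"
  shows "set_mset M = simples"
proof (rule ccontr)
  assume "set_mset M \<noteq> simples"
  moreover have "M \<noteq> {#}" using M t zero_notin_P by auto
  ultimately obtain a b where ab: "a \<in># M" "b \<in> simples - set_mset M" "a \<bullet> b \<noteq> 0"
    using irreducible_simples[OF irr, of "set_mset M" "simples - set_mset M"] M by auto
  have "0 \<le> x \<bullet> (- b)" if "x \<in># M" for x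
    using simples_obtuse[of x b] that M ab by force
  moreover have "\<Sum>\<^sub># M \<bullet> (- b) \<le> 0" using maximal_dominant[OF t, of b] M ab simples_P by auto
  ultimately have "a \<bullet> (- b) = 0" using ab by (intro sum_mset_inner_eq_0) auto
  thus False using ab by simp
qed

text \<open>Full support and dominance make the inner product of two maximal roots positive, since
  otherwise one of them would be orthogonal to all simple roots. Their difference is then a root,
  and one lies above the other.\<close>

lemma maximal_unique:
  assumes irr: "irreducible_rs \<Phi>" and t: "\<theta> \<in> P" "\<And>\<gamma>. root_le P \<theta> \<gamma> \<Longrightarrow> \<gamma> = \<theta>"
    and t': "\<theta>' \<in> P" "\<And>\<gamma>. root_le P \<theta>' \<gamma> \<Longrightarrow> \<gamma> = \<theta>'"
  shows "\<theta> = \<theta>'"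
proof (rule ccontr)
  assume ne: "\<theta> \<noteq> \<theta>'"
  obtain M where M: "set_mset M \<subseteq> simples" "\<Sum>\<^sub># M = \<theta>" using sum_of_simples[OF t(1)] .
  have supp: "set_mset M = simples" using maximal_support[OF irr t M] .
  have "0 < \<theta> \<bullet> \<theta>'"
  proof (rule ccontr)
    assume "\<not> ?thesis"
    hence le: "\<Sum>\<^sub># M \<bullet> \<theta>' \<le> 0" using M by simp
    have nn: "0 \<le> x \<bullet> \<theta>'" if "x \<in># M" for x
      using maximal_dominant[OF t', of x] that M simples_P by (auto simp: inner_commute)
    have "a \<bullet> b = 0" if "a \<in> simples" "b \<in> {\<theta>'}" for a b
      using sum_mset_inner_eq_0[OF nn le, of a] that supp by simp
    hence "\<theta>' \<bullet> \<theta>' = 0" using orthogonal_spans[of simples "{\<theta>'}" \<theta>' \<theta>'] span_simples by (simp add: span_base)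
    thus False using P_inner_pos[OF t'(1)] by simp
  qed
  hence r: "\<theta> - \<theta>' \<in> \<Phi>" using t t' ne P_root by (intro diff_root) auto
  from root_cases[OF r] show False
  proof
    assume "\<theta> - \<theta>' \<in> P"
    hence "root_le P \<theta>' \<theta>" using root_le_add[OF t'(1), of "\<theta> - \<theta>'"] t(1) by simp
    thus False using t'(2) ne by blast
  next
    assume "- (\<theta> - \<theta>') \<in> P"
    hence "root_le P \<theta> \<theta>'" using root_le_add[OF t(1), of "\<theta>' - \<theta>"] t'(1) by simp
    thus False using t(2) ne by metis
  qed
qed

lemma highest_root:
  assumes irr: "irreducible_rs \<Phi>"
  shows "highest_root P \<in> P" and "\<beta> \<in> P \<Longrightarrow> root_le P \<beta> (highest_root P)"
proof -
  obtain \<beta>0 where "\<beta>0 \<in> P"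
  proof -
    have "P \<noteq> {}"
    proof
      assume "P = {}"
      hence "(UNIV :: 'a set) = {0}" using span_P by simp
      thus False using nonzero_Basis nonempty_Basis by blast
    qed
    thus ?thesis using that by blast
  qed
  then obtain \<theta> where t: "root_le P \<beta>0 \<theta>" "\<And>\<gamma>. root_le P \<theta> \<gamma> \<Longrightarrow> \<gamma> = \<theta>"
    using exists_maximal_above by blast
  have tP: "\<theta> \<in> P" using t(1) by (simp add: root_le_def)
  have le: "root_le P \<beta> \<theta>" if b: "\<beta> \<in> P" for \<beta>
  proof -
    obtain \<theta>' where t': "root_le P \<beta> \<theta>'" "\<And>\<gamma>. root_le P \<theta>' \<gamma> \<Longrightarrow> \<gamma> = \<theta>'"
      using exists_maximal_above[OF b] by blast
    hence "\<theta>' \<in> P" by (simp add: root_le_def)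
    hence "\<theta> = \<theta>'" using maximal_unique[OF irr tP t(2)] t'(2) by blast
    thus ?thesis using t' by simp
  qed
  have "highest_root P = \<theta>"
    unfolding highest_root_def
  proof (rule the_equality)
    show "\<theta> \<in> P \<and> (\<forall>\<beta>\<in>P. root_le P \<beta> \<theta>)" using tP le by blast
    show "\<gamma> = \<theta>" if "\<gamma> \<in> P \<and> (\<forall>\<beta>\<in>P. root_le P \<beta> \<gamma>)" for \<gamma>
      using that tP t(2) by blast
  qed
  thus "highest_root P \<in> P" "\<beta> \<in> P \<Longrightarrow> root_le P \<beta> (highest_root P)" using tP le by auto
qed

lemma fund_alcove_nonempty:
  assumes irr: "irreducible_rs \<Phi>"
  shows "fund_alcove P \<noteq> {}"
proof -
  let ?h = "highest_root P \<bullet> height_vec"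
  have h: "0 < ?h" using P_height[OF highest_root(1)[OF irr]] .
  \<comment> \<open>The factor gives the highest root the value 1/2.\<close>
  have "(1 / (2 * ?h)) *\<^sub>R height_vec \<in> fund_alcove P"
    using h P_height simples_P unfolding fund_alcove_def simple_roots_eq by auto
  thus ?thesis by blast
qed

lemma fund_alcove_hminus:
  assumes irr: "irreducible_rs \<Phi>" and a: "\<alpha> \<in> P"
  shows "fund_alcove P \<subseteq> hminus \<alpha> 1"
proof
  fix x assume "x \<in> fund_alcove P"
  hence x: "\<forall>\<sigma>\<in>simples. 0 < \<sigma> \<bullet> x" "highest_root P \<bullet> x < 1"
    by (auto simp: fund_alcove_def simple_roots_eq)
  have "0 < \<beta> \<bullet> x" if b: "\<beta> \<in> P" for \<beta>
  proof -
    obtain M where M: "set_mset M \<subseteq> simples" "\<Sum>\<^sub># M = \<beta>" using sum_of_simples[OF b] .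
    obtain c M' where M': "M = add_mset c M'" using M b zero_notin_P by (cases M) auto
    have "\<forall>z\<in>#M'. 0 \<le> z \<bullet> x" using x(1) M(1) M' by (auto intro: less_imp_le)
    hence "0 \<le> \<Sum>\<^sub># M' \<bullet> x" by (induction M') (auto simp: inner_add_left)
    moreover have "0 < c \<bullet> x" using x(1) M(1) M' by simp
    ultimately show ?thesis using M(2) M' by (auto simp: inner_add_left)
  qed
  hence "generic 0 x" by (simp add: generic_0_iff)
  hence "\<alpha> \<bullet> x \<le> highest_root P \<bullet> x" using root_le_inner(1) highest_root(2)[OF irr a] by blast
  thus "x \<in> hminus \<alpha> 1" using x(2) by (simp add: hminus_def)
qed

end

section \<open>Counting\<close>

text \<open>Both sides of the defining identity are the sum over regions of x to the number of
  walls. Expanding in powers of x - 1 counts pairs of a region and a set of its walls, and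
  uniqueness of coefficients identifies \<open>f_plus\<close>.\<close>

lemma f_plus_eq_card_pairs_walls:
  fixes \<Phi> P :: "'a::euclidean_space set"
  assumes fin: "finite (bdd_dom_regions \<Phi> P m)"
    and walls: "\<And>R. R \<in> bdd_dom_regions \<Phi> P m \<Longrightarrow>
      finite (nonsep_walls \<Phi> P m R) \<and> card (nonsep_walls \<Phi> P m R) \<le> DIM('a)"
    and k: "k \<le> DIM('a)"
  shows "f_plus \<Phi> P m k = int (card (pairs_walls \<Phi> P m k))"
proof -
  define D where "D = DIM('a)"
  define \<R> where "\<R> = bdd_dom_regions \<Phi> P m"
  define n where "n R = card (nonsep_walls \<Phi> P m R)" for R
  define F where "F i = (if i \<le> D then int (card (pairs_walls \<Phi> P m i)) else 0)" for i
  have nD: "n R \<le> D" if "R \<in> \<R>" for R using walls[of R] that by (simp add: n_def D_def \<R>_def)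
  have finW: "finite (nonsep_walls \<Phi> P m R)" if "R \<in> \<R>" for R
    using walls[of R] that by (simp add: \<R>_def)
  have finR: "finite \<R>" using fin by (simp add: \<R>_def)
  have card: "card (pairs_walls \<Phi> P m i) = (\<Sum>R\<in>\<R>. n R choose (D - i))" for i
  proof -
    have "pairs_walls \<Phi> P m i = (SIGMA R:\<R>. {S. S \<subseteq> nonsep_walls \<Phi> P m R \<and> card S = D - i})"
      by (auto simp: pairs_walls_def D_def \<R>_def)
    moreover have "finite {S. S \<subseteq> nonsep_walls \<Phi> P m R \<and> card S = D - i}" if "R \<in> \<R>" for R
      by (rule finite_subset[of _ "Pow (nonsep_walls \<Phi> P m R)"]) (use finW[OF that] in auto)
    ultimately have "card (pairs_walls \<Phi> P m i)
        = (\<Sum>R\<in>\<R>. card {S. S \<subseteq> nonsep_walls \<Phi> P m R \<and> card S = D - i})"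
      using finR by simp
    also have "\<dots> = (\<Sum>R\<in>\<R>. n R choose (D - i))"
      by (intro sum.cong refl) (simp add: n_subsets finW n_def)
    finally show ?thesis .
  qed
  have h: "(\<Sum>i\<le>D. real (h_plus \<Phi> P m i) * x ^ (D - i)) = (\<Sum>R\<in>\<R>. x ^ n R)" for x :: real
  proof -
    have "(\<Sum>i\<le>D. real (h_plus \<Phi> P m i) * x ^ (D - i))
        = (\<Sum>i\<le>D. real (card {R \<in> \<R>. n R = D - i}) * x ^ (D - i))"
      by (simp add: h_plus_def n_def D_def \<R>_def)
    also have "\<dots> = (\<Sum>j\<le>D. real (card {R \<in> \<R>. n R = j}) * x ^ j)"
      by (rule sum_atMost_rev[of "\<lambda>j. real (card {R \<in> \<R>. n R = j}) * x ^ j"])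
    also have "\<dots> = (\<Sum>j\<le>D. \<Sum>R\<in>{R \<in> \<R>. n R = j}. x ^ n R)" by simp
    also have "\<dots> = (\<Sum>R\<in>\<R>. x ^ n R)" using finR nD by (intro sum.group) auto
    finally show ?thesis .
  qed
  have F: "(\<Sum>i\<le>D. real_of_int (F i) * (x - 1) ^ (D - i)) = (\<Sum>R\<in>\<R>. x ^ n R)" for x :: real
  proof -
    have "(\<Sum>i\<le>D. real_of_int (F i) * (x - 1) ^ (D - i))
        = (\<Sum>i\<le>D. (\<Sum>R\<in>\<R>. real (n R choose (D - i))) * (x - 1) ^ (D - i))"
      by (intro sum.cong) (auto simp: F_def card)
    also have "\<dots> = (\<Sum>j\<le>D. (\<Sum>R\<in>\<R>. real (n R choose j)) * (x - 1) ^ j)"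
      by (rule sum_atMost_rev[of "\<lambda>j. (\<Sum>R\<in>\<R>. real (n R choose j)) * (x - 1) ^ j"])
    also have "\<dots> = (\<Sum>R\<in>\<R>. \<Sum>j\<le>D. real (n R choose j) * (x - 1) ^ j)"
      by (subst sum.swap) (simp add: sum_distrib_right)
    also have "\<dots> = (\<Sum>R\<in>\<R>. x ^ n R)"
      by (intro sum.cong refl binomial_expand_minus_1 nD)
    finally show ?thesis .
  qed
  have "f_plus \<Phi> P m = F"
    unfolding f_plus_def D_def[symmetric]
  proof (rule the_equality)
    show "(\<forall>i>D. F i = 0) \<and> (\<forall>x::real. (\<Sum>i\<le>D. real_of_int (F i) * (x - 1) ^ (D - i)) =
        (\<Sum>i\<le>D. real (h_plus \<Phi> P m i) * x ^ (D - i)))"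
      using F h by (simp add: F_def)
  next
    fix G :: "nat \<Rightarrow> int"
    assume G: "(\<forall>i>D. G i = 0) \<and> (\<forall>x::real. (\<Sum>i\<le>D. real_of_int (G i) * (x - 1) ^ (D - i)) =
        (\<Sum>i\<le>D. real (h_plus \<Phi> P m i) * x ^ (D - i)))"
    have rev: "(\<Sum>i\<le>D. real_of_int (H i) * y ^ (D - i)) = (\<Sum>j\<le>D. real_of_int (H (D - j)) * y ^ j)"
      for H :: "nat \<Rightarrow> int" and y :: real
      using sum_atMost_rev[of "\<lambda>j. real_of_int (H (D - j)) * y ^ j" D] by simp
    have "(\<Sum>j\<le>D. real_of_int (G (D - j)) * y ^ j) = (\<Sum>j\<le>D. real_of_int (F (D - j)) * y ^ j)" for y :: real
    proof -
      \<comment> \<open>Evaluating at y + 1 turns powers of x - 1 into powers of y, so polynomial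
        coefficients can be compared.\<close>
      have "(\<Sum>i\<le>D. real_of_int (G i) * (y + 1 - 1) ^ (D - i)) = (\<Sum>i\<le>D. real_of_int (F i) * (y + 1 - 1) ^ (D - i))"
        using G F h by metis
      thus ?thesis by (simp add: rev)
    qed
    hence "\<forall>j\<le>D. real_of_int (G (D - j)) = real_of_int (F (D - j))"
      using polyfun_eq_coeffs[of "\<lambda>j. real_of_int (G (D - j))" D "\<lambda>j. real_of_int (F (D - j))"] by blast
    hence "G i = F i" if "i \<le> D" for i
      using that by (metis diff_diff_cancel diff_le_self of_int_eq_iff)
    moreover have "G i = F i" if "i > D" for i using that G by (simp add: F_def)
    ultimately show "G = F" by (metis ext not_le)
  qed
  thus ?thesis using k by (simp add: F_def D_def)
qed

context positive_roots
begin

lemma finite_chains: "finite {J. pos_geom_chain P m J}"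
proof (rule finite_subset)
  show "{J. pos_geom_chain P m J} \<subseteq> {J. \<forall>i. (i \<in> {..m} \<longrightarrow> J i \<in> Pow P) \<and> (i \<notin> {..m} \<longrightarrow> J i = {})}"
    by (auto simp: pos_geom_chain_def is_ideal_def)
  show "finite \<dots>" by (rule finite_set_of_finite_funs) (auto simp: finite_P)
qed

lemma finite_bdd_dom_regions: "finite (bdd_dom_regions \<Phi> P m)"
proof -
  let ?X = "{x. generic m x \<and> simples_le m x \<and> contact_roots m x = {}}"
  have "cell m x = cell m y \<longleftrightarrow> chain_of m x = chain_of m y" if "x \<in> ?X" "y \<in> ?X" for x y
    using that cell_eq_iff_chain_contact by simp
  hence "bij_betw (chain_of m \<circ> inv_into ?X (cell m)) (cell m ` ?X) (chain_of m ` ?X)"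
    by (rule bij_betw_images)
  moreover have "chain_of m ` ?X \<subseteq> {J. pos_geom_chain P m J}" using pos_geom_chain_of by blast
  hence "finite (chain_of m ` ?X)" using finite_chains finite_subset by blast
  ultimately show ?thesis unfolding bdd_dom_regions_eq using bij_betw_finite by blast
qed

text \<open>Taking \<open>T\<close> to be the full set of indecomposable roots makes all of them
  contact roots of a single point.\<close>

lemma independent_indecomposable:
  assumes "1 \<le> m" "pos_geom_chain P m J"
  shows "independent {\<alpha>. indecomposable P m J \<alpha>}"
proof -
  obtain x where "generic m x" "contact_roots m x = {\<alpha>. indecomposable P m J \<alpha>}"
    using exists_generic[OF assms order_refl] by blast
  thus ?thesis using independent_contact_roots by metis
qed

lemma card_faces_plus:
  assumes "1 \<le> m" "k \<le> DIM('a)"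
  shows "card (faces_plus P m k) = card (pairs_chains P m k)"
  unfolding faces_plus_eq[OF assms] pairs_chains_eq[OF assms(1)]
  by (rule card_images_eq) (simp add: cell_eq_iff_chain_contact)

text \<open>A point yields the region with its chain, reached by giving up all contact, together
  with the walls of its contact roots. As \<open>hyp_inj\<close> recovers a root from its wall, this
  pair has the same fibres as the pair of chain and contact roots.\<close>

lemma card_pairs_walls:
  assumes irr: "irreducible_rs \<Phi>" and m: "1 \<le> m"
  shows "card (pairs_walls \<Phi> P m k) = card (pairs_chains P m k)"
proof -
  let ?X = "{x. generic m x \<and> simples_le m x \<and> card (contact_roots m x) = DIM('a) - k}"
  let ?H = "\<lambda>\<alpha>. hyp \<alpha> (real m)"
  have inj: "inj_on ?H P" using hyp_inj by (auto intro: inj_onI)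
  have zP: "contact_roots m x \<subseteq> P" for x by (auto simp: contact_roots_def)
  have walls: "nonsep_walls \<Phi> P m (cell m x) = ?H ` {\<alpha>. indecomposable P m (chain_of m x) \<alpha>}"
    if "generic m x" "simples_le m x" "contact_roots m x = {}" for x
    using nonsep_walls_cell[OF m that fund_alcove_nonempty[OF irr] fund_alcove_hminus[OF irr]] .
  have "\<exists>y. generic m y \<and> simples_le m y \<and> chain_of m y = chain_of m x \<and> contact_roots m y = {}" if "generic m x" "simples_le m x" for x
    using exists_generic[OF m pos_geom_chain_of[OF that], of "{}"] by blast
  then obtain e where e: "\<And>x. generic m x \<Longrightarrow> simples_le m x \<Longrightarrow>
      generic m (e x) \<and> simples_le m (e x) \<and> chain_of m (e x) = chain_of m x \<and> contact_roots m (e x) = {}"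
    by metis
  have "pairs_walls \<Phi> P m k = (\<lambda>x. (cell m (e x), ?H ` contact_roots m x)) ` ?X"
  proof (intro equalityI subsetI)
    fix p assume "p \<in> pairs_walls \<Phi> P m k"
    then obtain R S where p: "p = (R, S)" "R \<in> bdd_dom_regions \<Phi> P m" "S \<subseteq> nonsep_walls \<Phi> P m R"
      "card S = DIM('a) - k" by (auto simp: pairs_walls_def)
    obtain y where y: "generic m y" "simples_le m y" "contact_roots m y = {}" "R = cell m y"
      using p(2) unfolding bdd_dom_regions_eq by blast
    have "S \<subseteq> ?H ` {\<alpha>. indecomposable P m (chain_of m y) \<alpha>}" using p(3) walls[OF y(1-3)] y(4) by simp
    then obtain T where T: "T \<subseteq> {\<alpha>. indecomposable P m (chain_of m y) \<alpha>}" "S = ?H ` T"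
      by (auto simp: subset_image_iff)
    obtain x where x: "generic m x" "simples_le m x" "chain_of m x = chain_of m y" "contact_roots m x = T"
      using exists_generic[OF m pos_geom_chain_of[OF y(1,2)] T(1)] .
    have "card (contact_roots m x) = DIM('a) - k"
      using card_image[OF inj_on_subset[OF inj zP[of x]]] p(4) T(2) x(4) by simp
    moreover have "cell m (e x) = R"
      using e[OF x(1,2)] cell_eq_iff_chain_contact[of m "e x" y] x(3) y by simp
    ultimately show "p \<in> (\<lambda>x. (cell m (e x), ?H ` contact_roots m x)) ` ?X"
      using x T p(1) by (intro image_eqI[of _ _ x]) auto
  next
    fix p assume "p \<in> (\<lambda>x. (cell m (e x), ?H ` contact_roots m x)) ` ?X"
    then obtain x where x: "generic m x" "simples_le m x" "card (contact_roots m x) = DIM('a) - k"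
      and p: "p = (cell m (e x), ?H ` contact_roots m x)" by blast
    have ex: "generic m (e x)" "simples_le m (e x)" "chain_of m (e x) = chain_of m x" "contact_roots m (e x) = {}"
      using e[OF x(1,2)] by auto
    have "cell m (e x) \<in> bdd_dom_regions \<Phi> P m" unfolding bdd_dom_regions_eq using ex by blast
    moreover have "?H ` contact_roots m x \<subseteq> nonsep_walls \<Phi> P m (cell m (e x))"
      unfolding walls[OF ex(1,2,4)] ex(3) using contact_roots_indecomposable[OF x(1) m] by (intro image_mono)
    moreover have "card (?H ` contact_roots m x) = DIM('a) - k"
      using card_image[OF inj_on_subset[OF inj zP[of x]]] x(3) by simp
    ultimately show "p \<in> pairs_walls \<Phi> P m k" unfolding pairs_walls_def p by simp
  qed
  moreover have "card ((\<lambda>x. (cell m (e x), ?H ` contact_roots m x)) ` ?X) = card ((\<lambda>x. (chain_of m x, contact_roots m x)) ` ?X)"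
  proof (rule card_images_eq)
    fix x y assume "x \<in> ?X" "y \<in> ?X"
    hence x: "generic m x" "simples_le m x" and y: "generic m y" "simples_le m y" by auto
    have "cell m (e x) = cell m (e y) \<longleftrightarrow> chain_of m x = chain_of m y"
      using e[OF x] e[OF y] cell_eq_iff_chain_contact[of m "e x" "e y"] by simp
    moreover have "?H ` contact_roots m x = ?H ` contact_roots m y \<longleftrightarrow> contact_roots m x = contact_roots m y"
      using inj_on_image_eq_iff[OF inj zP zP] .
    ultimately show "(cell m (e x), ?H ` contact_roots m x) = (cell m (e y), ?H ` contact_roots m y) \<longleftrightarrow>
        (chain_of m x, contact_roots m x) = (chain_of m y, contact_roots m y)" by simp
  qed
  ultimately show ?thesis using pairs_chains_eq[OF m] by simp
qed

lemma nonsep_walls_bound: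
  assumes irr: "irreducible_rs \<Phi>" and m: "1 \<le> m" and R: "R \<in> bdd_dom_regions \<Phi> P m"
  shows "finite (nonsep_walls \<Phi> P m R) \<and> card (nonsep_walls \<Phi> P m R) \<le> DIM('a)"
proof -
  obtain x where x: "generic m x" "simples_le m x" "contact_roots m x = {}" "R = cell m x"
    using R unfolding bdd_dom_regions_eq by blast
  let ?I = "{\<alpha>. indecomposable P m (chain_of m x) \<alpha>}"
  have eq: "nonsep_walls \<Phi> P m R = (\<lambda>\<alpha>. hyp \<alpha> (real m)) ` ?I"
    using nonsep_walls_cell[OF m x(1-3) fund_alcove_nonempty[OF irr] fund_alcove_hminus[OF irr]] x(4) by simp
  have "finite ?I \<and> card ?I \<le> DIM('a)"
    using independent_bound[OF independent_indecomposable[OF m pos_geom_chain_of[OF x(1,2)]]] by simp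
  thus ?thesis unfolding eq using card_image_le[of ?I "\<lambda>\<alpha>. hyp \<alpha> (real m)"] by auto
qed

end

theorem theorem5p2:
  fixes \<Phi> P :: "'a::euclidean_space set" and m k :: nat
  assumes "root_system \<Phi>" and "crystallographic \<Phi>" and "irreducible_rs \<Phi>"
    and "positive_system \<Phi> P" and "m \<ge> 1" and "k \<le> DIM('a)"
  shows "f_plus \<Phi> P m k = int (card (pairs_walls \<Phi> P m k)) \<and>
         f_plus \<Phi> P m k = int (card (pairs_chains P m k)) \<and>
         f_plus \<Phi> P m k = int (card (faces_plus P m k))"
proof -
  interpret positive_roots \<Phi> P using assms by unfold_locales
  have "f_plus \<Phi> P m k = int (card (pairs_walls \<Phi> P m k))"
    using finite_bdd_dom_regions nonsep_walls_bound[OF assms(3,5)] assms(6)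
    by (rule f_plus_eq_card_pairs_walls)
  thus ?thesis using card_pairs_walls[OF assms(3,5)] card_faces_plus[OF assms(5,6)] by simp
qed

end
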